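(* Let $X=\mathbb{P}^{n_1}\times\dots\times\mathbb{P}^{n_r}$ be a multiprojective space over $\mathbb{C}$ and let $d=n_1+\dots+n_r$. Let $\mathcal{E}$ be a normalized vector bundle of rank two on $X$. If, for every $i$ with $1\le i\le d-1$, $$H^i(X,\mathcal{E}\otimes\mathcal{O}_X(t_1,\dots,t_r))=0$$ whenever $t_1,\dots,t_r$ are integers with $-n_j\le t_j\le0$ for all $j$ and $\sum_{j=1}^r t_j=-i-1$, then $\mathcal{E}$ splits as a direct sum of line bundles.
   Context: A vector bundle $\mathcal{E}$ on $X=\mathbb{P}^{n_1}\times\dots\times\mathbb{P}^{n_r}$ is called normalized if $H^0(X,\mathcal{E})\ne0$ and $H^0(X,\mathcal{E}\otimes\mathcal{O}_X(a_1,\dots,a_r))=0$ whenever $a_1,\dots,a_r$ are non-positive integers not all equal to zero. Here $\mathcal{O}_X(a_1,\dots,a_r)$ is the line bundle of multidegree $(a_1,\dots,a_r)$. *)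

theory Defs
  imports
    "HOL-Analysis.Abstract_Topology"
    "HOL-Analysis.Function_Topology"
    "HOL-Library.Poly_Mapping"
    "Jordan_Normal_Form.Matrix"
begin

section \<open>Multiprojective space\<close>

text \<open>
  A list \<open>ns = [n\<^sub>1, \<dots>, n\<^sub>r]\<close> stands for the multiprojective space
  \<open>X = P(n\<^sub>1) \<times> \<dots> \<times> P(n\<^sub>r)\<close> over the complex numbers, regarded as a classical algebraic
  variety. Factors are numbered from 0. The homogeneous coordinate with index \<open>(j, k)\<close>,
  where \<open>j < r\<close> and \<open>k \<le> n\<^sub>j\<close>, is the \<open>k\<close>-th coordinate of the \<open>j\<close>-th factor; all other entries
  of a coordinate vector are 0 by convention.
\<close>

type_synonym coords = "nat \<times> nat \<Rightarrow> complex"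
type_synonym point = "coords set"

definition coord_index :: "nat list \<Rightarrow> (nat \<times> nat) set" where
  "coord_index ns = {(j, k). j < length ns \<and> k \<le> ns ! j}"

definition homog_coords :: "nat list \<Rightarrow> coords set" where
  "homog_coords ns = {v. (\<forall>i. i \<notin> coord_index ns \<longrightarrow> v i = 0) \<and>
                         (\<forall>j<length ns. \<exists>k\<le>ns ! j. v (j, k) \<noteq> 0)}"

definition proportional :: "nat list \<Rightarrow> (coords \<times> coords) set" where
  "proportional ns = {(v, w). v \<in> homog_coords ns \<and> w \<in> homog_coords ns \<and>
     (\<exists>c. (\<forall>j<length ns. c j \<noteq> 0) \<and> (\<forall>j k. w (j, k) = c j * v (j, k)))}"

definition mproj :: "nat list \<Rightarrow> point set" where
  "mproj ns = homog_coords ns // proportional ns"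

text \<open>An arbitrary choice of homogeneous coordinates; it is only used in expressions that do
  not depend on the choice.\<close>

definition hcoord :: "point \<Rightarrow> coords" where
  "hcoord P = (SOME v. v \<in> P)"

type_synonym mpoly = "((nat \<times> nat) \<Rightarrow>\<^sub>0 nat) \<Rightarrow>\<^sub>0 complex"

definition mpoly_eval :: "mpoly \<Rightarrow> coords \<Rightarrow> complex" where
  "mpoly_eval f v =
     (\<Sum>m\<in>Poly_Mapping.keys f.
        Poly_Mapping.lookup f m *
          (\<Prod>i\<in>Poly_Mapping.keys m. v i ^ Poly_Mapping.lookup m i))"

definition multihomogeneous :: "nat list \<Rightarrow> (nat \<Rightarrow> nat) \<Rightarrow> mpoly \<Rightarrow> bool" where
  "multihomogeneous ns a f \<longleftrightarrow>
     (\<forall>m\<in>Poly_Mapping.keys f. Poly_Mapping.keys m \<subseteq> coord_index ns \<and>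
        (\<forall>j<length ns. (\<Sum>k\<le>ns ! j. Poly_Mapping.lookup m (j, k)) = a j))"

text \<open>The open sets are the unions of the sets of points at which a multihomogeneous polynomial
  does not vanish (these sets are closed under binary intersections).\<close>

definition zariski :: "nat list \<Rightarrow> point topology" where
  "zariski ns = topology_generated_by
     {{P \<in> mproj ns. mpoly_eval f (hcoord P) \<noteq> 0} | f a. multihomogeneous ns a f}"

definition regular_on :: "nat list \<Rightarrow> point set \<Rightarrow> (point \<Rightarrow> complex) \<Rightarrow> bool" where
  "regular_on ns U \<phi> \<longleftrightarrow>
     (\<forall>P\<in>U. \<exists>V a g h. openin (zariski ns) V \<and> P \<in> V \<and> V \<subseteq> U \<and>
        multihomogeneous ns a g \<and> multihomogeneous ns a h \<and>
        (\<forall>Q\<in>V. mpoly_eval h (hcoord Q) \<noteq> 0 \<and>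
                \<phi> Q = mpoly_eval g (hcoord Q) / mpoly_eval h (hcoord Q)))"

definition regular_mat_on ::
    "nat list \<Rightarrow> nat \<Rightarrow> point set \<Rightarrow> (point \<Rightarrow> complex mat) \<Rightarrow> bool" where
  "regular_mat_on ns m U M \<longleftrightarrow>
     (\<forall>P\<in>U. M P \<in> carrier_mat m m) \<and>
     (\<forall>i<m. \<forall>j<m. regular_on ns U (\<lambda>P. M P $$ (i, j)))"

definition regular_vec_on ::
    "nat list \<Rightarrow> nat \<Rightarrow> point set \<Rightarrow> (point \<Rightarrow> complex vec) \<Rightarrow> bool" where
  "regular_vec_on ns m U s \<longleftrightarrow>
     (\<forall>P\<in>U. s P \<in> carrier_vec m) \<and>
     (\<forall>i<m. regular_on ns U (\<lambda>P. s P $ i))"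


section \<open>Algebraic vector bundles\<close>

text \<open>
  A vector bundle is given by trivialisations and transition matrices: every point \<open>x\<close> has an open
  neighbourhood \<open>nbhd E x\<close> over which \<open>E\<close> is trivialised, and \<open>trans E x y\<close> takes components in
  the trivialisation at \<open>y\<close> to components in the trivialisation at \<open>x\<close>. Indexing
  trivialisations by the points of \<open>X\<close> loses no generality: from an arbitrary
  trivialising cover choose for each point a member that contains it. Two bundles presented in
  this way have the sets \<open>nbhd E x \<inter> nbhd F x\<close> as a common trivialising cover.
\<close>

record vbundle =
  rank :: nat
  nbhd :: "point \<Rightarrow> point set"
  trans :: "point \<Rightarrow> point \<Rightarrow> point \<Rightarrow> complex mat"

definition vector_bundle :: "nat list \<Rightarrow> vbundle \<Rightarrow> bool" where
  "vector_bundle ns E \<longleftrightarrow>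
     (\<forall>x\<in>mproj ns. openin (zariski ns) (nbhd E x) \<and> x \<in> nbhd E x) \<and>
     (\<forall>x\<in>mproj ns. \<forall>y\<in>mproj ns.
        regular_mat_on ns (rank E) (nbhd E x \<inter> nbhd E y) (trans E x y)) \<and>
     (\<forall>x\<in>mproj ns. \<forall>P\<in>nbhd E x. trans E x x P = 1\<^sub>m (rank E)) \<and>
     (\<forall>x\<in>mproj ns. \<forall>y\<in>mproj ns. \<forall>z\<in>mproj ns. \<forall>P\<in>nbhd E x \<inter> nbhd E y \<inter> nbhd E z.
        trans E x y P * trans E y z P = trans E x z P)"

text \<open>An isomorphism is given on \<open>nbhd E x \<inter> nbhd F x\<close> by an invertible matrix \<open>h x\<close> of
  regular functions, with inverse \<open>k x\<close>.\<close>

definition vb_iso :: "nat list \<Rightarrow> vbundle \<Rightarrow> vbundle \<Rightarrow> bool" where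
  "vb_iso ns E F \<longleftrightarrow> rank E = rank F \<and>
     (\<exists>h k. (\<forall>x\<in>mproj ns.
          regular_mat_on ns (rank E) (nbhd E x \<inter> nbhd F x) (h x) \<and>
          regular_mat_on ns (rank E) (nbhd E x \<inter> nbhd F x) (k x) \<and>
          (\<forall>P\<in>nbhd E x \<inter> nbhd F x.
             h x P * k x P = 1\<^sub>m (rank E) \<and> k x P * h x P = 1\<^sub>m (rank E))) \<and>
        (\<forall>x\<in>mproj ns. \<forall>y\<in>mproj ns.
          \<forall>P\<in>nbhd E x \<inter> nbhd F x \<inter> (nbhd E y \<inter> nbhd F y).
             h x P * trans E x y P = trans F x y P * h y P))"

definition vb_sum :: "vbundle \<Rightarrow> vbundle \<Rightarrow> vbundle" where
  "vb_sum E F =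
     \<lparr>rank = rank E + rank F,
      nbhd = (\<lambda>x. nbhd E x \<inter> nbhd F x),
      trans = (\<lambda>x y P. four_block_mat (trans E x y P) (0\<^sub>m (rank E) (rank F))
                                       (0\<^sub>m (rank F) (rank E)) (trans F x y P))\<rparr>"

definition kronecker_mat :: "complex mat \<Rightarrow> complex mat \<Rightarrow> complex mat" where
  "kronecker_mat A B =
     mat (dim_row A * dim_row B) (dim_col A * dim_col B)
       (\<lambda>(i, j). A $$ (i div dim_row B, j div dim_col B) *
                 B $$ (i mod dim_row B, j mod dim_col B))"

definition vb_tensor :: "vbundle \<Rightarrow> vbundle \<Rightarrow> vbundle" where
  "vb_tensor E F =
     \<lparr>rank = rank E * rank F,
      nbhd = (\<lambda>x. nbhd E x \<inter> nbhd F x),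
      trans = (\<lambda>x y P. kronecker_mat (trans E x y P) (trans F x y P))\<rparr>"

definition is_line_bundle :: "nat list \<Rightarrow> vbundle \<Rightarrow> bool" where
  "is_line_bundle ns L \<longleftrightarrow> vector_bundle ns L \<and> rank L = 1"

definition splits_two :: "nat list \<Rightarrow> vbundle \<Rightarrow> bool" where
  "splits_two ns E \<longleftrightarrow>
     (\<exists>L M. is_line_bundle ns L \<and> is_line_bundle ns M \<and> vb_iso ns E (vb_sum L M))"

text \<open>
  The line bundle \<open>O(a\<^sub>1, \<dots>, a\<^sub>r)\<close>. Near \<open>x\<close> it is trivialised on the standard affine chart
  where the coordinates \<open>(j, chart x j)\<close> do not vanish: a section, viewed as a multihomogeneous
  function \<open>f\<close> of multidegree \<open>a\<close>, has there the component \<open>f\<close> divided by the product of the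
  powers \<open>v (j, chart x j) powi a j\<close>. Hence \<open>O(1)\<close> has the linear forms as global sections.
\<close>

definition chart :: "point \<Rightarrow> nat \<Rightarrow> nat" where
  "chart x j = (LEAST k. hcoord x (j, k) \<noteq> 0)"

definition O_bundle :: "nat list \<Rightarrow> (nat \<Rightarrow> int) \<Rightarrow> vbundle" where
  "O_bundle ns a =
     \<lparr>rank = 1,
      nbhd = (\<lambda>x. {P \<in> mproj ns. \<forall>j<length ns. hcoord P (j, chart x j) \<noteq> 0}),
      trans = (\<lambda>x y P. mat 1 1 (\<lambda>_. \<Prod>j<length ns.
                 (hcoord P (j, chart y j) / hcoord P (j, chart x j)) powi a j))\<rparr>"

abbreviation twist :: "nat list \<Rightarrow> vbundle \<Rightarrow> (nat \<Rightarrow> int) \<Rightarrow> vbundle" where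
  "twist ns E a \<equiv> vb_tensor E (O_bundle ns a)"


section \<open>Sections and cohomology\<close>

text \<open>A section over an open set \<open>U\<close> is the family of its components \<open>s x\<close> in the
  trivialisations at the points \<open>x\<close>. Only the values \<open>s x P\<close> with \<open>P \<in> U \<inter> nbhd E x\<close> are
  meaningful, so restriction to a smaller open set does not change \<open>s\<close>, and sections are
  compared on these values only.\<close>

type_synonym vb_section = "point \<Rightarrow> point \<Rightarrow> complex vec"

definition vb_sections :: "nat list \<Rightarrow> vbundle \<Rightarrow> point set \<Rightarrow> vb_section set" where
  "vb_sections ns E U =
     {s. (\<forall>x\<in>mproj ns. regular_vec_on ns (rank E) (U \<inter> nbhd E x) (s x)) \<and>
         (\<forall>x\<in>mproj ns. \<forall>y\<in>mproj ns. \<forall>P\<in>U \<inter> nbhd E x \<inter> nbhd E y.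
            s x P = trans E x y P *\<^sub>v s y P)}"

definition section_eq ::
    "nat list \<Rightarrow> vbundle \<Rightarrow> point set \<Rightarrow> vb_section \<Rightarrow> vb_section \<Rightarrow> bool" where
  "section_eq ns E U s t \<longleftrightarrow> (\<forall>x\<in>mproj ns. \<forall>P\<in>U \<inter> nbhd E x. s x P = t x P)"

definition zero_section :: "vbundle \<Rightarrow> vb_section" where
  "zero_section E = (\<lambda>x P. 0\<^sub>v (rank E))"

definition H0_vanishes :: "nat list \<Rightarrow> vbundle \<Rightarrow> bool" where
  "H0_vanishes ns E \<longleftrightarrow>
     (\<forall>s\<in>vb_sections ns E (mproj ns). section_eq ns E (mproj ns) s (zero_section E))"

text \<open>
  Cohomology of the sheaf of sections is Cech cohomology as in Serre's FAC: the direct limit,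
  over all open covers ordered by refinement, of the cohomology groups of the complexes of Cech
  cochains. A Cech \<open>i\<close>-simplex of a cover is an arbitrary list of \<open>i + 1\<close> members of the cover,
  and the cochains are not required to be alternating.
\<close>

definition open_cover :: "nat list \<Rightarrow> point set set \<Rightarrow> bool" where
  "open_cover ns \<U> \<longleftrightarrow> (\<forall>U\<in>\<U>. openin (zariski ns) U) \<and> \<Union>\<U> = mproj ns"

definition cech_simplices :: "point set set \<Rightarrow> nat \<Rightarrow> point set list set" where
  "cech_simplices \<U> i = {\<sigma>. length \<sigma> = Suc i \<and> set \<sigma> \<subseteq> \<U>}"

type_synonym cech_cochain = "point set list \<Rightarrow> vb_section"

definition cech_cochains ::
    "nat list \<Rightarrow> vbundle \<Rightarrow> point set set \<Rightarrow> nat \<Rightarrow> cech_cochain set" where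
  "cech_cochains ns E \<U> i =
     {c. \<forall>\<sigma>\<in>cech_simplices \<U> i. c \<sigma> \<in> vb_sections ns E (\<Inter>(set \<sigma>))}"

definition cochain_eq ::
    "nat list \<Rightarrow> vbundle \<Rightarrow> point set set \<Rightarrow> nat \<Rightarrow> cech_cochain \<Rightarrow> cech_cochain \<Rightarrow> bool" where
  "cochain_eq ns E \<U> i c c' \<longleftrightarrow>
     (\<forall>\<sigma>\<in>cech_simplices \<U> i. section_eq ns E (\<Inter>(set \<sigma>)) (c \<sigma>) (c' \<sigma>))"

definition cech_diff :: "vbundle \<Rightarrow> cech_cochain \<Rightarrow> cech_cochain" where
  "cech_diff E c = (\<lambda>\<sigma> x P. vec (rank E)
     (\<lambda>l. \<Sum>k<length \<sigma>. (-1) ^ k * (c (take k \<sigma> @ drop (Suc k) \<sigma>) x P $ l)))"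

definition cech_cocycles ::
    "nat list \<Rightarrow> vbundle \<Rightarrow> point set set \<Rightarrow> nat \<Rightarrow> cech_cochain set" where
  "cech_cocycles ns E \<U> i =
     {c \<in> cech_cochains ns E \<U> i.
        cochain_eq ns E \<U> (Suc i) (cech_diff E c) (\<lambda>_. zero_section E)}"

definition cech_coboundaries ::
    "nat list \<Rightarrow> vbundle \<Rightarrow> point set set \<Rightarrow> nat \<Rightarrow> cech_cochain set" where
  "cech_coboundaries ns E \<U> i =
     {c \<in> cech_cochains ns E \<U> i.
        (case i of
           0 \<Rightarrow> cochain_eq ns E \<U> 0 c (\<lambda>_. zero_section E)
         | Suc j \<Rightarrow> \<exists>b\<in>cech_cochains ns E \<U> j. cochain_eq ns E \<U> i c (cech_diff E b))}"

definition refinement_map ::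
    "point set set \<Rightarrow> point set set \<Rightarrow> (point set \<Rightarrow> point set) \<Rightarrow> bool" where
  "refinement_map \<V> \<U> \<tau> \<longleftrightarrow> (\<forall>V\<in>\<V>. \<tau> V \<in> \<U> \<and> V \<subseteq> \<tau> V)"

text \<open>The direct limit of the groups \<open>H\<^sup>i(\<U>, E)\<close> is zero if and only if every class of every
  \<open>H\<^sup>i(\<U>, E)\<close> becomes zero on some refinement of \<open>\<U>\<close>.\<close>

definition cohomology_vanishes :: "nat list \<Rightarrow> vbundle \<Rightarrow> nat \<Rightarrow> bool" where
  "cohomology_vanishes ns E i \<longleftrightarrow>
     (\<forall>\<U>. open_cover ns \<U> \<longrightarrow>
        (\<forall>c\<in>cech_cocycles ns E \<U> i.
           \<exists>\<V> \<tau>. open_cover ns \<V> \<and> refinement_map \<V> \<U> \<tau> \<and>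
             (\<lambda>\<sigma>. c (map \<tau> \<sigma>)) \<in> cech_coboundaries ns E \<V> i))"

definition normalized :: "nat list \<Rightarrow> vbundle \<Rightarrow> bool" where
  "normalized ns E \<longleftrightarrow> \<not> H0_vanishes ns E \<and>
     (\<forall>a. (\<forall>j<length ns. a j \<le> 0) \<and> (\<exists>j<length ns. a j \<noteq> 0) \<longrightarrow>
        H0_vanishes ns (twist ns E a))"

end

theory Submission
  imports Defs "HOL-Analysis.Continuum_Not_Denumerable"
    "HOL-Computational_Algebra.Fundamental_Theorem_Algebra" "HOL-Library.Function_Algebras"
begin

text \<open>
  Let \<open>s\<close> be a nonzero section of \<open>E\<close>. Multiplication with the generator of \<open>H\<^sup>d(X, \<omega>)\<close> is a
  composition of connecting maps of the Koszul complexes of the factors, and the vanishing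
  hypotheses together with \<open>H\<^sup>0(E(a)) = 0\<close> make all of these maps injective on \<open>s\<close>. Hence \<open>s\<close>
  divided by the product of all coordinates is not a sum of sections of \<open>E \<otimes> \<omega>\<close> that extend over
  a coordinate hyperplane, and some linear functional \<open>\<phi>\<close> vanishes on these sums and is 1 at this
  quotient. As in Macaulay's inverse systems, the sums of \<open>\<phi>(e x\<^sup>-\<^sup>m\<^sup>-\<^sup>1) x\<^sup>m\<close> over all monomials define
  a graded module map from the global sections of the twists of \<open>E\<close> to polynomials which sends
  \<open>s\<close> to 1. By the Nullstellensatz local sections extend to global sections of twists after
  multiplication with a power of a polynomial, so the module map is a morphism \<open>E \<rightarrow> O\<close> that splits
  \<open>s\<close>. Since \<open>E\<close> has rank two, the kernel is a line bundle, isomorphic to \<open>det E\<close>.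
\<close>

section \<open>Alternating sums and the Koszul complex\<close>

text \<open>Serre duality is the hidden guide: a retraction of the section is a global section of
  the dual bundle, that is, a functional on the top cohomology of E tensor \<omega>. Neither duality
  nor long exact sequences are invoked. Connecting maps are explicit cochains, and functions on the
  locus where all coordinates are nonzero, taken modulo the space \<open>W\<close>, stand in for the
  top cohomology. Only the survival of one element matters, so an arbitrary linear functional
  suffices and no finiteness theorem enters. With l = i + 1 the hypotheses and the normalization
  take one form: vanishing at length l for all t in the box -n_j \<le> t_j \<le> 0 with sum -l,
  where l = 1 is the normalization. The obstacle: when a factor is treated, the previous ones
  already carry degree -n_j - 1, outside of the box. A Koszul complex in such a factor trades this
  degree for 0, ..., -n_j at the price of n_j cohomological degrees. Cohomology is a limit over
  covers, so each use of a vanishing refines the cover; the choice of an invertible coordinate on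
  every member is carried along.\<close>

fun alt_sum :: "('u list \<Rightarrow> 'a::comm_ring_1) \<Rightarrow> 'u list \<Rightarrow> 'a" where
  "alt_sum c [] = 0"
| "alt_sum c (u # \<sigma>) = c \<sigma> - alt_sum (\<lambda>\<rho>. c (u # \<rho>)) \<sigma>"

lemma alt_sum_cong:
  "(\<And>\<rho>. Suc (length \<rho>) = length \<sigma> \<Longrightarrow> set \<rho> \<subseteq> set \<sigma> \<Longrightarrow> c \<rho> = c' \<rho>) \<Longrightarrow> alt_sum c \<sigma> = alt_sum c' \<sigma>"
proof (induction \<sigma> arbitrary: c c')
  case (Cons u \<sigma>)
  have "alt_sum (\<lambda>\<rho>. c (u # \<rho>)) \<sigma> = alt_sum (\<lambda>\<rho>. c' (u # \<rho>)) \<sigma>"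
    by (rule Cons.IH) (rule Cons.prems, auto)
  moreover have "c \<sigma> = c' \<sigma>" by (rule Cons.prems) auto
  ultimately show ?case by simp
qed simp

lemma alt_sum_zero [simp]: "alt_sum (\<lambda>_. 0) \<sigma> = 0"
  by (induction \<sigma>) auto

lemma alt_sum_diff: "alt_sum (\<lambda>\<rho>. c \<rho> - c' \<rho>) \<sigma> = alt_sum c \<sigma> - alt_sum c' \<sigma>"
  by (induction \<sigma> arbitrary: c c') (auto simp: algebra_simps)

lemma alt_sum_add: "alt_sum (\<lambda>\<rho>. c \<rho> + c' \<rho>) \<sigma> = alt_sum c \<sigma> + alt_sum c' \<sigma>"
  by (induction \<sigma> arbitrary: c c') (auto simp: algebra_simps)

lemma alt_sum_cmult: "alt_sum (\<lambda>\<rho>. a * c \<rho>) \<sigma> = a * alt_sum c \<sigma>"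
  by (induction \<sigma> arbitrary: c) (auto simp: algebra_simps)

lemma alt_sum_sum: "alt_sum (\<lambda>\<rho>. \<Sum>i\<in>I. c i \<rho>) \<sigma> = (\<Sum>i\<in>I. alt_sum (c i) \<sigma>)"
  by (induction I rule: infinite_finite_induct) (auto simp: alt_sum_add)

lemma alt_sum_map: "alt_sum c (map \<tau> \<sigma>) = alt_sum (\<lambda>\<rho>. c (map \<tau> \<rho>)) \<sigma>"
  by (induction \<sigma> arbitrary: c) auto

text \<open>Peeling off the first vertex produces \<open>alt_sum c \<sigma>\<close> twice with
  opposite signs; the induction hypothesis for the cochain with this vertex prefixed removes the
  rest. The recursive form of the coboundary is chosen for arguments of this kind.\<close>

lemma alt_sum_alt_sum: "alt_sum (alt_sum c) \<sigma> = 0"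
  by (induction \<sigma> arbitrary: c) (auto simp: alt_sum_diff)

lemma alt_sum_conv_sum:
  "alt_sum c \<sigma> = (\<Sum>k<length \<sigma>. (-1) ^ k * c (take k \<sigma> @ drop (Suc k) \<sigma>))"
proof (induction \<sigma> arbitrary: c)
  case (Cons u \<sigma>)
  show ?case
    by (simp add: Cons.IH sum.lessThan_Suc_shift sum_negf del: sum.lessThan_Suc)
qed simp

section \<open>Cup products of cochains\<close>

definition cup :: "nat \<Rightarrow> ('u list \<Rightarrow> 'a::comm_ring_1) \<Rightarrow> ('u list \<Rightarrow> 'a) \<Rightarrow> 'u list \<Rightarrow> 'a" where
  "cup l c g \<sigma> = c (take l \<sigma>) * g (drop (l - 1) \<sigma>)"

text \<open>The Leibniz rule. Lengths count vertices, so a cochain on \<open>Suc m\<close> vertices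
  has degree m, whence the sign. Front and back share one vertex; the last face of the front and the
  first face of the back give the same product with opposite signs and cancel.\<close>

lemma alt_sum_cup:
  assumes "length \<sigma> > Suc m"
  shows "alt_sum (cup (Suc m) c g) \<sigma> =
    alt_sum c (take (Suc (Suc m)) \<sigma>) * g (drop (Suc m) \<sigma>) + (-1) ^ m * c (take (Suc m) \<sigma>) * alt_sum g (drop m \<sigma>)"
  using assms
proof (induction m arbitrary: \<sigma> c)
  case 0
  then obtain u w \<sigma>' where s: "\<sigma> = u # w # \<sigma>'"
    by (metis Suc_less_eq length_Suc_conv less_imp_Suc_add list.exhaust list.size(3) not_less0)
  have e: "cup (Suc 0) c g (u # \<rho>) = c [u] * g (u # \<rho>)" for \<rho>
    by (simp add: cup_def)
  show ?case
    unfolding s alt_sum.simps(2)[of "cup _ _ _"] e alt_sum_cmult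
    by (simp add: cup_def alt_sum_cmult algebra_simps)
next
  case (Suc m)
  then obtain u \<sigma>' where s: "\<sigma> = u # \<sigma>'" by (cases \<sigma>) auto
  have e: "(\<lambda>\<rho>. cup (Suc (Suc m)) c g (u # \<rho>)) = cup (Suc m) (\<lambda>\<rho>. c (u # \<rho>)) g"
    by (rule ext) (simp add: cup_def)
  have l: "length \<sigma>' > Suc m" using Suc.prems s by simp
  show ?case
    unfolding s alt_sum.simps(2)[of "cup _ _ _"] e Suc.IH[OF l]
    by (simp add: cup_def algebra_simps)
qed

section \<open>The Koszul differential and its contraction\<close>

definition koszul_sign :: "nat \<Rightarrow> nat set \<Rightarrow> 'a::comm_ring_1" where
  "koszul_sign i A = (-1) ^ card {a\<in>A. a < i}"

text \<open>A family \<open>y\<close> indexed by subsets A of {0..n} stands for the element of an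
  exterior algebra with coefficients y_A at the basis vectors e_A. \<open>koszul_bd\<close>
  contracts it against x, and \<open>koszul_wedge k w\<close> multiplies it by w e_k from the
  left.\<close>

definition koszul_bd :: "nat \<Rightarrow> (nat \<Rightarrow> 'a) \<Rightarrow> (nat set \<Rightarrow> 'a) \<Rightarrow> nat set \<Rightarrow> 'a::comm_ring_1" where
  "koszul_bd n x y A = (\<Sum>i\<in>{..n} - A. koszul_sign i A * x i * y (insert i A))"

definition koszul_wedge :: "nat \<Rightarrow> 'a \<Rightarrow> (nat set \<Rightarrow> 'a) \<Rightarrow> nat set \<Rightarrow> 'a::comm_ring_1" where
  "koszul_wedge k w y A = (if k \<in> A then koszul_sign k (A - {k}) * w * y (A - {k}) else 0)"

lemma koszul_sign_sq: "koszul_sign i A * koszul_sign i A = 1"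
  unfolding koszul_sign_def power_add[symmetric] by simp

lemma koszul_sign_insert:
  assumes "finite A" "j \<notin> A"
  shows "koszul_sign i (insert j A) = (if j < i then - koszul_sign i A else koszul_sign i A)"
proof -
  have "{a \<in> insert j A. a < i} = (if j < i then insert j {a\<in>A. a < i} else {a\<in>A. a < i})"
    by auto
  then show ?thesis using assms by (simp add: koszul_sign_def)
qed

lemma koszul_sign_swap:
  assumes "finite A" "i \<notin> A" "j \<notin> A" "i \<noteq> j"
  shows "koszul_sign i A * koszul_sign j (insert i A) = - (koszul_sign j A * koszul_sign i (insert j A))"
  using assms by (auto simp: koszul_sign_insert)

text \<open>The double sum runs over an antisymmetric array, because adding i and then j differs by
  a sign from the other order. The inner fact \<open>diag\<close> asks for a zero diagonal
  separately, since 2 need not be cancellable in the ring.\<close>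

lemma koszul_bd_koszul_bd:
  assumes "A \<subseteq> {..n}"
  shows "koszul_bd n x (koszul_bd n x y) A = 0"
proof -
  have fA: "finite A" using assms finite_subset by blast
  let ?g = "\<lambda>i j. koszul_sign i A * koszul_sign j (insert i A) * (x i * x j * y (insert i (insert j A)))"
  have 1: "koszul_bd n x (koszul_bd n x y) A = (\<Sum>i\<in>{..n}-A. \<Sum>j\<in>{..n}-A. if i = j then 0 else ?g i j)"
    unfolding koszul_bd_def
  proof (rule sum.cong[OF refl])
    fix i assume i: "i \<in> {..n} - A"
    have "(\<Sum>j\<in>{..n} - A. if i = j then 0 else ?g i j) = (\<Sum>j\<in>{..n} - insert i A. ?g i j)"
      by (rule sum.mono_neutral_cong_right) auto
    also have "\<dots> = koszul_sign i A * x i * (\<Sum>j\<in>{..n} - insert i A. koszul_sign j (insert i A) * x j * y (insert j (insert i A)))"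
      by (simp add: sum_distrib_left insert_commute algebra_simps)
    finally show "koszul_sign i A * x i * (\<Sum>j\<in>{..n} - insert i A. koszul_sign j (insert i A) * x j * y (insert j (insert i A)))
      = (\<Sum>j\<in>{..n} - A. if i = j then 0 else ?g i j)" by simp
  qed
  define B where "B = {..n} - A"
  have anti: "?g i j = - ?g j i" if "i \<in> B" "j \<in> B" "i \<noteq> j" for i j
    using koszul_sign_swap[OF fA, of i j, where 'a='a] that unfolding B_def
    by (simp add: insert_commute mult.commute mult.left_commute)
  have diag: "(\<Sum>i\<in>B. \<Sum>j\<in>B. f i j) = 0"
    if "finite B" "\<And>i j. i \<in> B \<Longrightarrow> j \<in> B \<Longrightarrow> f i j = - f j i" "\<And>i. f i i = 0" for f :: "nat \<Rightarrow> nat \<Rightarrow> 'a" and B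
    using that
  proof (induction B rule: finite_induct)
    case (insert b B)
    have "(\<Sum>i\<in>B. f i b) = - (\<Sum>i\<in>B. f b i)"
      unfolding sum_negf[symmetric] by (rule sum.cong[OF refl]) (use insert.prems in blast)
    moreover have "(\<Sum>i\<in>B. \<Sum>j\<in>B. f i j) = 0"
      by (rule insert.IH) (use insert.prems in blast)+
    ultimately show ?case using insert.hyps insert.prems(2)[of b] by (simp add: sum.distrib)
  qed simp
  show ?thesis unfolding 1 B_def[symmetric]
  proof (rule diag)
    show "finite B" by (simp add: B_def)
    fix i j assume "i \<in> B" "j \<in> B"
    then show "(if i = j then 0 else ?g i j) = - (if j = i then 0 else ?g j i)"
      using anti[of i j] by (cases "i = j") simp_all
  qed simp
qed

text \<open>The contracting homotopy given by an invertible coordinate. If k is outside of A, only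
  the index k contributes to the first summand and the second is zero. If k lies in A, the index k
  in the second summand gives y A, and all other terms cancel against the first summand by the
  signs.\<close>

lemma koszul_bd_koszul_wedge:
  assumes A: "A \<subseteq> {..n}" and k: "k \<le> n" and w: "x k * w = 1"
  shows "koszul_bd n x (koszul_wedge k w y) A + koszul_wedge k w (koszul_bd n x y) A = y A"
proof (cases "k \<in> A")
  case False
  have "koszul_bd n x (koszul_wedge k w y) A = (\<Sum>i\<in>{k}. koszul_sign i A * x i * koszul_wedge k w y (insert i A))"
    unfolding koszul_bd_def by (rule sum.mono_neutral_right) (use False k in \<open>auto simp: koszul_wedge_def\<close>)
  also have "\<dots> = y A"
  proof -
    have "koszul_sign k A * x k * koszul_wedge k w y (insert k A) = (koszul_sign k A * koszul_sign k A) * (x k * w) * y A"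
      using False by (simp add: koszul_wedge_def algebra_simps)
    then show ?thesis using w by (simp add: koszul_sign_sq)
  qed
  finally show ?thesis using False by (simp add: koszul_wedge_def)
next
  case True
  define B where "B = A - {k}"
  have AB: "A = insert k B" "k \<notin> B" using True B_def by auto
  have fB: "finite B" using A AB finite_subset[of B "{..n}"] by auto
  have 1: "koszul_wedge k w (koszul_bd n x y) A = koszul_sign k B * w * (\<Sum>i\<in>{..n}-B. koszul_sign i B * x i * y (insert i B))"
    using True by (simp add: koszul_wedge_def koszul_bd_def B_def)
  have DB: "{..n} - B = insert k ({..n} - A)" using AB k by auto
  have s: "(\<Sum>i\<in>{..n}-B. koszul_sign i B * x i * y (insert i B)) = koszul_sign k B * x k * y A + (\<Sum>i\<in>{..n}-A. koszul_sign i B * x i * y (insert i B))"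
    unfolding DB by (subst sum.insert) (use True in \<open>simp_all flip: AB(1)\<close>)
  have 2: "koszul_wedge k w (koszul_bd n x y) A = (koszul_sign k B * koszul_sign k B) * (x k * w) * y A + (\<Sum>i\<in>{..n}-A. koszul_sign k B * w * (koszul_sign i B * x i * y (insert i B)))"
    unfolding 1 s distrib_left sum_distrib_left by (simp only: ac_simps)
  have 3: "koszul_bd n x (koszul_wedge k w y) A = (\<Sum>i\<in>{..n}-A. - (koszul_sign k B * w * (koszul_sign i B * x i * y (insert i B))))"
    unfolding koszul_bd_def
  proof (rule sum.cong[OF refl])
    fix i assume i: "i \<in> {..n} - A"
    have d: "insert i A - {k} = insert i B" using i AB by auto
    have "koszul_sign i A * x i * koszul_wedge k w y (insert i A) = (koszul_sign i (insert k B) * koszul_sign k (insert i B)) * (x i * w * y (insert i B))"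
      using True AB(1) d by (simp add: koszul_wedge_def B_def[symmetric] ac_simps)
    also have "koszul_sign i (insert k B) * koszul_sign k (insert i B) = - (koszul_sign i B * (koszul_sign k B :: 'a))"
    proof -
      have "i \<notin> B" "i \<noteq> k" using i AB by auto
      then show ?thesis using AB(2) fB by (cases "k < i") (auto simp: koszul_sign_insert)
    qed
    finally show "koszul_sign i A * x i * koszul_wedge k w y (insert i A) = - (koszul_sign k B * w * (koszul_sign i B * x i * y (insert i B)))"
      by (simp add: algebra_simps)
  qed
  show ?thesis unfolding 2 3 using w by (simp add: koszul_sign_sq sum_negf)
qed

text \<open>For K = [k_1, ..., k_p] these are the coefficients of the wedge product of the vectors
  w_k e_k. With w the inverse coordinates, sending K to this product is a Cech cochain with values
  in the Koszul complex.\<close>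

fun koszul_theta :: "(nat \<Rightarrow> 'a::comm_ring_1) \<Rightarrow> nat list \<Rightarrow> nat set \<Rightarrow> 'a" where
  "koszul_theta w [] A = (if A = {} then 1 else 0)"
| "koszul_theta w (k # K) A = koszul_wedge k (w k) (koszul_theta w K) A"

lemma koszul_bd_cong: "(\<And>i. i \<in> {..n} - A \<Longrightarrow> y (insert i A) = y' (insert i A)) \<Longrightarrow> koszul_bd n x y A = koszul_bd n x y' A"
  by (simp add: koszul_bd_def)

text \<open>On this cochain the Koszul differential and the Cech coboundary agree, so the components
  form a zigzag that starts from 1 at the empty set and computes iterated connecting maps. The
  homotopy identity for the first entry of K is exactly one step of the recursion of
  \<open>alt_sum\<close>.\<close>

lemma koszul_bd_koszul_theta:
  assumes "set K \<subseteq> {..n}" "A \<subseteq> {..n}" "\<And>k. k \<in> set K \<Longrightarrow> x k * w k = 1"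
  shows "koszul_bd n x (koszul_theta w K) A = alt_sum (\<lambda>K. koszul_theta w K A) K"
  using assms
proof (induction K arbitrary: A)
  case Nil
  then show ?case by (simp add: koszul_bd_def)
next
  case (Cons k K)
  have "koszul_wedge k (w k) (koszul_bd n x (koszul_theta w K)) A = alt_sum (\<lambda>\<rho>. koszul_theta w (k # \<rho>) A) K"
  proof -
    have "A - {k} \<subseteq> {..n}" using Cons.prems(2) by blast
    then have "koszul_bd n x (koszul_theta w K) (A - {k}) = alt_sum (\<lambda>K. koszul_theta w K (A - {k})) K"
      using Cons.IH Cons.prems by simp
    then show ?thesis by (simp add: koszul_wedge_def alt_sum_cmult)
  qed
  moreover have "koszul_bd n x (koszul_wedge k (w k) (koszul_theta w K)) A + koszul_wedge k (w k) (koszul_bd n x (koszul_theta w K)) A = koszul_theta w K A"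
    by (rule koszul_bd_koszul_wedge) (use Cons in auto)
  ultimately show ?case by (simp add: koszul_bd_def algebra_simps)
qed

lemma koszul_theta_support: "koszul_theta w K A \<noteq> 0 \<Longrightarrow> A = set K"
proof (induction K arbitrary: A)
  case (Cons k K)
  then have "k \<in> A" "koszul_theta w K (A - {k}) \<noteq> 0" by (auto simp: koszul_wedge_def split: if_splits)
  then show ?case using Cons.IH by auto
qed (auto split: if_splits)

text \<open>Separates the inverse coordinates from a sign that depends on K and A only. The signs,
  obtained with w = 1, serve later as constant cochains.\<close>

lemma koszul_theta_scale: "finite A \<Longrightarrow> koszul_theta w K A = (\<Prod>k\<in>A. w k) * koszul_theta (\<lambda>_. 1) K A"
proof (induction K arbitrary: A)
  case (Cons k K)
  show ?case
  proof (cases "k \<in> A")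
    case True
    then have "(\<Prod>k\<in>A. w k) = w k * (\<Prod>k\<in>A-{k}. w k)"
      using Cons.prems by (metis prod.remove)
    then show ?thesis using True Cons by (simp add: koszul_wedge_def)
  qed (simp add: koszul_wedge_def)
qed simp

lemma koszul_bd_diff: "koszul_bd n x (\<lambda>A. y A - y' A) A = koszul_bd n x y A - koszul_bd n x y' A"
  by (simp add: koszul_bd_def sum_subtractf algebra_simps)

lemma koszul_bd_alt_sum: "koszul_bd n x (\<lambda>A. alt_sum (\<lambda>\<rho>. y \<rho> A) \<sigma>) A = alt_sum (\<lambda>\<rho>. koszul_bd n x (y \<rho>) A) \<sigma>"
  by (simp add: koszul_bd_def alt_sum_sum alt_sum_cmult)

lemma koszul_bd_cmult: "koszul_bd n x (\<lambda>A. a * y A) A = a * koszul_bd n x y A"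
  by (simp add: koszul_bd_def sum_distrib_left algebra_simps)

section \<open>Koszul arguments in Cech cohomology\<close>

text \<open>Sections of all twists are modelled as functions on one set of places, so that
  coordinates and their inverses act by pointwise multiplication. \<open>pl U\<close> collects the
  places over U at which sections are compared; values elsewhere carry no meaning.
  \<open>D j k\<close> is the locus where the coordinate k of factor j is invertible.\<close>

locale graded_sheaf =
  fixes opn :: "'p set \<Rightarrow> bool" and X :: "'p set" and pl :: "'p set \<Rightarrow> 'q set"
    and sec :: "(nat \<Rightarrow> int) \<Rightarrow> 'p set \<Rightarrow> ('q \<Rightarrow> complex) set"
    and x :: "nat \<Rightarrow> nat \<Rightarrow> 'q \<Rightarrow> complex" and D :: "nat \<Rightarrow> nat \<Rightarrow> 'p set"
    and ns :: "nat list"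
  assumes pl_mono: "U \<subseteq> V \<Longrightarrow> pl U \<subseteq> pl V"
    and sec_zero: "(\<lambda>_. 0) \<in> sec t U"
    and sec_add: "f \<in> sec t U \<Longrightarrow> g \<in> sec t U \<Longrightarrow> (\<lambda>q. f q + g q) \<in> sec t U"
    and sec_cmult: "f \<in> sec t U \<Longrightarrow> (\<lambda>q. a * f q) \<in> sec t U"
    and sec_mono: "U \<subseteq> V \<Longrightarrow> f \<in> sec t V \<Longrightarrow> f \<in> sec t U"
    and sec_x: "j < length ns \<Longrightarrow> k \<le> ns ! j \<Longrightarrow> f \<in> sec (t(j := s)) U \<Longrightarrow>
      (\<lambda>q. x j k q * f q) \<in> sec (t(j := s + 1)) U"
    and sec_inv: "j < length ns \<Longrightarrow> k \<le> ns ! j \<Longrightarrow> U \<subseteq> D j k \<Longrightarrow> f \<in> sec (t(j := s)) U \<Longrightarrow>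
      (\<lambda>q. inverse (x j k q) * f q) \<in> sec (t(j := s - 1)) U"
    and pl_Union: "q \<in> pl (\<Union>W) \<Longrightarrow> \<exists>u\<in>W. q \<in> pl u"
    and x_nz: "q \<in> pl (D j k) \<Longrightarrow> x j k q \<noteq> 0"
    and opn_Int: "opn U \<Longrightarrow> opn V \<Longrightarrow> opn (U \<inter> V)"
    and opn_X: "opn X"
    and opn_D: "j < length ns \<Longrightarrow> k \<le> ns ! j \<Longrightarrow> opn (D j k)"
    and D_cover: "P \<in> X \<Longrightarrow> j < length ns \<Longrightarrow> \<exists>k\<le>ns ! j. P \<in> D j k"
begin

definition cover :: "'p set set \<Rightarrow> bool" where
  "cover V \<longleftrightarrow> (\<forall>U\<in>V. opn U) \<and> \<Union>V = X"

definition simplices :: "'p set set \<Rightarrow> nat \<Rightarrow> 'p set list set" where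
  "simplices V l = {\<sigma>. length \<sigma> = l \<and> set \<sigma> \<subseteq> V}"

text \<open>The index l counts the entries of a simplex, one more than the cohomological degree. The
  empty simplex carries only zero, so primitives of index 0 vanish and \<open>van t 1\<close> says
  that 0-cocycles become zero after refinement, without a separate clause for degree 0.\<close>

definition cochains :: "'p set set \<Rightarrow> nat \<Rightarrow> (nat \<Rightarrow> int) \<Rightarrow> ('p set list \<Rightarrow> 'q \<Rightarrow> complex) set" where
  "cochains V l t = {c. \<forall>\<sigma>\<in>simplices V l. if \<sigma> = [] then \<forall>q. c \<sigma> q = 0 else c \<sigma> \<in> sec t (\<Inter>(set \<sigma>))}"

definition cocycle :: "'p set set \<Rightarrow> nat \<Rightarrow> ('p set list \<Rightarrow> 'q \<Rightarrow> complex) \<Rightarrow> bool" where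
  "cocycle V l c \<longleftrightarrow> (\<forall>\<sigma>\<in>simplices V (Suc l). \<forall>q\<in>pl (\<Inter>(set \<sigma>)). alt_sum (\<lambda>\<rho>. c \<rho> q) \<sigma> = 0)"

definition bounds :: "'p set set \<Rightarrow> nat \<Rightarrow> ('p set list \<Rightarrow> 'q \<Rightarrow> complex) \<Rightarrow> ('p set list \<Rightarrow> 'q \<Rightarrow> complex) \<Rightarrow> bool" where
  "bounds V l b c \<longleftrightarrow> (\<forall>\<sigma>\<in>simplices V l. \<forall>q\<in>pl (\<Inter>(set \<sigma>)). c \<sigma> q = alt_sum (\<lambda>\<rho>. b \<rho> q) \<sigma>)"

definition refines :: "'p set set \<Rightarrow> 'p set set \<Rightarrow> ('p set \<Rightarrow> 'p set) \<Rightarrow> bool" where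
  "refines V U \<tau> \<longleftrightarrow> (\<forall>u\<in>V. \<tau> u \<in> U \<and> u \<subseteq> \<tau> u)"

definition van :: "(nat \<Rightarrow> int) \<Rightarrow> nat \<Rightarrow> bool" where
  "van t l \<longleftrightarrow> (\<forall>U c. cover U \<longrightarrow> c \<in> cochains U l t \<longrightarrow> cocycle U l c \<longrightarrow>
     (\<exists>V \<tau> b. cover V \<and> refines V U \<tau> \<and> b \<in> cochains V (l - 1) t \<and> bounds V l b (\<lambda>\<sigma>. c (map \<tau> \<sigma>))))"

text \<open>Records a coordinate of factor j that is invertible on each member of the cover; it
  feeds the contracting homotopy and the inverses in \<open>koszul_theta\<close>.\<close>

definition adapted :: "'p set set \<Rightarrow> nat \<Rightarrow> ('p set \<Rightarrow> nat) \<Rightarrow> bool" where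
  "adapted V j kk \<longleftrightarrow> (\<forall>u\<in>V. kk u \<le> ns ! j \<and> u \<subseteq> D j (kk u))"

lemma cochI:
  assumes "\<And>\<sigma>. \<sigma> \<in> simplices V l \<Longrightarrow> if \<sigma> = [] then \<forall>q. c \<sigma> q = 0 else c \<sigma> \<in> sec t (\<Inter>(set \<sigma>))"
  shows "c \<in> cochains V l t"
  using assms unfolding cochains_def mem_Collect_eq by (rule ballI)

lemma cochD:
  assumes "c \<in> cochains V l t" "\<sigma> \<in> simplices V l"
  shows "if \<sigma> = [] then \<forall>q. c \<sigma> q = 0 else c \<sigma> \<in> sec t (\<Inter>(set \<sigma>))"
  using assms(1)[unfolded cochains_def mem_Collect_eq] assms(2) by (rule bspec)

lemma refines_id: "refines V V (\<lambda>u. u)" by (simp add: refines_def)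

lemma refines_trans: "refines V U \<tau> \<Longrightarrow> refines W V \<tau>' \<Longrightarrow> refines W U (\<lambda>u. \<tau> (\<tau>' u))"
  unfolding refines_def by blast

lemma refines_simplices:
  assumes "refines V U \<tau>" "\<sigma> \<in> simplices V l"
  shows "map \<tau> \<sigma> \<in> simplices U l" "\<Inter>(set \<sigma>) \<subseteq> \<Inter>(set (map \<tau> \<sigma>))"
    "pl (\<Inter>(set \<sigma>)) \<subseteq> pl (\<Inter>(set (map \<tau> \<sigma>)))"
proof -
  show "map \<tau> \<sigma> \<in> simplices U l" using assms unfolding refines_def simplices_def by auto
  show "\<Inter>(set \<sigma>) \<subseteq> \<Inter>(set (map \<tau> \<sigma>))" using assms unfolding refines_def simplices_def by fastforce
  then show "pl (\<Inter>(set \<sigma>)) \<subseteq> pl (\<Inter>(set (map \<tau> \<sigma>)))" by (rule pl_mono)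
qed

lemma cochains_refine:
  assumes "refines V U \<tau>" "c \<in> cochains U l t"
  shows "(\<lambda>\<sigma>. c (map \<tau> \<sigma>)) \<in> cochains V l t"
proof -
  have "if \<sigma> = [] then \<forall>q. c (map \<tau> \<sigma>) q = 0 else c (map \<tau> \<sigma>) \<in> sec t (\<Inter>(set \<sigma>))"
    if s: "\<sigma> \<in> simplices V l" for \<sigma>
  proof -
    have c: "if map \<tau> \<sigma> = [] then \<forall>q. c (map \<tau> \<sigma>) q = 0 else c (map \<tau> \<sigma>) \<in> sec t (\<Inter>(set (map \<tau> \<sigma>)))"
      by (rule cochD[OF assms(2) refines_simplices(1)[OF assms(1) s]])
    show ?thesis
    proof (cases "\<sigma> = []")
      case False
      then have "c (map \<tau> \<sigma>) \<in> sec t (\<Inter>(set (map \<tau> \<sigma>)))" using c by simp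
      with False show ?thesis using sec_mono[OF refines_simplices(2)[OF assms(1) s]] by simp
    qed (use c in simp)
  qed
  then show ?thesis by (rule cochI)
qed

lemma cocycle_refine:
  assumes "refines V U \<tau>" "cocycle U l c"
  shows "cocycle V l (\<lambda>\<sigma>. c (map \<tau> \<sigma>))"
  unfolding cocycle_def
proof (intro ballI)
  fix \<sigma> q assume s: "\<sigma> \<in> simplices V (Suc l)" and q: "q \<in> pl (\<Inter>(set \<sigma>))"
  have "alt_sum (\<lambda>\<rho>. c \<rho> q) (map \<tau> \<sigma>) = 0"
    using assms(2) refines_simplices(1,3)[OF assms(1) s] q unfolding cocycle_def by blast
  then show "alt_sum (\<lambda>\<rho>. c (map \<tau> \<rho>) q) \<sigma> = 0" by (simp only: alt_sum_map)
qed

lemma bounds_refine: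
  assumes "refines V U \<tau>" "bounds U l b c"
  shows "bounds V l (\<lambda>\<sigma>. b (map \<tau> \<sigma>)) (\<lambda>\<sigma>. c (map \<tau> \<sigma>))"
  unfolding bounds_def
proof (intro ballI)
  fix \<sigma> q assume s: "\<sigma> \<in> simplices V l" and q: "q \<in> pl (\<Inter>(set \<sigma>))"
  have "c (map \<tau> \<sigma>) q = alt_sum (\<lambda>\<rho>. b \<rho> q) (map \<tau> \<sigma>)"
    using assms(2) refines_simplices(1,3)[OF assms(1) s] q unfolding bounds_def by blast
  then show "c (map \<tau> \<sigma>) q = alt_sum (\<lambda>\<rho>. b (map \<tau> \<rho>) q) \<sigma>" by (simp only: alt_sum_map)
qed

lemma adapted_refine: "refines V U \<tau> \<Longrightarrow> adapted U j kk \<Longrightarrow> adapted V j (\<lambda>u. kk (\<tau> u))"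
  unfolding refines_def adapted_def by blast

lemma vanE:
  assumes "van t l" "cover U" "c \<in> cochains U l t" "cocycle U l c"
  obtains V \<tau> b where "cover V" "refines V U \<tau>" "b \<in> cochains V (l - 1) t" "bounds V l b (\<lambda>\<sigma>. c (map \<tau> \<sigma>))"
  using assms(1)[unfolded van_def, rule_format, OF assms(2-4)] by (elim exE conjE)

lemma vanI_witness:
  assumes "cover V" "refines V U \<tau>" "b \<in> cochains V (l - 1) t" "bounds V l b (\<lambda>\<sigma>. c (map \<tau> \<sigma>))"
  shows "\<exists>V \<tau> b. cover V \<and> refines V U \<tau> \<and> b \<in> cochains V (l - 1) t \<and> bounds V l b (\<lambda>\<sigma>. c (map \<tau> \<sigma>))"
  using assms by (intro exI conjI)

text \<open>The classes are killed one after the other, each on a further refinement to which the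
  primitives found so far are pulled back. The components of a Koszul family need one common cover,
  and their number is finite.\<close>

lemma van_family:
  assumes "finite I" "van t l" "cover U" "\<And>A. A \<in> I \<Longrightarrow> c A \<in> cochains U l t" "\<And>A. A \<in> I \<Longrightarrow> cocycle U l (c A)"
  obtains V \<tau> b where "cover V" "refines V U \<tau>" "\<And>A. A \<in> I \<Longrightarrow> b A \<in> cochains V (l - 1) t"
    "\<And>A. A \<in> I \<Longrightarrow> bounds V l (b A) (\<lambda>\<sigma>. c A (map \<tau> \<sigma>))"
  using assms
proof (induction I arbitrary: thesis rule: finite_induct)
  case empty
  show ?case by (rule empty.prems(1)[OF empty.prems(3) refines_id]) simp_all
next
  case (insert B I)
  obtain V \<tau> b where V: "cover V" "refines V U \<tau>" "\<And>A. A \<in> I \<Longrightarrow> b A \<in> cochains V (l - 1) t"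
    "\<And>A. A \<in> I \<Longrightarrow> bounds V l (b A) (\<lambda>\<sigma>. c A (map \<tau> \<sigma>))"
    by (rule insert.IH) (use insert.prems in auto)
  have "c B \<in> cochains U l t" "cocycle U l (c B)" using insert.prems(4,5) by auto
  then have "(\<lambda>\<sigma>. c B (map \<tau> \<sigma>)) \<in> cochains V l t" "cocycle V l (\<lambda>\<sigma>. c B (map \<tau> \<sigma>))"
    using cochains_refine[OF V(2)] cocycle_refine[OF V(2)] by auto
  from vanE[OF insert.prems(2) V(1) this]
  obtain W \<tau>' b' where W: "cover W" "refines W V \<tau>'" "b' \<in> cochains W (l - 1) t"
    "bounds W l b' (\<lambda>\<sigma>. c B (map \<tau> (map \<tau>' \<sigma>)))" .
  let ?b = "\<lambda>A \<sigma>. if A = B then b' \<sigma> else b A (map \<tau>' \<sigma>)"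
  show ?case
  proof (rule insert.prems(1)[OF W(1) refines_trans[OF V(2) W(2)], of ?b])
    fix A assume A: "A \<in> insert B I"
    show "?b A \<in> cochains W (l - 1) t"
    proof (cases "A = B")
      case True
      then show ?thesis using W(3) by simp
    next
      case False
      then show ?thesis using A cochains_refine[OF W(2) V(3)] by auto
    qed
    show "bounds W l (?b A) (\<lambda>\<sigma>. c A (map (\<lambda>u. \<tau> (\<tau>' u)) \<sigma>))"
    proof (cases "A = B")
      case True
      then show ?thesis using W(4) by (simp add: comp_def)
    next
      case False
      then show ?thesis using A bounds_refine[OF W(2) V(4)] by (auto simp: comp_def)
    qed
  qed
qed

lemma cover_adapted:
  assumes "cover U" "j < length ns"
  shows "\<exists>V \<tau> kk. cover V \<and> refines V U \<tau> \<and> adapted V j kk"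
proof -
  define V where "V = {u \<inter> D j k | u k. u \<in> U \<and> k \<le> ns ! j}"
  have "cover V"
  proof -
    have "\<forall>v\<in>V. opn v" using assms opn_Int opn_D unfolding cover_def V_def by blast
    moreover have "\<Union>V = \<Union>U" using assms D_cover unfolding cover_def V_def by blast
    ultimately show ?thesis using assms unfolding cover_def by simp
  qed
  moreover have "\<forall>v\<in>V. \<exists>u. u \<in> U \<and> v \<subseteq> u" unfolding V_def by blast
  then obtain \<tau> where "refines V U \<tau>" unfolding refines_def by metis
  moreover have "\<forall>v\<in>V. \<exists>k. k \<le> ns ! j \<and> v \<subseteq> D j k" unfolding V_def by blast
  then obtain kk where "adapted V j kk" unfolding adapted_def by metis
  ultimately show ?thesis by blast
qed

lemma sec_diff: "f \<in> sec t U \<Longrightarrow> g \<in> sec t U \<Longrightarrow> (\<lambda>q. f q - g q) \<in> sec t U"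
  using sec_add[of f t U "\<lambda>q. -1 * g q"] sec_cmult[of g t U "-1"] by simp

lemma sec_sum: "(\<And>i. i \<in> I \<Longrightarrow> f i \<in> sec t U) \<Longrightarrow> (\<lambda>q. \<Sum>i\<in>I. f i q) \<in> sec t U"
  by (induction I rule: infinite_finite_induct) (auto simp: sec_zero sec_add)

lemma cochains_zero: "(\<lambda>\<sigma> q. 0) \<in> cochains V l t"
  unfolding cochains_def using sec_zero by auto

lemma cochains_diff: "f \<in> cochains V l t \<Longrightarrow> g \<in> cochains V l t \<Longrightarrow> (\<lambda>\<sigma> q. f \<sigma> q - g \<sigma> q) \<in> cochains V l t"
  unfolding cochains_def using sec_diff by auto

lemma cochains_cmult: "f \<in> cochains V l t \<Longrightarrow> (\<lambda>\<sigma> q. a * f \<sigma> q) \<in> cochains V l t"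
  unfolding cochains_def using sec_cmult by auto

lemma cochains_sum:
  assumes "\<And>i. i \<in> I \<Longrightarrow> f i \<in> cochains V l t"
  shows "(\<lambda>\<sigma> q. \<Sum>i\<in>I. f i \<sigma> q) \<in> cochains V l t"
  using assms unfolding cochains_def by (auto intro!: sec_sum)

lemma cochains_x: "j < length ns \<Longrightarrow> k \<le> ns ! j \<Longrightarrow> f \<in> cochains V l (t(j := s)) \<Longrightarrow>
    (\<lambda>\<sigma> q. x j k q * f \<sigma> q) \<in> cochains V l (t(j := s + 1))"
  unfolding cochains_def using sec_x by auto

lemma cochains_alt_sum:
  assumes "f \<in> cochains V (l - 1) t"
  shows "(\<lambda>\<sigma> q. alt_sum (\<lambda>\<rho>. f \<rho> q) \<sigma>) \<in> cochains V l t"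
proof -
  have f: "if \<rho> = [] then \<forall>q. f \<rho> q = 0 else f \<rho> \<in> sec t (\<Inter>(set \<rho>))" if "\<rho> \<in> simplices V (l - 1)" for \<rho>
    by (rule cochD[OF assms that])
  have "(\<lambda>q. alt_sum (\<lambda>\<rho>. f \<rho> q) \<sigma>) \<in> sec t (\<Inter>(set \<sigma>))" if "\<sigma> \<in> simplices V l" for \<sigma>
    unfolding alt_sum_conv_sum
  proof (intro sec_sum sec_cmult)
    fix k assume "k \<in> {..<length \<sigma>}"
    define \<rho> where "\<rho> = take k \<sigma> @ drop (Suc k) \<sigma>"
    have s: "\<rho> \<in> simplices V (l - 1)" "set \<rho> \<subseteq> set \<sigma>"
      using that \<open>k \<in> _\<close> set_take_subset[of k \<sigma>] set_drop_subset[of "Suc k" \<sigma>] unfolding simplices_def \<rho>_def by auto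
    have "f \<rho> \<in> sec t (\<Inter>(set \<sigma>))"
    proof (cases "\<rho> = []")
      case True
      then have "f \<rho> = (\<lambda>_. 0)" using f[OF s(1)] by auto
      then show ?thesis using sec_zero by simp
    next
      case False
      then have "f \<rho> \<in> sec t (\<Inter>(set \<rho>))" using f[OF s(1)] by simp
      then show ?thesis by (rule sec_mono[rotated]) (use s in blast)
    qed
    then show "f (take k \<sigma> @ drop (Suc k) \<sigma>) \<in> sec t (\<Inter>(set \<sigma>))" by (simp add: \<rho>_def)
  qed
  then show ?thesis by (intro cochI) simp
qed

section \<open>Koszul families of cochains\<close>

definition bdry :: "nat \<Rightarrow> (nat set \<Rightarrow> 'q \<Rightarrow> complex) \<Rightarrow> nat set \<Rightarrow> 'q \<Rightarrow> complex" where
  "bdry j y A q = koszul_bd (ns ! j) (\<lambda>i. x j i q) (\<lambda>A. y A q) A"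

definition level :: "nat \<Rightarrow> nat \<Rightarrow> nat set set" where
  "level j p = {A. A \<subseteq> {..ns ! j} \<and> card A = p}"

lemma level_insert: "A \<in> level j p \<Longrightarrow> i \<in> {..ns ! j} - A \<Longrightarrow> insert i A \<in> level j (Suc p)"
  unfolding level_def using finite_subset[of A "{..ns ! j}"] by auto

lemma finite_level: "finite (level j p)"
  by (rule finite_subset[of _ "Pow {..ns ! j}"]) (auto simp: level_def)

lemma cochains_bdry:
  assumes "j < length ns" "\<And>A. A \<in> level j (Suc p) \<Longrightarrow> (\<lambda>\<sigma>. Y \<sigma> A) \<in> cochains V l (t(j := s - int (Suc p)))"
    "A \<in> level j p"
  shows "(\<lambda>\<sigma>. bdry j (Y \<sigma>) A) \<in> cochains V l (t(j := s - int p))"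
proof -
  have "(\<lambda>\<sigma> q. koszul_sign i A * (x j i q * Y \<sigma> (insert i A) q)) \<in> cochains V l (t(j := s - int p))"
    if i: "i \<in> {..ns ! j} - A" for i
  proof (rule cochains_cmult)
    have "i \<le> ns ! j" using i by simp
    from cochains_x[OF assms(1) this assms(2)[OF level_insert[OF assms(3) i]]]
    have "(\<lambda>\<sigma> q. x j i q * Y \<sigma> (insert i A) q) \<in> cochains V l (t(j := s - int (Suc p) + 1))" .
    then show "(\<lambda>\<sigma> q. x j i q * Y \<sigma> (insert i A) q) \<in> cochains V l (t(j := s - int p))" by simp
  qed
  then have "(\<lambda>\<sigma> q. \<Sum>i\<in>{..ns ! j} - A. koszul_sign i A * (x j i q * Y \<sigma> (insert i A) q)) \<in> cochains V l (t(j := s - int p))"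
    by (rule cochains_sum)
  then show ?thesis by (simp add: bdry_def[abs_def] koszul_bd_def mult.assoc)
qed

text \<open>The coordinate is read off the first vertex, so this operator need not commute with the
  Cech differential. It is applied simplex by simplex to invert \<open>bdry\<close> on cycles, and
  \<open>bdry\<close> does commute. On the empty simplex \<open>hd\<close> is arbitrary, but
  cochains vanish there.\<close>

definition contraction :: "nat \<Rightarrow> ('p set \<Rightarrow> nat) \<Rightarrow> ('p set list \<Rightarrow> nat set \<Rightarrow> 'q \<Rightarrow> complex) \<Rightarrow> 'p set list \<Rightarrow> nat set \<Rightarrow> 'q \<Rightarrow> complex" where
  "contraction j kk Y \<sigma> A q = koszul_wedge (kk (hd \<sigma>)) (inverse (x j (kk (hd \<sigma>)) q)) (\<lambda>A. Y \<sigma> A q) A"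

lemma cochains_contraction:
  assumes "j < length ns" "adapted V j kk"
    "\<And>A. A \<in> level j p \<Longrightarrow> (\<lambda>\<sigma>. Y \<sigma> A) \<in> cochains V l (t(j := s - int p))"
    "A \<in> level j (Suc p)"
  shows "(\<lambda>\<sigma>. contraction j kk Y \<sigma> A) \<in> cochains V l (t(j := s - int (Suc p)))"
proof -
  have "(if \<sigma> = [] then \<forall>q. contraction j kk Y \<sigma> A q = 0 else contraction j kk Y \<sigma> A \<in> sec (t(j := s - int (Suc p))) (\<Inter>(set \<sigma>)))"
    if s: "\<sigma> \<in> simplices V l" for \<sigma>
  proof (cases "kk (hd \<sigma>) \<in> A")
    case False
    then have "contraction j kk Y \<sigma> A = (\<lambda>q. 0)" by (simp add: contraction_def[abs_def] koszul_wedge_def)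
    then show ?thesis using sec_zero by (cases "\<sigma> = []") simp_all
  next
    case True
    define k where "k = kk (hd \<sigma>)"
    have B: "A - {k} \<in> level j p" using True assms(4) k_def unfolding level_def
      by (auto intro: finite_subset)
    then have Y: "(\<lambda>\<sigma>. Y \<sigma> (A - {k})) \<in> cochains V l (t(j := s - int p))" by (rule assms(3))
    have e: "contraction j kk Y \<sigma> A = (\<lambda>q. koszul_sign k (A - {k}) * (inverse (x j k q) * Y \<sigma> (A - {k}) q))"
      using True by (simp add: contraction_def[abs_def] koszul_wedge_def k_def mult.assoc)
    show ?thesis
    proof (cases "\<sigma> = []")
      case True
      then show ?thesis using cochD[OF Y s] unfolding e by simp
    next
      case False
      then have h: "hd \<sigma> \<in> V" "hd \<sigma> \<in> set \<sigma>" using s unfolding simplices_def by auto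
      have "(\<lambda>q. inverse (x j k q) * Y \<sigma> (A - {k}) q) \<in> sec (t(j := s - int p - 1)) (\<Inter>(set \<sigma>))"
      proof (rule sec_inv)
        show "k \<le> ns ! j" "\<Inter>(set \<sigma>) \<subseteq> D j k" using h assms(2) unfolding adapted_def k_def by auto
        show "Y \<sigma> (A - {k}) \<in> sec (t(j := s - int p)) (\<Inter>(set \<sigma>))"
          using cochD[OF Y s] False by simp
      qed (rule assms(1))
      then have "(\<lambda>q. inverse (x j k q) * Y \<sigma> (A - {k}) q) \<in> sec (t(j := s - int (Suc p))) (\<Inter>(set \<sigma>))"
        by (simp add: algebra_simps)
      then show ?thesis unfolding e using False by (simp add: sec_cmult)
    qed
  qed
  then show ?thesis by (rule cochI)
qed

lemma bdry_contraction:
  assumes "adapted V j kk" "\<sigma> \<in> simplices V (Suc l)" "q \<in> pl (\<Inter>(set \<sigma>))" "A \<subseteq> {..ns ! j}"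
  shows "bdry j (contraction j kk Y \<sigma>) A q + contraction j kk (\<lambda>\<sigma>. bdry j (Y \<sigma>)) \<sigma> A q = Y \<sigma> A q"
proof -
  have h: "hd \<sigma> \<in> V" "hd \<sigma> \<in> set \<sigma>" using assms(2) unfolding simplices_def by (auto simp: length_Suc_conv)
  then have k: "kk (hd \<sigma>) \<le> ns ! j" "\<Inter>(set \<sigma>) \<subseteq> D j (kk (hd \<sigma>))"
    using assms(1) unfolding adapted_def by auto
  then have "x j (kk (hd \<sigma>)) q \<noteq> 0" using assms(3) pl_mono x_nz by blast
  then show ?thesis unfolding bdry_def contraction_def
    by (intro koszul_bd_koszul_wedge) (use assms k in auto)
qed

lemma bdry_bdry: "A \<subseteq> {..ns ! j} \<Longrightarrow> bdry j (bdry j y) A q = 0"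
  unfolding bdry_def by (rule koszul_bd_koszul_bd)

lemma bdry_alt_sum: "bdry j (\<lambda>A q. alt_sum (\<lambda>\<rho>. y \<rho> A q) \<sigma>) A q = alt_sum (\<lambda>\<rho>. bdry j (y \<rho>) A q) \<sigma>"
  unfolding bdry_def by (rule koszul_bd_alt_sum)

lemma bdry_cong: "A \<in> level j p \<Longrightarrow> (\<And>B. B \<in> level j (Suc p) \<Longrightarrow> y B q = y' B q) \<Longrightarrow> bdry j y A q = bdry j y' A q"
  unfolding bdry_def by (rule koszul_bd_cong) (use level_insert in blast)

lemma bdry_diff: "bdry j (\<lambda>A q. y A q - y' A q) A q = bdry j y A q - bdry j y' A q"
  unfolding bdry_def by (rule koszul_bd_diff)

text \<open>The Koszul and the Cech differential commute, so the Koszul boundary of a Cech primitive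
  of \<open>bdry Y\<close> has Cech coboundary \<open>bdry (bdry Y)\<close>, which is zero.\<close>

lemma bdry_alt_sum_zero:
  assumes "\<And>A. A \<in> level j p \<Longrightarrow> bounds V l (\<lambda>\<sigma>. y \<sigma> A) (\<lambda>\<sigma>. bdry j (Y \<sigma>) A)"
    "A \<in> level j (p - 1)" "p \<ge> 1" "\<sigma> \<in> simplices V l" "q \<in> pl (\<Inter>(set \<sigma>))"
  shows "alt_sum (\<lambda>\<rho>. bdry j (y \<rho>) A q) \<sigma> = 0"
proof -
  have "alt_sum (\<lambda>\<rho>. bdry j (y \<rho>) A q) \<sigma> = bdry j (\<lambda>A q. alt_sum (\<lambda>\<rho>. y \<rho> A q) \<sigma>) A q"
    by (rule bdry_alt_sum[symmetric])
  also have "\<dots> = bdry j (bdry j (Y \<sigma>)) A q"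
  proof (rule bdry_cong[OF assms(2)])
    fix B assume "B \<in> level j (Suc (p - 1))"
    then have "B \<in> level j p" using assms(3) by simp
    then show "alt_sum (\<lambda>\<rho>. y \<rho> B q) \<sigma> = bdry j (Y \<sigma>) B q"
      using assms(1)[of B] assms(4,5) unfolding bounds_def by simp
  qed
  also have "\<dots> = 0" using assms(2) by (intro bdry_bdry) (simp add: level_def)
  finally show ?thesis .
qed

text \<open>Acyclicity of the Koszul complex: lift step by step along its rows with the hypothesis, then
  climb back with the contraction by a nonvanishing coordinate.\<close>

lemma koszul_descent:
  assumes j: "j < length ns" and l0: "l0 \<ge> 1"
    and van: "\<And>p'. p' \<le> p \<Longrightarrow> van (t(j := s - int p')) (l0 + p')"
    and V: "cover V" "adapted V j kk"
    and Y: "\<And>A. A \<in> level j (Suc p) \<Longrightarrow> (\<lambda>\<sigma>. Y \<sigma> A) \<in> cochains V (l0 + p) (t(j := s - int (Suc p)))"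
    and cyc: "\<And>A. A \<in> level j p \<Longrightarrow> cocycle V (l0 + p) (\<lambda>\<sigma>. bdry j (Y \<sigma>) A)"
  obtains V' \<tau> w where "cover V'" "refines V' V \<tau>"
    "\<And>A. A \<in> level j (Suc p) \<Longrightarrow> (\<lambda>\<sigma>. w \<sigma> A) \<in> cochains V' (l0 + p - 1) (t(j := s - int (Suc p)))"
    "\<And>A. A \<in> level j p \<Longrightarrow> bounds V' (l0 + p) (\<lambda>\<rho>. bdry j (w \<rho>) A) (\<lambda>\<sigma>. bdry j (Y (map \<tau> \<sigma>)) A)"
  using van V Y cyc
proof (induction p arbitrary: V kk Y thesis rule: less_induct)
  case (less p V kk Y)
  have c: "(\<lambda>\<sigma>. bdry j (Y \<sigma>) A) \<in> cochains V (l0 + p) (t(j := s - int p))" if "A \<in> level j p" for A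
    by (rule cochains_bdry[OF j less.prems(5) that])
  obtain V1 \<tau>1 y where V1: "cover V1" "refines V1 V \<tau>1"
    and y: "\<And>A. A \<in> level j p \<Longrightarrow> y A \<in> cochains V1 (l0 + p - 1) (t(j := s - int p))"
    and by1: "\<And>A. A \<in> level j p \<Longrightarrow> bounds V1 (l0 + p) (y A) (\<lambda>\<sigma>. bdry j (Y (map \<tau>1 \<sigma>)) A)"
  proof (rule van_family[where c = "\<lambda>A \<sigma>. bdry j (Y \<sigma>) A", OF finite_level[of j p] less.prems(2)[OF order_refl] less.prems(3)])
    show "(\<lambda>\<sigma>. bdry j (Y \<sigma>) A) \<in> cochains V (l0 + p) (t(j := s - int p))" if "A \<in> level j p" for A by (rule c[OF that])
    show "cocycle V (l0 + p) (\<lambda>\<sigma>. bdry j (Y \<sigma>) A)" if "A \<in> level j p" for A by (rule less.prems(6)[OF that])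
  qed (rule that)
  \<comment> \<open>The induction hypothesis, applied with \<open>y\<close> in the role of
    \<open>Y\<close>, finds Koszul boundaries whose Cech coboundary is the Koszul boundary of
    \<open>y\<close>. At p = 0 there is no lower level and zero serves.\<close>
  obtain V2 \<tau>2 w' where V2: "cover V2" "refines V2 V1 \<tau>2"
    and w': "\<And>A. A \<in> level j p \<Longrightarrow> (\<lambda>\<sigma>. w' \<sigma> A) \<in> cochains V2 (l0 + p - 1 - 1) (t(j := s - int p))"
    and bw: "\<And>A. p \<ge> 1 \<Longrightarrow> A \<in> level j (p - 1) \<Longrightarrow>
      bounds V2 (l0 + p - 1) (\<lambda>\<rho>. bdry j (w' \<rho>) A) (\<lambda>\<sigma>. bdry j (\<lambda>A. y A (map \<tau>2 \<sigma>)) A)"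
  proof (cases p)
    case 0
    show ?thesis
      by (rule that[OF V1(1) refines_id, of "\<lambda>_ _ _. 0"]) (use cochains_zero 0 in auto)
  next
    case (Suc p')
    have y': "(\<lambda>\<sigma>. y A \<sigma>) \<in> cochains V1 (l0 + p') (t(j := s - int (Suc p')))" if "A \<in> level j (Suc p')" for A
      using y[of A] that Suc by simp
    have cyc': "cocycle V1 (l0 + p') (\<lambda>\<sigma>. bdry j (\<lambda>A. y A \<sigma>) A)" if A: "A \<in> level j p'" for A
      unfolding cocycle_def
    proof (intro ballI)
      fix \<sigma> q assume "\<sigma> \<in> simplices V1 (Suc (l0 + p'))" "q \<in> pl (\<Inter>(set \<sigma>))"
      then show "alt_sum (\<lambda>\<rho>. bdry j (\<lambda>A. y A \<rho>) A q) \<sigma> = 0"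
        using Suc A by (intro bdry_alt_sum_zero[where p = p and V = V1 and l = "l0 + p" and y = "\<lambda>\<rho> A. y A \<rho>" and Y = "\<lambda>\<sigma>. Y (map \<tau>1 \<sigma>)", OF by1]) simp_all
    qed
    show ?thesis
    proof (rule less.IH[where y = p' and V = V1 and kk = "\<lambda>u. kk (\<tau>1 u)" and Y = "\<lambda>\<sigma> A. y A \<sigma>"])
      fix V' \<tau> w
      assume *: "cover V'" "refines V' V1 \<tau>"
        "\<And>A. A \<in> level j (Suc p') \<Longrightarrow> (\<lambda>\<sigma>. w \<sigma> A) \<in> cochains V' (l0 + p' - 1) (t(j := s - int (Suc p')))"
        "\<And>A. A \<in> level j p' \<Longrightarrow> bounds V' (l0 + p') (\<lambda>\<rho>. bdry j (w \<rho>) A) (\<lambda>\<sigma>. bdry j (\<lambda>A. y A (map \<tau> \<sigma>)) A)"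
      show thesis
        by (rule that[OF *(1,2), of w]) (use *(3,4) Suc in simp_all)
    next
      show "van (t(j := s - int p'')) (l0 + p'')" if "p'' \<le> p'" for p''
        by (rule less.prems(2)) (use that Suc in simp)
    next
      show "p' < p" using Suc by simp
      show "cover V1" by (rule V1(1))
      show "adapted V1 j (\<lambda>u. kk (\<tau>1 u))" by (rule adapted_refine[OF V1(2) less.prems(4)])
      show "(\<lambda>\<sigma>. y A \<sigma>) \<in> cochains V1 (l0 + p') (t(j := s - int (Suc p')))" if "A \<in> level j (Suc p')" for A
        by (rule y'[OF that])
      show "cocycle V1 (l0 + p') (\<lambda>\<sigma>. bdry j (\<lambda>A. y A \<sigma>) A)" if "A \<in> level j p'" for A
        by (rule cyc'[OF that])
    qed
  qed
  \<comment> \<open>The correction is a Cech coboundary, so \<open>u\<close> has the same coboundary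
    as \<open>y\<close>, but it is also a Koszul cycle (\<open>bdu\<close>). Hence its contraction
    \<open>w\<close> satisfies bdry w = u.\<close>
  define u where "u \<sigma> A q = y A (map \<tau>2 \<sigma>) q - alt_sum (\<lambda>\<rho>. w' \<rho> A q) \<sigma>" for \<sigma> A q
  define k2 where "k2 u = kk (\<tau>1 (\<tau>2 u))" for u
  have k2: "adapted V2 j k2"
    unfolding k2_def[abs_def] using adapted_refine[OF V2(2) adapted_refine[OF V1(2) less.prems(4)]] .
  have u: "(\<lambda>\<sigma>. u \<sigma> A) \<in> cochains V2 (l0 + p - 1) (t(j := s - int p))" if A: "A \<in> level j p" for A
    unfolding u_def[abs_def] by (intro cochains_diff cochains_alt_sum w' A cochains_refine[OF V2(2) y])
  define w where "w = contraction j k2 u"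
  have w: "(\<lambda>\<sigma>. w \<sigma> A) \<in> cochains V2 (l0 + p - 1) (t(j := s - int (Suc p)))" if A: "A \<in> level j (Suc p)" for A
    unfolding w_def by (rule cochains_contraction[OF j k2 u A])
  have bdu: "bdry j (u \<rho>) A q = 0" if "p \<ge> 1" "A \<in> level j (p - 1)" "\<rho> \<in> simplices V2 (l0 + p - 1)" "q \<in> pl (\<Inter>(set \<rho>))" for \<rho> A q
  proof -
    have "bdry j (u \<rho>) A q = bdry j (\<lambda>A. y A (map \<tau>2 \<rho>)) A q - alt_sum (\<lambda>\<rho>. bdry j (w' \<rho>) A q) \<rho>"
      unfolding u_def[abs_def] bdry_diff bdry_alt_sum ..
    then show ?thesis using bw[OF that(1,2)] that(3,4) unfolding bounds_def by simp
  qed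
  have wu: "bdry j (w \<rho>) A q = u \<rho> A q"
    if A: "A \<in> level j p" and r: "\<rho> \<in> simplices V2 (l0 + p - 1)" "q \<in> pl (\<Inter>(set \<rho>))" for \<rho> A q
  proof (cases "\<rho> = []")
    case True
    have z: "B \<in> level j p \<Longrightarrow> u \<rho> B q = 0" for B
      using cochD[OF u r(1)] True by simp
    have "w \<rho> B q = 0" if "B \<in> level j (Suc p)" for B
    proof -
      have "k \<in> B \<Longrightarrow> B - {k} \<in> level j p" for k
        using that unfolding level_def by (auto intro: finite_subset)
      then show ?thesis using z by (simp add: w_def contraction_def koszul_wedge_def)
    qed
    then have "bdry j (w \<rho>) A q = bdry j (\<lambda>A q. 0) A q" by (rule bdry_cong[OF A])
    also have "\<dots> = 0" by (simp add: bdry_def koszul_bd_def)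
    finally show ?thesis using z A by simp
  next
    case False
    then obtain l where l: "l0 + p - 1 = Suc l" using r unfolding simplices_def by (cases "l0 + p - 1") auto
    have "contraction j k2 (\<lambda>\<sigma>. bdry j (u \<sigma>)) \<rho> A q = 0"
    proof (cases "k2 (hd \<rho>) \<in> A")
      case True
      then have "A - {k2 (hd \<rho>)} \<in> level j (p - 1)" "p \<ge> 1"
        using A finite_subset[of A "{..ns ! j}"] unfolding level_def
        by (auto simp: Suc_le_eq card_gt_0_iff)
      then show ?thesis using bdu r by (simp add: contraction_def koszul_wedge_def)
    qed (simp add: contraction_def koszul_wedge_def)
    moreover have "bdry j (contraction j k2 u \<rho>) A q + contraction j k2 (\<lambda>\<sigma>. bdry j (u \<sigma>)) \<rho> A q = u \<rho> A q"
      by (rule bdry_contraction[OF k2, of _ l]) (use r l A in \<open>simp_all add: level_def\<close>)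
    ultimately show ?thesis by (simp add: w_def)
  qed
  show ?case
  proof (rule less.prems(1)[OF V2(1) refines_trans[OF V1(2) V2(2)], of w])
    show "(\<lambda>\<sigma>. w \<sigma> A) \<in> cochains V2 (l0 + p - 1) (t(j := s - int (Suc p)))" if "A \<in> level j (Suc p)" for A
      by (rule w[OF that])
    show "bounds V2 (l0 + p) (\<lambda>\<rho>. bdry j (w \<rho>) A) (\<lambda>\<sigma>. bdry j (Y (map (\<lambda>u. \<tau>1 (\<tau>2 u)) \<sigma>)) A)"
      if A: "A \<in> level j p" for A
      unfolding bounds_def
    proof (intro ballI)
      fix \<sigma> q assume s: "\<sigma> \<in> simplices V2 (l0 + p)" "q \<in> pl (\<Inter>(set \<sigma>))"
      have "alt_sum (\<lambda>\<rho>. bdry j (w \<rho>) A q) \<sigma> = alt_sum (\<lambda>\<rho>. u \<rho> A q) \<sigma>"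
      proof (rule alt_sum_cong)
        fix \<rho> assume r: "Suc (length \<rho>) = length \<sigma>" "set \<rho> \<subseteq> set \<sigma>"
        have "pl (\<Inter>(set \<sigma>)) \<subseteq> pl (\<Inter>(set \<rho>))" using r(2) by (intro pl_mono) auto
        moreover have "\<rho> \<in> simplices V2 (l0 + p - 1)" using r s(1) by (auto simp: simplices_def)
        ultimately show "bdry j (w \<rho>) A q = u \<rho> A q" using wu[OF A] s(2) by blast
      qed
      also have "\<dots> = alt_sum (\<lambda>\<rho>. y A (map \<tau>2 \<rho>) q) \<sigma>"
        unfolding u_def alt_sum_diff by (simp add: alt_sum_alt_sum)
      also have "\<dots> = bdry j (Y (map \<tau>1 (map \<tau>2 \<sigma>))) A q"
        using bounds_refine[OF V2(2) by1[OF A]] s unfolding bounds_def by simp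
      finally show "bdry j (Y (map (\<lambda>u. \<tau>1 (\<tau>2 u)) \<sigma>)) A q = alt_sum (\<lambda>\<rho>. bdry j (w \<rho>) A q) \<sigma>"
        by (simp add: comp_def)
    qed
  qed
qed

text \<open>A chase through the exact Koszul complex 0 -> O(s-n-1) -> O(s-n)^(n+1) -> ... -> O(s) ->
  0 of factor j. A class at the left end is moved to the right, losing one cohomological degree per
  step, through terms whose cohomology vanishes by assumption.\<close>

lemma van_koszul:
  assumes j: "j < length ns" and l0: "l0 \<ge> 1"
    and van: "\<And>p. p \<le> ns ! j \<Longrightarrow> van (t(j := s - int p)) (l0 + p)"
  shows "van (t(j := s - int (Suc (ns ! j)))) (l0 + ns ! j)"
  unfolding van_def
proof (intro allI impI)
  fix U c
  let ?n = "ns ! j"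
  let ?t = "t(j := s - int (Suc ?n))"
  assume U: "cover U" and c: "c \<in> cochains U (l0 + ?n) ?t" and cy: "cocycle U (l0 + ?n) c"
  obtain V \<tau> kk where V: "cover V" "refines V U \<tau>" "adapted V j kk"
    using cover_adapted[OF U j] by blast
  \<comment> \<open>The full index set is the left end of the complex and carries the given
    cocycle.\<close>
  define Y where "Y \<sigma> A = (if A = {..?n} then c (map \<tau> \<sigma>) else (\<lambda>q. 0))" for \<sigma> :: "'p set list" and A :: "nat set"
  have full: "A = {..?n}" if "A \<in> level j (Suc ?n)" for A
    using that card_subset_eq[of "{..?n}" A] unfolding level_def by simp
  have full': "{..?n} \<in> level j (Suc ?n)" by (simp add: level_def)
  have Y: "(\<lambda>\<sigma>. Y \<sigma> A) \<in> cochains V (l0 + ?n) ?t" if "A \<in> level j (Suc ?n)" for A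
    using full[OF that] cochains_refine[OF V(2) c] by (simp add: Y_def)
  have Yc: "cocycle V (l0 + ?n) (\<lambda>\<sigma>. Y \<sigma> A)" if "A \<in> level j (Suc ?n)" for A
    using full[OF that] cocycle_refine[OF V(2) cy] by (simp add: Y_def)
  have cyc: "cocycle V (l0 + ?n) (\<lambda>\<sigma>. bdry j (Y \<sigma>) A)" if A: "A \<in> level j ?n" for A
    unfolding cocycle_def
  proof (intro ballI)
    fix \<sigma> q assume s: "\<sigma> \<in> simplices V (Suc (l0 + ?n))" "q \<in> pl (\<Inter>(set \<sigma>))"
    have "alt_sum (\<lambda>\<rho>. bdry j (Y \<rho>) A q) \<sigma> = bdry j (\<lambda>A q. alt_sum (\<lambda>\<rho>. Y \<rho> A q) \<sigma>) A q"
      by (rule bdry_alt_sum[symmetric])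
    also have "\<dots> = bdry j (\<lambda>A q. 0) A q"
      by (rule bdry_cong[OF A]) (use Yc s in \<open>simp add: cocycle_def\<close>)
    finally show "alt_sum (\<lambda>\<rho>. bdry j (Y \<rho>) A q) \<sigma> = 0" by (simp add: bdry_def koszul_bd_def)
  qed
  obtain V' \<tau>' w where V': "cover V'" "refines V' V \<tau>'"
    and w: "\<And>A. A \<in> level j (Suc ?n) \<Longrightarrow> (\<lambda>\<sigma>. w \<sigma> A) \<in> cochains V' (l0 + ?n - 1) ?t"
    and bw: "\<And>A. A \<in> level j ?n \<Longrightarrow> bounds V' (l0 + ?n) (\<lambda>\<rho>. bdry j (w \<rho>) A) (\<lambda>\<sigma>. bdry j (Y (map \<tau>' \<sigma>)) A)"
  proof (rule koszul_descent[OF j l0 _ V(1,3), where p = ?n and Y = Y])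
    show "van (t(j := s - int p)) (l0 + p)" if "p \<le> ?n" for p by (rule van[OF that])
    show "(\<lambda>\<sigma>. Y \<sigma> A) \<in> cochains V (l0 + ?n) ?t" if "A \<in> level j (Suc ?n)" for A by (rule Y[OF that])
    show "cocycle V (l0 + ?n) (\<lambda>\<sigma>. bdry j (Y \<sigma>) A)" if "A \<in> level j ?n" for A by (rule cyc[OF that])
  qed (rule that)
  define k' where "k' u = kk (\<tau>' u)" for u
  have k': "adapted V' j k'" unfolding k'_def[abs_def] by (rule adapted_refine[OF V'(2) V(3)])
  have "bounds V' (l0 + ?n) (\<lambda>\<sigma>. w \<sigma> {..?n}) (\<lambda>\<sigma>. c (map (\<lambda>u. \<tau> (\<tau>' u)) \<sigma>))"
    unfolding bounds_def
  proof (intro ballI)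
    fix \<sigma> q assume s: "\<sigma> \<in> simplices V' (l0 + ?n)" "q \<in> pl (\<Inter>(set \<sigma>))"
    obtain l where l: "l0 + ?n = Suc l" using l0 by (cases "l0 + ?n") auto
    \<comment> \<open>The top component minus the coboundary of \<open>w\<close> is a Koszul cycle.
      The differential is injective at the left end, so this difference is zero and \<open>w\<close>
      is the desired primitive.\<close>
    define z where "z \<sigma> A q = Y (map \<tau>' \<sigma>) A q - alt_sum (\<lambda>\<rho>. w \<rho> A q) \<sigma>" for \<sigma> A q
    have bz: "bdry j (z \<sigma>) A q = 0" if "A \<in> level j ?n" for A
    proof -
      have "bdry j (z \<sigma>) A q = bdry j (Y (map \<tau>' \<sigma>)) A q - alt_sum (\<lambda>\<rho>. bdry j (w \<rho>) A q) \<sigma>"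
        unfolding z_def[abs_def] bdry_diff bdry_alt_sum ..
      then show ?thesis using bw[OF that] s unfolding bounds_def by simp
    qed
    have "z \<sigma> {..?n} q = bdry j (contraction j k' z \<sigma>) {..?n} q + contraction j k' (\<lambda>\<sigma>. bdry j (z \<sigma>)) \<sigma> {..?n} q"
      by (rule bdry_contraction[OF k', of _ l, symmetric]) (use s l in simp_all)
    also have "bdry j (contraction j k' z \<sigma>) {..?n} q = 0" by (simp add: bdry_def koszul_bd_def)
    also have "contraction j k' (\<lambda>\<sigma>. bdry j (z \<sigma>)) \<sigma> {..?n} q = 0"
    proof -
      have "k \<in> {..?n} \<Longrightarrow> {..?n} - {k} \<in> level j ?n" for k by (simp add: level_def)
      then show ?thesis using bz by (simp add: contraction_def koszul_wedge_def)
    qed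
    finally show "c (map (\<lambda>u. \<tau> (\<tau>' u)) \<sigma>) q = alt_sum (\<lambda>\<rho>. w \<rho> {..?n} q) \<sigma>"
      by (simp add: z_def Y_def comp_def)
  qed
  from vanI_witness[OF V'(1) refines_trans[OF V(2) V'(2)] w[OF full'] this]
  show "\<exists>V \<tau> b. cover V \<and> refines V U \<tau> \<and> b \<in> cochains V (l0 + ?n - 1) ?t \<and> bounds V (l0 + ?n) b (\<lambda>\<sigma>. c (map \<tau> \<sigma>))" .
qed

lemma sec_koszul_theta:
  assumes j: "j < length ns" and f: "f \<in> sec (t(j := s)) U"
    and K: "\<And>k. k \<in> set K \<Longrightarrow> k \<le> ns ! j \<and> U \<subseteq> D j k" and A: "finite A"
  shows "(\<lambda>q. f q * koszul_theta (\<lambda>i. inverse (x j i q)) K A) \<in> sec (t(j := s - int (card A))) U"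
proof (cases "koszul_theta (\<lambda>_. 1 :: complex) K A = 0")
  case True
  then have "(\<lambda>q. f q * koszul_theta (\<lambda>i. inverse (x j i q)) K A) = (\<lambda>q. 0)"
    by (intro ext) (subst koszul_theta_scale[OF A], simp)
  then show ?thesis using sec_zero by simp
next
  case False
  then have "A = set K" by (rule koszul_theta_support)
  have "(\<lambda>q. (\<Prod>k\<in>B. inverse (x j k q)) * f q) \<in> sec (t(j := s - int (card B))) U" if "B \<subseteq> set K" for B
    using finite_subset[OF that finite_set] that
  proof (induction B rule: finite_induct)
    case empty
    show ?case using f by (simp only: card.empty of_nat_0 diff_0_right prod.empty mult_1_left)
  next
    case (insert k B)
    have "(\<lambda>q. inverse (x j k q) * ((\<Prod>k\<in>B. inverse (x j k q)) * f q)) \<in> sec (t(j := s - int (card B) - 1)) U"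
    proof (rule sec_inv[OF j])
      show "k \<le> ns ! j" "U \<subseteq> D j k" using K[of k] insert.prems by simp_all
      show "(\<lambda>q. (\<Prod>k\<in>B. inverse (x j k q)) * f q) \<in> sec (t(j := s - int (card B))) U"
        by (rule insert.IH) (use insert.prems in simp)
    qed
    moreover have "s - int (card (insert k B)) = s - int (card B) - 1" using insert.hyps by simp
    moreover have "(\<lambda>q. (\<Prod>k\<in>insert k B. inverse (x j k q)) * f q) = (\<lambda>q. inverse (x j k q) * ((\<Prod>k\<in>B. inverse (x j k q)) * f q))"
      using insert.hyps by (simp add: mult.assoc)
    ultimately show ?case by metis
  qed
  from sec_cmult[OF this[OF order_refl], of "koszul_theta (\<lambda>_. 1 :: complex) K A"]
  have 1: "(\<lambda>q. koszul_theta (\<lambda>_. 1) K A * ((\<Prod>k\<in>A. inverse (x j k q)) * f q)) \<in> sec (t(j := s - int (card A))) U"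
    by (simp only: \<open>A = set K\<close>)
  have "(\<lambda>q. koszul_theta (\<lambda>_. 1) K A * ((\<Prod>k\<in>A. inverse (x j k q)) * f q)) = (\<lambda>q. f q * koszul_theta (\<lambda>i. inverse (x j i q)) K A)"
    by (intro ext) (subst (2) koszul_theta_scale[OF A], simp)
  with 1 show ?thesis by (simp only:)
qed

lemma cochains_koszul_theta:
  assumes j: "j < length ns" and V: "adapted V j kk" and c: "c \<in> cochains V (Suc l) (t(j := s))"
    and A: "A \<subseteq> {..ns ! j}"
  shows "(\<lambda>\<sigma> q. c (take (Suc l) \<sigma>) q * koszul_theta (\<lambda>i. inverse (x j i q)) (map kk (drop l \<sigma>)) A)
    \<in> cochains V (Suc l + m) (t(j := s - int (card A)))"
proof (rule cochI)
  fix \<sigma> assume "\<sigma> \<in> simplices V (Suc l + m)"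
  then have ls: "length \<sigma> = Suc l + m" "set \<sigma> \<subseteq> V" unfolding simplices_def by auto
  then have ts: "take (Suc l) \<sigma> \<in> simplices V (Suc l)" "set (take (Suc l) \<sigma>) \<subseteq> set \<sigma>" "take (Suc l) \<sigma> \<noteq> []"
    using set_take_subset[of "Suc l" \<sigma>] unfolding simplices_def by auto
  have "c (take (Suc l) \<sigma>) \<in> sec (t(j := s)) (\<Inter>(set (take (Suc l) \<sigma>)))"
    using cochD[OF c ts(1)] ts(3) by simp
  then have cs: "c (take (Suc l) \<sigma>) \<in> sec (t(j := s)) (\<Inter>(set \<sigma>))"
    by (rule sec_mono[rotated]) (use ts(2) in blast)
  have "(\<lambda>q. c (take (Suc l) \<sigma>) q * koszul_theta (\<lambda>i. inverse (x j i q)) (map kk (drop l \<sigma>)) A)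
      \<in> sec (t(j := s - int (card A))) (\<Inter>(set \<sigma>))"
  proof (rule sec_koszul_theta[OF j cs])
    show "finite A" using A finite_subset by blast
    fix k assume "k \<in> set (map kk (drop l \<sigma>))"
    then obtain u where "u \<in> set \<sigma>" "k = kk u" using set_drop_subset[of l \<sigma>] by auto
    then show "k \<le> ns ! j \<and> \<Inter>(set \<sigma>) \<subseteq> D j k" using V ls unfolding adapted_def by auto
  qed
  moreover have "\<sigma> \<noteq> []" using ls by auto
  ultimately show "if \<sigma> = [] then \<forall>q. c (take (Suc l) \<sigma>) q * koszul_theta (\<lambda>i. inverse (x j i q)) (map kk (drop l \<sigma>)) A = 0
      else (\<lambda>q. c (take (Suc l) \<sigma>) q * koszul_theta (\<lambda>i. inverse (x j i q)) (map kk (drop l \<sigma>)) A) \<in> sec (t(j := s - int (card A))) (\<Inter>(set \<sigma>))"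
    by (simp only: if_False)
qed

lemma adapted_nz:
  assumes "adapted V j kk" "set \<sigma> \<subseteq> V" "q \<in> pl (\<Inter>(set \<sigma>))" "u \<in> set \<sigma>"
  shows "kk u \<le> ns ! j" "x j (kk u) q \<noteq> 0"
proof -
  show "kk u \<le> ns ! j" using assms unfolding adapted_def by auto
  have "\<Inter>(set \<sigma>) \<subseteq> D j (kk u)" using assms unfolding adapted_def by auto
  then show "x j (kk u) q \<noteq> 0" using pl_mono x_nz assms(3) by blast
qed

text \<open>In the Leibniz rule the coboundary of \<open>c\<close> drops out, and the coboundary of
  \<open>koszul_theta\<close> is its Koszul differential. Thus the coboundary of a product at A is
  expressed by the products at sets with one more element.\<close>

lemma alt_sum_koszul_theta:
  assumes j: "j < length ns" and V: "adapted V j kk" and c: "cocycle V (Suc l) c"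
    and A: "A \<subseteq> {..ns ! j}" and s: "set \<sigma> \<subseteq> V" "length \<sigma> > Suc l" "q \<in> pl (\<Inter>(set \<sigma>))"
  shows "alt_sum (\<lambda>\<rho>. c (take (Suc l) \<rho>) q * koszul_theta (\<lambda>i. inverse (x j i q)) (map kk (drop l \<rho>)) A) \<sigma> =
    (-1) ^ l * bdry j (\<lambda>A q. c (take (Suc l) \<sigma>) q * koszul_theta (\<lambda>i. inverse (x j i q)) (map kk (drop l \<sigma>)) A) A q"
proof -
  define w where "w i = inverse (x j i q)" for i
  define g where "g \<rho> = koszul_theta w (map kk \<rho>) A" for \<rho>
  have "alt_sum (cup (Suc l) (\<lambda>\<rho>. c \<rho> q) g) \<sigma> = alt_sum (\<lambda>\<rho>. c \<rho> q) (take (Suc (Suc l)) \<sigma>) * g (drop (Suc l) \<sigma>)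
      + (-1) ^ l * c (take (Suc l) \<sigma>) q * alt_sum g (drop l \<sigma>)"
    by (rule alt_sum_cup) (use s in simp)
  also have "alt_sum (\<lambda>\<rho>. c \<rho> q) (take (Suc (Suc l)) \<sigma>) = 0"
  proof -
    have ts: "take (Suc (Suc l)) \<sigma> \<in> simplices V (Suc (Suc l))" "set (take (Suc (Suc l)) \<sigma>) \<subseteq> set \<sigma>"
      using s set_take_subset[of "Suc (Suc l)" \<sigma>] unfolding simplices_def by auto
    then have "pl (\<Inter>(set \<sigma>)) \<subseteq> pl (\<Inter>(set (take (Suc (Suc l)) \<sigma>)))" by (intro pl_mono) auto
    then show ?thesis using c ts(1) s(3) unfolding cocycle_def by blast
  qed
  also have "alt_sum g (drop l \<sigma>) = bdry j (\<lambda>A q. koszul_theta (\<lambda>i. inverse (x j i q)) (map kk (drop l \<sigma>)) A) A q"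
  proof -
    have ds: "set (drop l \<sigma>) \<subseteq> set \<sigma>" by (rule set_drop_subset)
    have "bdry j (\<lambda>A q. koszul_theta (\<lambda>i. inverse (x j i q)) (map kk (drop l \<sigma>)) A) A q = alt_sum (\<lambda>K. koszul_theta w K A) (map kk (drop l \<sigma>))"
      unfolding bdry_def w_def[abs_def]
      by (rule koszul_bd_koszul_theta) (use A adapted_nz[OF V s(1,3)] ds in auto)
    then show ?thesis by (simp add: alt_sum_map g_def[abs_def])
  qed
  finally show ?thesis
    unfolding bdry_def koszul_bd_cmult by (simp add: cup_def[abs_def] g_def w_def[abs_def])
qed

text \<open>The class of \<open>koszul_theta\<close> is the iterated connecting map of the Koszul complex, and the
  hypothesis makes it injective. The correction term \<open>r\<close> records what the Koszul differential
  kills in each step of the downward induction on \<open>m\<close>.\<close>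

lemma koszul_ascent:
  assumes j: "j < length ns"
    and van: "\<And>p. 1 \<le> p \<Longrightarrow> p \<le> ns ! j \<Longrightarrow> van (t(j := s - int p)) (l + p)"
    and m: "m \<le> ns ! j"
    and V: "cover V" "adapted V j kk"
    and c: "c \<in> cochains V (Suc l) (t(j := s))" "cocycle V (Suc l) c"
    and b: "\<And>A. A \<in> level j (Suc m) \<Longrightarrow> (\<lambda>\<sigma>. b \<sigma> A) \<in> cochains V (l + m) (t(j := s - int (Suc m)))"
    and r: "\<And>A \<sigma> q. A \<in> level j m \<Longrightarrow> \<sigma> \<in> simplices V (Suc l + m) \<Longrightarrow> q \<in> pl (\<Inter>(set \<sigma>)) \<Longrightarrow> bdry j (r \<sigma>) A q = 0"
    and eq: "\<And>A \<sigma> q. A \<in> level j (Suc m) \<Longrightarrow> \<sigma> \<in> simplices V (Suc l + m) \<Longrightarrow> q \<in> pl (\<Inter>(set \<sigma>)) \<Longrightarrow>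
      c (take (Suc l) \<sigma>) q * koszul_theta (\<lambda>i. inverse (x j i q)) (map kk (drop l \<sigma>)) A + r \<sigma> A q = alt_sum (\<lambda>\<rho>. b \<rho> A q) \<sigma>"
  obtains V' \<tau> b' where "cover V'" "refines V' V \<tau>" "b' \<in> cochains V' l (t(j := s))"
    "bounds V' (Suc l) b' (\<lambda>\<sigma>. c (map \<tau> \<sigma>))"
  using m V c b r eq
proof (induction m arbitrary: V kk c b r thesis)
  case (0 V kk c b r)
  have e: "{} \<in> level j 0" by (simp add: level_def)
  \<comment> \<open>The Koszul differential of \<open>koszul_theta\<close> for a single vertex is 1
    at the empty set. Applied to the equation \<open>eq\<close> at level one it returns
    \<open>c\<close> itself and removes \<open>r\<close>.\<close>
  have "bounds V (Suc l) (\<lambda>\<rho>. bdry j (b \<rho>) {}) (\<lambda>\<sigma>. c (map (\<lambda>u. u) \<sigma>))"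
    unfolding bounds_def
  proof (intro ballI)
    fix \<sigma> q assume s: "\<sigma> \<in> simplices V (Suc l)" "q \<in> pl (\<Inter>(set \<sigma>))"
    have ls: "length \<sigma> = Suc l" "set \<sigma> \<subseteq> V" using s unfolding simplices_def by auto
    then have "length (drop l \<sigma>) = Suc 0" by simp
    then obtain u where u: "drop l \<sigma> = [u]" by (cases "drop l \<sigma>") simp_all
    then have uin: "u \<in> set \<sigma>" by (metis in_set_dropD list.set_intros(1))
    then have ku: "kk u \<le> ns ! j" "\<Inter>(set \<sigma>) \<subseteq> D j (kk u)" using 0(4) ls unfolding adapted_def by auto
    then have nz: "x j (kk u) q \<noteq> 0" using pl_mono x_nz s(2) by blast
    have "alt_sum (\<lambda>\<rho>. bdry j (b \<rho>) {} q) \<sigma> = bdry j (\<lambda>A q. alt_sum (\<lambda>\<rho>. b \<rho> A q) \<sigma>) {} q"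
      by (rule bdry_alt_sum[symmetric])
    also have "\<dots> = bdry j (\<lambda>A q. c \<sigma> q * koszul_theta (\<lambda>i. inverse (x j i q)) [kk u] A - (- 1) * r \<sigma> A q) {} q"
    proof (rule bdry_cong[OF e])
      fix B assume "B \<in> level j (Suc 0)"
      then show "alt_sum (\<lambda>\<rho>. b \<rho> B q) \<sigma> = c \<sigma> q * koszul_theta (\<lambda>i. inverse (x j i q)) [kk u] B - (- 1) * r \<sigma> B q"
        using 0(9)[of B \<sigma> q] s ls u by simp
    qed
    also have "\<dots> = bdry j (\<lambda>A q. c \<sigma> q * koszul_theta (\<lambda>i. inverse (x j i q)) [kk u] A) {} q - (- 1) * bdry j (r \<sigma>) {} q"
      unfolding bdry_diff unfolding bdry_def koszul_bd_cmult ..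
    also have "bdry j (r \<sigma>) {} q = 0" using 0(8)[OF e, of \<sigma> q] s by simp
    also have "bdry j (\<lambda>A q. c \<sigma> q * koszul_theta (\<lambda>i. inverse (x j i q)) [kk u] A) {} q
        = c \<sigma> q * alt_sum (\<lambda>K. koszul_theta (\<lambda>i. inverse (x j i q)) K {}) [kk u]"
      unfolding bdry_def koszul_bd_cmult by (subst koszul_bd_koszul_theta) (use ku nz in auto)
    also have "\<dots> = c \<sigma> q" by simp
    finally show "c (map (\<lambda>u. u) \<sigma>) q = alt_sum (\<lambda>\<rho>. bdry j (b \<rho>) {} q) \<sigma>" by simp
  qed
  moreover have "(\<lambda>\<rho>. bdry j (b \<rho>) {}) \<in> cochains V (l + 0) (t(j := s - int 0))"
    by (rule cochains_bdry[OF j 0(7) e])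
  then have "(\<lambda>\<rho>. bdry j (b \<rho>) {}) \<in> cochains V l (t(j := s))" by (simp only: diff_0_right add_0_right of_nat_0)
  ultimately show ?case by (intro 0(1)[OF 0(3) refines_id])
next
  case (Suc m V kk c b r)
  define w where "w q i = inverse (x j i q)" for q i
  \<comment> \<open>Both terms have the same Cech coboundary: for the first it is a sign times the
    Koszul differential of the products one level up, and the given equation turns these into
    coboundaries of \<open>b\<close>, as \<open>r\<close> is killed. The difference is a cocycle at
    a length and degree where cohomology vanishes.\<close>
  define z where "z A \<sigma> q = c (take (Suc l) \<sigma>) q * koszul_theta (w q) (map kk (drop l \<sigma>)) A - (-1) ^ l * bdry j (b \<sigma>) A q" for A \<sigma> q
  have z: "z A \<in> cochains V (l + Suc m) (t(j := s - int (Suc m)))" if A: "A \<in> level j (Suc m)" for A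
    unfolding z_def w_def[abs_def]
  proof (intro cochains_diff cochains_cmult cochains_bdry[OF j Suc.prems(7) A])
    have "card A = Suc m" "A \<subseteq> {..ns ! j}" using A by (simp_all add: level_def)
    then show "(\<lambda>\<sigma> q. c (take (Suc l) \<sigma>) q * koszul_theta (\<lambda>i. inverse (x j i q)) (map kk (drop l \<sigma>)) A) \<in> cochains V (l + Suc m) (t(j := s - int (Suc m)))"
      using cochains_koszul_theta[OF j Suc.prems(4,5), of A m] by (simp only: add_Suc add_Suc_right)
  qed
  have zc: "cocycle V (l + Suc m) (z A)" if A: "A \<in> level j (Suc m)" for A
    unfolding cocycle_def
  proof (intro ballI)
    fix \<sigma> q assume s: "\<sigma> \<in> simplices V (Suc (l + Suc m))" "q \<in> pl (\<Inter>(set \<sigma>))"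
    then have ls: "length \<sigma> = Suc (l + Suc m)" "set \<sigma> \<subseteq> V" unfolding simplices_def by auto
    define G where "G \<rho> = c (take (Suc l) \<rho>) q * koszul_theta (w q) (map kk (drop l \<rho>)) A" for \<rho>
    have 1: "alt_sum G \<sigma> = (-1) ^ l * bdry j (\<lambda>A q. c (take (Suc l) \<sigma>) q * koszul_theta (w q) (map kk (drop l \<sigma>)) A) A q"
      unfolding w_def[abs_def] G_def[abs_def]
      by (rule alt_sum_koszul_theta[OF j Suc.prems(4,6)]) (use ls A s in \<open>auto simp: level_def\<close>)
    have "bdry j (\<lambda>A q. c (take (Suc l) \<sigma>) q * koszul_theta (w q) (map kk (drop l \<sigma>)) A) A q
        = bdry j (\<lambda>A q. alt_sum (\<lambda>\<rho>. b \<rho> A q) \<sigma> - r \<sigma> A q) A q"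
    proof (rule bdry_cong[OF A])
      fix B assume "B \<in> level j (Suc (Suc m))"
      then show "c (take (Suc l) \<sigma>) q * koszul_theta (w q) (map kk (drop l \<sigma>)) B = alt_sum (\<lambda>\<rho>. b \<rho> B q) \<sigma> - r \<sigma> B q"
        using Suc.prems(9)[of B \<sigma> q] s unfolding w_def[abs_def] by (simp add: algebra_simps)
    qed
    also have "\<dots> = alt_sum (\<lambda>\<rho>. bdry j (b \<rho>) A q) \<sigma>"
      unfolding bdry_diff bdry_alt_sum using Suc.prems(8)[OF A, of \<sigma> q] s by simp
    finally have 2: "alt_sum G \<sigma> = (-1) ^ l * alt_sum (\<lambda>\<rho>. bdry j (b \<rho>) A q) \<sigma>"
      unfolding 1 by simp
    have "(\<lambda>\<rho>. z A \<rho> q) = (\<lambda>\<rho>. G \<rho> - (-1) ^ l * bdry j (b \<rho>) A q)"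
      by (simp add: z_def G_def)
    then show "alt_sum (\<lambda>\<rho>. z A \<rho> q) \<sigma> = 0"
      by (simp add: alt_sum_diff alt_sum_cmult 2)
  qed
  obtain V1 \<tau>1 y where V1: "cover V1" "refines V1 V \<tau>1"
    and y: "\<And>A. A \<in> level j (Suc m) \<Longrightarrow> y A \<in> cochains V1 (l + Suc m - 1) (t(j := s - int (Suc m)))"
    and by1: "\<And>A. A \<in> level j (Suc m) \<Longrightarrow> bounds V1 (l + Suc m) (y A) (\<lambda>\<sigma>. z A (map \<tau>1 \<sigma>))"
  proof (rule van_family[where c = z, OF finite_level[of j "Suc m"] van[of "Suc m"] Suc.prems(3)])
    show "z A \<in> cochains V (l + Suc m) (t(j := s - int (Suc m)))" if "A \<in> level j (Suc m)" for A by (rule z[OF that])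
    show "cocycle V (l + Suc m) (z A)" if "A \<in> level j (Suc m)" for A by (rule zc[OF that])
    show "1 \<le> Suc m" "Suc m \<le> ns ! j" using Suc.prems(2) by simp_all
  qed (rule that)
  have V1': "adapted V1 j (\<lambda>u. kk (\<tau>1 u))" by (rule adapted_refine[OF V1(2) Suc.prems(4)])
  show ?case
  \<comment> \<open>The correction for the next step is minus the Koszul boundary of
    \<open>b\<close> up to sign, and the Koszul differential kills it because it squares to
    zero.\<close>
  proof (rule Suc.IH[where V = V1 and kk = "\<lambda>u. kk (\<tau>1 u)" and c = "\<lambda>\<sigma>. c (map \<tau>1 \<sigma>)" and b = "\<lambda>\<sigma> A. y A \<sigma>" and r = "\<lambda>\<sigma> A q. (- ((-1) ^ l)) * bdry j (b (map \<tau>1 \<sigma>)) A q"])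
    fix V' \<tau> b' assume *: "cover V'" "refines V' V1 \<tau>" "b' \<in> cochains V' l (t(j := s))"
      "bounds V' (Suc l) b' (\<lambda>\<sigma>. c (map \<tau>1 (map \<tau> \<sigma>)))"
    show thesis
      by (rule Suc.prems(1)[OF *(1) refines_trans[OF V1(2) *(2)] *(3)]) (use *(4) in \<open>simp add: comp_def\<close>)
  next
    show "m \<le> ns ! j" using Suc.prems(2) by simp
    show "cover V1" "adapted V1 j (\<lambda>u. kk (\<tau>1 u))" by fact+
    show "(\<lambda>\<sigma>. c (map \<tau>1 \<sigma>)) \<in> cochains V1 (Suc l) (t(j := s))" by (rule cochains_refine[OF V1(2) Suc.prems(5)])
    show "cocycle V1 (Suc l) (\<lambda>\<sigma>. c (map \<tau>1 \<sigma>))" by (rule cocycle_refine[OF V1(2) Suc.prems(6)])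
    show "(\<lambda>\<sigma>. y A \<sigma>) \<in> cochains V1 (l + m) (t(j := s - int (Suc m)))" if "A \<in> level j (Suc m)" for A
      using y[OF that] by simp
    show "bdry j (\<lambda>A q. (- ((-1) ^ l)) * bdry j (b (map \<tau>1 \<sigma>)) A q) A q = 0"
      if A: "A \<in> level j m" and "\<sigma> \<in> simplices V1 (Suc l + m)" "q \<in> pl (\<Inter>(set \<sigma>))" for A \<sigma> q
    proof -
      have "bdry j (\<lambda>A q. (- ((-1) ^ l)) * bdry j (b (map \<tau>1 \<sigma>)) A q) A q = (- ((-1) ^ l)) * bdry j (bdry j (b (map \<tau>1 \<sigma>))) A q"
        unfolding bdry_def by (rule koszul_bd_cmult)
      also have "bdry j (bdry j (b (map \<tau>1 \<sigma>))) A q = 0" using A by (intro bdry_bdry) (simp add: level_def)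
      finally show ?thesis by simp
    qed
    show "c (map \<tau>1 (take (Suc l) \<sigma>)) q * koszul_theta (\<lambda>i. inverse (x j i q)) (map (\<lambda>u. kk (\<tau>1 u)) (drop l \<sigma>)) A
        + (- ((-1) ^ l)) * bdry j (b (map \<tau>1 \<sigma>)) A q = alt_sum (\<lambda>\<rho>. y A \<rho> q) \<sigma>"
      if A: "A \<in> level j (Suc m)" and s: "\<sigma> \<in> simplices V1 (Suc l + m)" "q \<in> pl (\<Inter>(set \<sigma>))" for A \<sigma> q
    proof -
      have "z A (map \<tau>1 \<sigma>) q = alt_sum (\<lambda>\<rho>. y A \<rho> q) \<sigma>"
        using by1[OF A] s unfolding bounds_def by simp
      then show ?thesis unfolding z_def w_def[abs_def] by (simp add: take_map drop_map comp_def)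
    qed
  qed
qed

end

section \<open>Iteration over the factors\<close>

context graded_sheaf
begin

definition dim_sum :: "nat \<Rightarrow> nat" where "dim_sum q = (\<Sum>j<q. ns ! j)"

text \<open>The degree of the canonical bundle of the product of the first q factors, extended by 0
  to the other factors; \<open>dim_sum q\<close> is the dimension of that product.\<close>

definition canon_deg :: "nat \<Rightarrow> nat \<Rightarrow> int" where "canon_deg q j = (if j < q then - int (ns ! j) - 1 else 0)"

lemma dim_sum_Suc: "dim_sum (Suc q) = dim_sum q + ns ! q" by (simp add: dim_sum_def)

lemma canon_deg_upd: "canon_deg q = (canon_deg q)(q := 0)" by (auto simp: canon_deg_def)

lemma canon_deg_Suc: "canon_deg (Suc q) = (canon_deg q)(q := 0 - int (Suc (ns ! q)))" by (auto simp: canon_deg_def)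

text \<open>Extends the vanishing to degrees outside of the box. A factor at -n_j - 1 counts only
  n_j towards the length, and \<open>van_koszul\<close> in this factor reduces it to the degrees 0,
  ..., -n_j. The negative entry at \<open>j0\<close>, in a factor that is never modified, keeps the
  starting length at least 1.\<close>

lemma van_multi:
  assumes H: "\<And>t l. (\<forall>j<length ns. - int (ns ! j) \<le> t j \<and> t j \<le> 0) \<Longrightarrow> (\<forall>j\<ge>length ns. t j = 0) \<Longrightarrow>
      (\<Sum>j<length ns. t j) = - int l \<Longrightarrow> l \<ge> 1 \<Longrightarrow> van t l"
    and t: "\<forall>j<q. t j = - int (ns ! j) - 1" "\<forall>j. q \<le> j \<and> j < length ns \<longrightarrow> - int (ns ! j) \<le> t j \<and> t j \<le> 0"
      "\<forall>j\<ge>length ns. t j = 0" "q \<le> j0" "j0 < length ns" "t j0 < 0"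
    and l: "int l = (\<Sum>j<length ns. if j < q then int (ns ! j) else - t j)"
  shows "van t l"
  using t l
proof (induction q arbitrary: t l)
  case 0
  have "(\<Sum>j<length ns. t j) = - int l" using 0(7) by (simp add: sum_negf)
  moreover have "l \<ge> 1"
  proof -
    have "- t j0 \<le> (\<Sum>j<length ns. - t j)"
      by (rule member_le_sum) (use 0 in auto)
    then show ?thesis using 0(6,7) by simp
  qed
  ultimately show ?case using H[of t l] 0 by simp
next
  case (Suc q)
  let ?r = "length ns" and ?n = "ns ! q"
  have q: "q < ?r" using Suc.prems by simp
  have canon_deg: "t q = - int ?n - 1" using Suc.prems(1) by simp
  define F where "F a j = (if j < q then int (ns ! j) else - (t(q := a)) j)" for a j
  have F: "(\<Sum>j<?r. F a j) = (\<Sum>j\<in>{..<?r} - {q}. F 0 j) - a" for a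
  proof -
    have "(\<Sum>j<?r. F a j) = F a q + (\<Sum>j\<in>{..<?r} - {q}. F a j)"
      using q by (intro sum.remove) auto
    also have "(\<Sum>j\<in>{..<?r} - {q}. F a j) = (\<Sum>j\<in>{..<?r} - {q}. F 0 j)"
      by (rule sum.cong) (auto simp: F_def)
    finally show ?thesis by (simp add: F_def)
  qed
  have l: "int l = (\<Sum>j<?r. F (- int ?n) j)"
    unfolding Suc.prems(7) by (rule sum.cong) (auto simp: F_def less_Suc_eq)
  have F0: "(\<Sum>j<?r. F 0 j) \<ge> 1"
  proof -
    have "F 0 j0 \<le> (\<Sum>j<?r. F 0 j)"
    proof (rule member_le_sum)
      fix j assume "j \<in> {..<?r} - {j0}"
      then show "0 \<le> F 0 j" using Suc.prems(2) by (auto simp: F_def not_less)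
    qed (use Suc.prems in auto)
    moreover have "F 0 j0 = - t j0" using Suc.prems(4) by (auto simp: F_def)
    ultimately show ?thesis using Suc.prems(6) by simp
  qed
  \<comment> \<open>The length that belongs to entry 0 in factor q. Entry -p raises it by p, which
    matches the indices of \<open>van_koszul\<close>.\<close>
  define l0 where "l0 = nat (\<Sum>j<?r. F 0 j)"
  have l0: "int l0 = (\<Sum>j<?r. F 0 j)" "l0 \<ge> 1" using F0 by (auto simp: l0_def)
  have ll0: "l = l0 + ?n" using l l0(1) F[of 0] F[of "- int ?n"] by simp
  have "van (t(q := 0 - int (Suc ?n))) (l0 + ?n)"
  proof (rule van_koszul[OF q l0(2)])
    fix p assume p: "p \<le> ?n"
    have "int (l0 + p) = (\<Sum>j<?r. F (0 - int p) j)" using l0(1) F[of 0] F[of "0 - int p"] by simp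
    then show "van (t(q := 0 - int p)) (l0 + p)"
      using p Suc.prems q unfolding F_def by (intro Suc.IH) (auto simp: le_Suc_eq)
  qed
  moreover have "t(q := 0 - int (Suc ?n)) = t" using canon_deg by auto
  ultimately show ?case using ll0 by simp
qed

text \<open>The cup product of the section with the generators of H^n(P^n, O(-n-1)) for the first
  factors. Consecutive cup factors share a vertex, hence \<open>Suc (dim_sum j)\<close> in front and
  \<open>dim_sum j\<close> behind.\<close>

fun theta_product :: "('q \<Rightarrow> complex) \<Rightarrow> (nat \<Rightarrow> 'p set \<Rightarrow> nat) \<Rightarrow> nat \<Rightarrow> 'p set list \<Rightarrow> 'q \<Rightarrow> complex" where
  "theta_product s kk 0 \<sigma> q = s q"
| "theta_product s kk (Suc j) \<sigma> q = theta_product s kk j (take (Suc (dim_sum j)) \<sigma>) q *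
     koszul_theta (\<lambda>i. inverse (x j i q)) (map (kk j) (drop (dim_sum j) \<sigma>)) {..ns ! j}"

lemma theta_product_map: "theta_product s kk j (map \<tau> \<sigma>) q = theta_product s (\<lambda>j u. kk j (\<tau> u)) j \<sigma> q"
  by (induction j arbitrary: \<sigma>) (simp_all add: take_map drop_map comp_def)

lemma theta_product_cocycle:
  assumes V: "cover V" "\<And>j. j < length ns \<Longrightarrow> adapted V j (kk j)" and s: "s \<in> sec (\<lambda>_. 0) X"
  shows "m \<le> length ns \<Longrightarrow> theta_product s kk m \<in> cochains V (Suc (dim_sum m)) (canon_deg m) \<and> cocycle V (Suc (dim_sum m)) (theta_product s kk m)"
proof (induction m)
  case 0
  have "theta_product s kk 0 \<in> cochains V (Suc (dim_sum 0)) (canon_deg 0)"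
  proof (rule cochI)
    fix \<sigma> assume "\<sigma> \<in> simplices V (Suc (dim_sum 0))"
    then have s1: "\<sigma> \<noteq> []" "\<Inter>(set \<sigma>) \<subseteq> X" using V(1) unfolding simplices_def cover_def dim_sum_def by (auto simp: length_Suc_conv)
    have "theta_product s kk 0 \<sigma> = s" "canon_deg 0 = (\<lambda>_. 0)" by (auto simp: canon_deg_def)
    then show "if \<sigma> = [] then \<forall>q. theta_product s kk 0 \<sigma> q = 0 else theta_product s kk 0 \<sigma> \<in> sec (canon_deg 0) (\<Inter>(set \<sigma>))"
      using sec_mono[OF s1(2) s] s1 by (simp only: if_False)
  qed
  moreover have "cocycle V (Suc (dim_sum 0)) (theta_product s kk 0)"
    unfolding cocycle_def dim_sum_def simplices_def by (auto simp: length_Suc_conv)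
  ultimately show ?case ..
next
  case (Suc m)
  then have m: "m < length ns" and IH: "theta_product s kk m \<in> cochains V (Suc (dim_sum m)) (canon_deg m)" "cocycle V (Suc (dim_sum m)) (theta_product s kk m)" by auto
  have IH1: "theta_product s kk m \<in> cochains V (Suc (dim_sum m)) ((canon_deg m)(m := 0))" using IH(1) canon_deg_upd[of m] by simp
  have e: "theta_product s kk (Suc m) = (\<lambda>\<sigma> q. theta_product s kk m (take (Suc (dim_sum m)) \<sigma>) q * koszul_theta (\<lambda>i. inverse (x m i q)) (map (kk m) (drop (dim_sum m) \<sigma>)) {..ns ! m})"
    by (intro ext) simp
  have "theta_product s kk (Suc m) \<in> cochains V (Suc (dim_sum (Suc m))) (canon_deg (Suc m))"
    unfolding e canon_deg_Suc using cochains_koszul_theta[OF m V(2)[OF m] IH1 order_refl, of "ns ! m"] by (simp only: dim_sum_Suc add_Suc card_atMost)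
  moreover have "cocycle V (Suc (dim_sum (Suc m))) (theta_product s kk (Suc m))"
    unfolding cocycle_def
  proof (intro ballI)
    fix \<sigma> q assume "\<sigma> \<in> simplices V (Suc (Suc (dim_sum (Suc m))))" and q: "q \<in> pl (\<Inter>(set \<sigma>))"
    then have "set \<sigma> \<subseteq> V" "length \<sigma> > Suc (dim_sum m)" unfolding simplices_def by (auto simp: dim_sum_Suc)
    then have "alt_sum (\<lambda>\<rho>. theta_product s kk (Suc m) \<rho> q) \<sigma> = (-1) ^ dim_sum m * bdry m (\<lambda>A q. theta_product s kk m (take (Suc (dim_sum m)) \<sigma>) q *
        koszul_theta (\<lambda>i. inverse (x m i q)) (map (kk m) (drop (dim_sum m) \<sigma>)) A) {..ns ! m} q"
      unfolding e by (rule alt_sum_koszul_theta[OF m V(2)[OF m] IH(2) order_refl _ _ q])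
    then show "alt_sum (\<lambda>\<rho>. theta_product s kk (Suc m) \<rho> q) \<sigma> = 0" by (simp add: bdry_def koszul_bd_def)
  qed
  ultimately show ?case ..
qed

text \<open>Peels the factors off from the last to the first: \<open>koszul_ascent\<close> without
  correction term turns a primitive of the product over m + 1 factors into one of the product over m
  factors. In the end the section itself has a primitive on the empty simplex, where only zero
  lives.\<close>

lemma theta_product_descent:
  assumes H: "\<And>t l. (\<forall>j<length ns. - int (ns ! j) \<le> t j \<and> t j \<le> 0) \<Longrightarrow> (\<forall>j\<ge>length ns. t j = 0) \<Longrightarrow>
      (\<Sum>j<length ns. t j) = - int l \<Longrightarrow> l \<ge> 1 \<Longrightarrow> van t l"
    and s: "s \<in> sec (\<lambda>_. 0) X" and q0: "q0 \<in> pl X"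
  shows "m \<le> length ns \<Longrightarrow> cover V \<Longrightarrow> (\<And>j. j < length ns \<Longrightarrow> adapted V j (kk j)) \<Longrightarrow>
    b \<in> cochains V (dim_sum m) (canon_deg m) \<Longrightarrow> bounds V (Suc (dim_sum m)) b (theta_product s kk m) \<Longrightarrow> s q0 = 0"
proof (induction m arbitrary: V kk b)
  case (0 V kk b)
  have "q0 \<in> pl (\<Union>V)" using q0 0 by (simp add: cover_def)
  then obtain u where u: "u \<in> V" "q0 \<in> pl u" using pl_Union by blast
  have "[] \<in> simplices V (dim_sum 0)" "[u] \<in> simplices V (Suc (dim_sum 0))" using u by (auto simp: simplices_def dim_sum_def)
  then have "b [] q0 = 0" "s q0 = alt_sum (\<lambda>\<rho>. b \<rho> q0) [u]"
    using cochD[OF 0(4)] 0(5) u(2) unfolding bounds_def by (force, fastforce)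
  then show ?case by simp
next
  case (Suc m V kk b)
  let ?n = "ns ! m"
  have m: "m < length ns" using Suc.prems by simp
  have cy: "theta_product s kk m \<in> cochains V (Suc (dim_sum m)) (canon_deg m)" "cocycle V (Suc (dim_sum m)) (theta_product s kk m)"
    using theta_product_cocycle[OF Suc.prems(2,3) s, of m] m by auto
  have cy': "theta_product s kk m \<in> cochains V (Suc (dim_sum m)) ((canon_deg m)(m := 0))" using cy(1) canon_deg_upd[of m] by simp
  have full: "A = {..?n}" if "A \<in> level m (Suc ?n)" for A
    using that card_subset_eq[of "{..?n}" A] unfolding level_def by simp
  obtain V' \<tau> b' where V': "cover V'" "refines V' V \<tau>" "b' \<in> cochains V' (dim_sum m) ((canon_deg m)(m := 0))"
    "bounds V' (Suc (dim_sum m)) b' (\<lambda>\<sigma>. theta_product s kk m (map \<tau> \<sigma>))"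
  proof (rule koszul_ascent[OF m _ order_refl Suc.prems(2) Suc.prems(3)[OF m] cy' cy(2), where b = "\<lambda>\<sigma> A. b \<sigma>" and r = "\<lambda>_ _ _. 0"])
    fix p assume p: "1 \<le> p" "p \<le> ?n"
    show "van ((canon_deg m)(m := 0 - int p)) (dim_sum m + p)"
    \<comment> \<open>Factors before m sit at -n_j - 1, factor m at -p, and later ones at 0. As p is
      positive, m itself is the required factor with a negative entry.\<close>
    proof (rule van_multi[OF H, where q = m and ?j0.0 = m])
      have "(\<Sum>j<length ns. if j < m then int (ns ! j) else - ((canon_deg m)(m := 0 - int p)) j)
          = (\<Sum>j<Suc m. if j < m then int (ns ! j) else - ((canon_deg m)(m := 0 - int p)) j)"
        by (rule sum.mono_neutral_right) (use m in \<open>auto simp: canon_deg_def\<close>)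
      also have "\<dots> = int (dim_sum m) + int p" by (simp add: dim_sum_def)
      finally show "int (dim_sum m + p) = (\<Sum>j<length ns. if j < m then int (ns ! j) else - ((canon_deg m)(m := 0 - int p)) j)"
        by simp
    qed (use p m in \<open>auto simp: canon_deg_def\<close>)
  next
    fix A assume "A \<in> level m (Suc ?n)"
    show "b \<in> cochains V (dim_sum m + ?n) ((canon_deg m)(m := 0 - int (Suc ?n)))"
      using Suc.prems(4) by (simp only: dim_sum_Suc canon_deg_Suc)
  next
    fix A \<sigma> q assume "A \<in> level m ?n"
    show "bdry m (\<lambda>_ _. 0) A q = 0" by (simp add: bdry_def koszul_bd_def)
  next
    fix A \<sigma> q assume A: "A \<in> level m (Suc ?n)" and s: "\<sigma> \<in> simplices V (Suc (dim_sum m) + ?n)" "q \<in> pl (\<Inter>(set \<sigma>))"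
    have "theta_product s kk (Suc m) \<sigma> q = alt_sum (\<lambda>\<rho>. b \<rho> q) \<sigma>"
      using Suc.prems(5) s unfolding bounds_def by (simp add: dim_sum_Suc)
    then show "theta_product s kk m (take (Suc (dim_sum m)) \<sigma>) q * koszul_theta (\<lambda>i. inverse (x m i q)) (map (kk m) (drop (dim_sum m) \<sigma>)) A + 0 = alt_sum (\<lambda>\<rho>. b \<rho> q) \<sigma>"
      using full[OF A] by simp
  qed (rule that)
  have b': "b' \<in> cochains V' (dim_sum m) (canon_deg m)" using V'(3) canon_deg_upd[of m] by simp
  have e: "(\<lambda>\<sigma>. theta_product s kk m (map \<tau> \<sigma>)) = theta_product s (\<lambda>j u. kk j (\<tau> u)) m"
    by (intro ext) (rule theta_product_map)
  show ?case
    by (rule Suc.IH[OF _ V'(1) _ b' V'(4)[unfolded e]]) (use m adapted_refine[OF V'(2) Suc.prems(3)] in auto)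
qed

section \<open>An explicit primitive of the product class\<close>

fun sign_product :: "(nat \<Rightarrow> 'p set \<Rightarrow> nat) \<Rightarrow> nat \<Rightarrow> 'p set list \<Rightarrow> complex" where
  "sign_product kk 0 \<sigma> = 1"
| "sign_product kk (Suc j) \<sigma> = sign_product kk j (take (Suc (dim_sum j)) \<sigma>) * koszul_theta (\<lambda>i. 1) (map (kk j) (drop (dim_sum j) \<sigma>)) {..ns ! j}"

text \<open>Prefixing k to the list of factor j is a cone construction: the coboundary becomes
  \<open>sign_product\<close>, while the vertices need not provide the coordinate (j, k). The power
  of -1 undoes the Leibniz sign. For factors after j the front part has one vertex less, hence the
  shifted splitting.\<close>

fun sign_primitive :: "(nat \<Rightarrow> 'p set \<Rightarrow> nat) \<Rightarrow> nat \<Rightarrow> nat \<Rightarrow> nat \<Rightarrow> 'p set list \<Rightarrow> complex" where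
  "sign_primitive kk j k 0 \<sigma> = 0"
| "sign_primitive kk j k (Suc m) \<sigma> = (if m = j then (-1) ^ dim_sum m * (sign_product kk m (take (Suc (dim_sum m)) \<sigma>) * koszul_theta (\<lambda>i. 1) (k # map (kk m) (drop (dim_sum m) \<sigma>)) {..ns ! m})
     else if j < m then sign_primitive kk j k m (take (dim_sum m) \<sigma>) * koszul_theta (\<lambda>i. 1) (map (kk m) (drop (dim_sum m - 1) \<sigma>)) {..ns ! m} else 0)"

text \<open>All dependence on the place sits in the section divided by the product of the
  coordinates; what remains is a constant cochain of signs, for which primitives can be sought
  combinatorially.\<close>

lemma theta_product_sign_product: "theta_product s kk m \<sigma> q = sign_product kk m \<sigma> * (s q * (\<Prod>j<m. \<Prod>k\<le>ns ! j. inverse (x j k q)))"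
proof (induction m arbitrary: \<sigma>)
  case (Suc m)
  show ?case
    unfolding theta_product.simps Suc.IH sign_product.simps
    by (subst koszul_theta_scale) simp_all
qed simp

text \<open>With x = 1 the coboundary equals the Koszul differential, which is an empty sum at the
  full index set.\<close>

lemma koszul_theta_one_cocycle:
  assumes "set K \<subseteq> {..n}"
  shows "alt_sum (\<lambda>K. koszul_theta (\<lambda>_. 1 :: complex) K {..n}) K = 0"
  by (subst koszul_bd_koszul_theta[symmetric, where n = n and x = "\<lambda>_. 1"]) (use assms in \<open>auto simp: koszul_bd_def\<close>)

lemma sign_product_cocycle:
  assumes "\<And>j. j < length ns \<Longrightarrow> adapted V j (kk j)"
  shows "m \<le> length ns \<Longrightarrow> set \<sigma> \<subseteq> V \<Longrightarrow> length \<sigma> = Suc (Suc (dim_sum m)) \<Longrightarrow> alt_sum (sign_product kk m) \<sigma> = 0"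
proof (induction m arbitrary: \<sigma>)
  case 0
  then show ?case by (auto simp: dim_sum_def length_Suc_conv)
next
  case (Suc m)
  define g where "g \<rho> = koszul_theta (\<lambda>i. 1 :: complex) (map (kk m) \<rho>) {..ns ! m}" for \<rho>
  have "alt_sum (sign_product kk (Suc m)) \<sigma> = alt_sum (cup (Suc (dim_sum m)) (sign_product kk m) g) \<sigma>"
    by (rule alt_sum_cong) (simp add: cup_def g_def)
  also have "\<dots> = alt_sum (sign_product kk m) (take (Suc (Suc (dim_sum m))) \<sigma>) * g (drop (Suc (dim_sum m)) \<sigma>)
      + (-1) ^ dim_sum m * sign_product kk m (take (Suc (dim_sum m)) \<sigma>) * alt_sum g (drop (dim_sum m) \<sigma>)"
    by (rule alt_sum_cup) (use Suc.prems in \<open>simp add: dim_sum_Suc\<close>)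
  also have "alt_sum (sign_product kk m) (take (Suc (Suc (dim_sum m))) \<sigma>) = 0"
    by (rule Suc.IH) (use Suc.prems set_take_subset[of "Suc (Suc (dim_sum m))" \<sigma>] in \<open>auto simp: dim_sum_Suc\<close>)
  also have "alt_sum g (drop (dim_sum m) \<sigma>) = 0"
  proof -
    have "set (map (kk m) (drop (dim_sum m) \<sigma>)) \<subseteq> {..ns ! m}"
      using assms[of m] Suc.prems set_drop_subset[of "dim_sum m" \<sigma>] unfolding adapted_def by fastforce
    from koszul_theta_one_cocycle[OF this] show ?thesis by (simp add: alt_sum_map g_def[abs_def])
  qed
  finally show ?case by simp
qed

text \<open>In factor j the cocycle identity for the list with k prefixed says that the coboundary
  of the prefixed cochain is the original one; later factors follow by the Leibniz rule, since they
  are cocycles. Positive dimensions make the simplices long enough for that rule and keep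
  \<open>dim_sum m - 1\<close> from being truncated.\<close>

lemma alt_sum_sign_primitive:
  assumes V: "\<And>j. j < length ns \<Longrightarrow> adapted V j (kk j)" and k: "k \<le> ns ! j" and n: "\<And>j. j < length ns \<Longrightarrow> ns ! j \<ge> 1"
  shows "m \<le> length ns \<Longrightarrow> j < m \<Longrightarrow> set \<sigma> \<subseteq> V \<Longrightarrow> length \<sigma> = Suc (dim_sum m) \<Longrightarrow> alt_sum (sign_primitive kk j k m) \<sigma> = sign_product kk m \<sigma>"
proof (induction m arbitrary: \<sigma>)
  case (Suc m)
  have m: "m < length ns" using Suc.prems by simp
  have kkm: "set (map (kk m) \<rho>) \<subseteq> {..ns ! m}" if "set \<rho> \<subseteq> set \<sigma>" for \<rho>
    using V[of m] Suc.prems that unfolding adapted_def by fastforce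
  have tk: "set (take i \<sigma>) \<subseteq> set \<sigma>" "set (drop i \<sigma>) \<subseteq> set \<sigma>" for i
    by (rule set_take_subset, rule set_drop_subset)
  show ?case
  proof (cases "m = j")
    case True
    define g where "g \<rho> = koszul_theta (\<lambda>i. 1 :: complex) (k # map (kk m) \<rho>) {..ns ! m}" for \<rho>
    have "alt_sum (sign_primitive kk j k (Suc m)) \<sigma> = alt_sum (\<lambda>\<rho>. (-1) ^ dim_sum m * cup (Suc (dim_sum m)) (sign_product kk m) g \<rho>) \<sigma>"
      by (rule alt_sum_cong) (use True in \<open>simp add: cup_def g_def\<close>)
    also have "\<dots> = (-1) ^ dim_sum m * (alt_sum (sign_product kk m) (take (Suc (Suc (dim_sum m))) \<sigma>) * g (drop (Suc (dim_sum m)) \<sigma>)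
        + (-1) ^ dim_sum m * sign_product kk m (take (Suc (dim_sum m)) \<sigma>) * alt_sum g (drop (dim_sum m) \<sigma>))"
      unfolding alt_sum_cmult by (subst alt_sum_cup) (use Suc.prems n[OF m] in \<open>simp_all add: dim_sum_Suc\<close>)
    also have "alt_sum (sign_product kk m) (take (Suc (Suc (dim_sum m))) \<sigma>) = 0"
      by (rule sign_product_cocycle[OF V]) (use Suc.prems n[OF m] tk in \<open>auto simp: dim_sum_Suc\<close>)
    also have "alt_sum g (drop (dim_sum m) \<sigma>) = koszul_theta (\<lambda>i. 1) (map (kk m) (drop (dim_sum m) \<sigma>)) {..ns ! m}"
    proof -
      have "alt_sum (\<lambda>K. koszul_theta (\<lambda>_. 1 :: complex) K {..ns ! m}) (k # map (kk m) (drop (dim_sum m) \<sigma>)) = 0"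
        by (rule koszul_theta_one_cocycle) (use kkm[OF tk(2)] k True in auto)
      then show ?thesis unfolding alt_sum.simps alt_sum_map g_def[abs_def] by simp
    qed
    finally show ?thesis by simp
  next
    case False
    then have jm: "j < m" using Suc.prems by simp
    have "dim_sum m \<ge> ns ! j" unfolding dim_sum_def by (rule member_le_sum) (use jm in auto)
    then obtain l where l: "dim_sum m = Suc l" using n[of j] jm m by (cases "dim_sum m") auto
    define g where "g \<rho> = koszul_theta (\<lambda>i. 1 :: complex) (map (kk m) \<rho>) {..ns ! m}" for \<rho>
    have "alt_sum (sign_primitive kk j k (Suc m)) \<sigma> = alt_sum (cup (Suc l) (sign_primitive kk j k m) g) \<sigma>"
      by (rule alt_sum_cong) (use False jm l in \<open>simp add: cup_def g_def\<close>)
    also have "\<dots> = alt_sum (sign_primitive kk j k m) (take (Suc (Suc l)) \<sigma>) * g (drop (Suc l) \<sigma>)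
        + (-1) ^ l * sign_primitive kk j k m (take (Suc l) \<sigma>) * alt_sum g (drop l \<sigma>)"
      by (rule alt_sum_cup) (use Suc.prems n[OF m] l in \<open>simp_all add: dim_sum_Suc\<close>)
    also have "alt_sum (sign_primitive kk j k m) (take (Suc (Suc l)) \<sigma>) = sign_product kk m (take (Suc (Suc l)) \<sigma>)"
      by (rule Suc.IH) (use Suc.prems jm tk l in \<open>auto simp: dim_sum_Suc\<close>)
    also have "alt_sum g (drop l \<sigma>) = 0"
      using koszul_theta_one_cocycle[OF kkm[OF tk(2)], of l] by (simp add: alt_sum_map g_def[abs_def])
    finally show ?thesis using l by (simp add: g_def)
  qed
qed simp

lemma sign_product_support:
  "sign_product kk m \<sigma> \<noteq> 0 \<Longrightarrow> j < m \<Longrightarrow> k \<le> ns ! j \<Longrightarrow> \<exists>u\<in>set \<sigma>. kk j u = k"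
proof (induction m arbitrary: \<sigma>)
  case (Suc m)
  have tk: "set (take i \<sigma>) \<subseteq> set \<sigma>" "set (drop i \<sigma>) \<subseteq> set \<sigma>" for i
    by (rule set_take_subset, rule set_drop_subset)
  show ?case
  proof (cases "j = m")
    case True
    have "{..ns ! m} = set (map (kk m) (drop (dim_sum m) \<sigma>))"
      by (rule koszul_theta_support[of "\<lambda>_. 1 :: complex"]) (use Suc.prems in auto)
    then have "k \<in> set (map (kk m) (drop (dim_sum m) \<sigma>))" using Suc.prems True by auto
    then show ?thesis using tk(2) True by auto
  next
    case False
    then have "sign_product kk m (take (Suc (dim_sum m)) \<sigma>) \<noteq> 0" "j < m" using Suc.prems by auto
    then show ?thesis using Suc.IH[of "take (Suc (dim_sum m)) \<sigma>"] Suc.prems(3) tk(1) by fastforce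
  qed
qed simp

text \<open>The reason why a summand \<open>e j k\<close> only has to be regular on
  \<open>Uexc j k\<close>: on a simplex in the support every coordinate other than (j, k) is
  invertible on some vertex.\<close>

lemma sign_primitive_support:
  "sign_primitive kk j k m \<sigma> \<noteq> 0 \<Longrightarrow> j' < m \<Longrightarrow> k' \<le> ns ! j' \<Longrightarrow> (j', k') \<noteq> (j, k) \<Longrightarrow> \<exists>u\<in>set \<sigma>. kk j' u = k'"
proof (induction m arbitrary: \<sigma>)
  case (Suc m)
  have tk: "set (take i \<sigma>) \<subseteq> set \<sigma>" "set (drop i \<sigma>) \<subseteq> set \<sigma>" for i
    by (rule set_take_subset, rule set_drop_subset)
  consider "m = j" | "j < m" using Suc.prems(1) by (cases "m = j"; cases "j < m") auto
  then show ?case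
  proof cases
    case 1
    then have nz: "sign_product kk m (take (Suc (dim_sum m)) \<sigma>) \<noteq> 0" "koszul_theta (\<lambda>i. 1 :: complex) (k # map (kk m) (drop (dim_sum m) \<sigma>)) {..ns ! m} \<noteq> 0"
      using Suc.prems(1) by (auto simp del: koszul_theta.simps)
    show ?thesis
    proof (cases "j' = m")
      case True
      have "{..ns ! m} = set (k # map (kk m) (drop (dim_sum m) \<sigma>))" by (rule koszul_theta_support[OF nz(2)])
      moreover have "k' \<in> {..ns ! m}" "k' \<noteq> k" using Suc.prems True 1 by auto
      ultimately have "k' \<in> set (map (kk m) (drop (dim_sum m) \<sigma>))" by auto
      then show ?thesis using tk(2) True by auto
    next
      case False
      then show ?thesis using sign_product_support[OF nz(1), of j' k'] Suc.prems tk(1) by fastforce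
    qed
  next
    case 2
    then have nz: "sign_primitive kk j k m (take (dim_sum m) \<sigma>) \<noteq> 0" "koszul_theta (\<lambda>i. 1 :: complex) (map (kk m) (drop (dim_sum m - 1) \<sigma>)) {..ns ! m} \<noteq> 0"
      using Suc.prems(1) by auto
    show ?thesis
    proof (cases "j' = m")
      case True
      have "{..ns ! m} = set (map (kk m) (drop (dim_sum m - 1) \<sigma>))" by (rule koszul_theta_support[OF nz(2)])
      then have "k' \<in> set (map (kk m) (drop (dim_sum m - 1) \<sigma>))" using Suc.prems True by auto
      then show ?thesis using tk(2) True by auto
    next
      case False
      then show ?thesis using Suc.IH[OF nz(1)] Suc.prems tk(1) by fastforce
    qed
  qed
qed simp

definition Uall :: "'p set" where
  "Uall = {P \<in> X. \<forall>j<length ns. \<forall>k\<le>ns ! j. P \<in> D j k}"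

definition Uexc :: "nat \<Rightarrow> nat \<Rightarrow> 'p set" where
  "Uexc j k = {P \<in> X. \<forall>j'<length ns. \<forall>k'\<le>ns ! j'. (j', k') \<noteq> (j, k) \<longrightarrow> P \<in> D j' k'}"

lemma cover_adapted_all:
  assumes "m \<le> length ns"
  shows "\<exists>V kk. cover V \<and> (\<forall>j<m. adapted V j (kk j))"
  using assms
proof (induction m)
  case 0
  have "cover {X}" using opn_X by (simp add: cover_def)
  then have "cover {X} \<and> (\<forall>j<0. adapted {X} j ((\<lambda>_ _. 0) j))" by simp
  then show ?case by (intro exI)
next
  case (Suc m)
  then obtain V kk where V: "cover V" "\<forall>j<m. adapted V j (kk j)" by (metis Suc_leD)
  have "m < length ns" using Suc.prems by simp
  from cover_adapted[OF V(1) this]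
  obtain W \<tau> k where W: "cover W" "refines W V \<tau>" "adapted W m k" by (elim exE conjE)
  define kk' where "kk' j = (if j = m then k else (\<lambda>u. kk j (\<tau> u)))" for j
  have "\<forall>j<Suc m. adapted W j (kk' j)"
  proof (intro allI impI)
    fix j assume j: "j < Suc m"
    show "adapted W j (kk' j)"
    proof (cases "j = m")
      case False
      then have "adapted V j (kk j)" using V(2) j by simp
      from adapted_refine[OF W(2) this] show ?thesis using False by (simp add: kk'_def)
    qed (use W(3) in \<open>simp add: kk'_def\<close>)
  qed
  with W(1) show ?case by (intro exI conjI)
qed

text \<open>Weighting the summands \<open>e j k\<close> with the constant cochains
  \<open>sign_primitive\<close> gives a cochain that is regular on all simplices, because its
  support avoids the poles. Its coboundary is \<open>theta_product\<close>, so the product class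
  vanishes and the descent forces the section to vanish.\<close>

theorem section_zero:
  assumes H: "\<And>t l. (\<forall>j<length ns. - int (ns ! j) \<le> t j \<and> t j \<le> 0) \<Longrightarrow> (\<forall>j\<ge>length ns. t j = 0) \<Longrightarrow>
      (\<Sum>j<length ns. t j) = - int l \<Longrightarrow> l \<ge> 1 \<Longrightarrow> van t l"
    and n: "\<And>j. j < length ns \<Longrightarrow> ns ! j \<ge> 1"
    and s: "s \<in> sec (\<lambda>_. 0) X" and q0: "q0 \<in> pl X"
    and e: "\<And>j k. j < length ns \<Longrightarrow> k \<le> ns ! j \<Longrightarrow> e j k \<in> sec (canon_deg (length ns)) (Uexc j k)"
    and eq: "\<And>q. q \<in> pl Uall \<Longrightarrow> s q * (\<Prod>j<length ns. \<Prod>k\<le>ns ! j. inverse (x j k q)) = (\<Sum>j<length ns. \<Sum>k\<le>ns ! j. e j k q)"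
  shows "s q0 = 0"
proof -
  let ?r = "length ns"
  from cover_adapted_all[OF order_refl]
  obtain V kk where V0: "cover V" "\<forall>j<?r. adapted V j (kk j)" by (elim exE conjE)
  have V: "cover V" "\<And>j. j < ?r \<Longrightarrow> adapted V j (kk j)" using V0 by simp_all
  define b where "b \<sigma> q = (\<Sum>j<?r. \<Sum>k\<le>ns ! j. sign_primitive kk j k ?r \<sigma> * e j k q)" for \<sigma> q
  have b: "b \<in> cochains V (dim_sum ?r) (canon_deg ?r)"
  proof (rule cochI)
    fix \<sigma> assume s: "\<sigma> \<in> simplices V (dim_sum ?r)"
    show "if \<sigma> = [] then \<forall>q. b \<sigma> q = 0 else b \<sigma> \<in> sec (canon_deg ?r) (\<Inter>(set \<sigma>))"
    proof (cases "\<sigma> = []")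
      case True
      \<comment> \<open>Total dimension 0 with all dimensions positive leaves no factor at all, so
        the sum that defines \<open>b\<close> is empty.\<close>
      then have "dim_sum ?r = 0" using s by (simp add: simplices_def)
      have "length ns = 0"
      proof (rule ccontr)
        assume "length ns \<noteq> 0"
        then have "ns ! 0 \<le> dim_sum ?r" unfolding dim_sum_def by (intro member_le_sum) auto
        then show False using n[of 0] \<open>dim_sum ?r = 0\<close> \<open>length ns \<noteq> 0\<close> by simp
      qed
      then show ?thesis using True by (simp add: b_def)
    next
      case False
      have "(\<lambda>q. sign_primitive kk j k ?r \<sigma> * e j k q) \<in> sec (canon_deg ?r) (\<Inter>(set \<sigma>))" if jk: "j < ?r" "k \<le> ns ! j" for j k
      proof (cases "sign_primitive kk j k ?r \<sigma> = 0")
        case True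
        then show ?thesis using sec_zero by simp
      next
        case nz: False
        have "P \<in> Uexc j k" if P: "P \<in> \<Inter>(set \<sigma>)" for P
        proof -
          have "P \<in> X" using P False s V(1) unfolding simplices_def cover_def by (cases \<sigma>) auto
          moreover have "P \<in> D j' k'" if jk': "j' < ?r" "k' \<le> ns ! j'" "(j', k') \<noteq> (j, k)" for j' k'
          proof -
            obtain u where "u \<in> set \<sigma>" "kk j' u = k'" using sign_primitive_support[OF nz jk'] by blast
            then show ?thesis using V(2)[OF jk'(1)] s P unfolding adapted_def simplices_def by blast
          qed
          ultimately show ?thesis unfolding Uexc_def by blast
        qed
        then show ?thesis by (intro sec_cmult sec_mono[OF _ e[OF jk]]) blast
      qed
      then have "b \<sigma> \<in> sec (canon_deg ?r) (\<Inter>(set \<sigma>))" unfolding b_def by (intro sec_sum) auto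
      then show ?thesis using False by simp
    qed
  qed
  moreover have "bounds V (Suc (dim_sum ?r)) b (theta_product s kk ?r)"
    unfolding bounds_def
  proof (intro ballI)
    fix \<sigma> q assume s: "\<sigma> \<in> simplices V (Suc (dim_sum ?r))" and q: "q \<in> pl (\<Inter>(set \<sigma>))"
    have "alt_sum (\<lambda>\<rho>. b \<rho> q) \<sigma> = (\<Sum>j<?r. \<Sum>k\<le>ns ! j. e j k q * alt_sum (sign_primitive kk j k ?r) \<sigma>)"
      unfolding b_def alt_sum_sum by (simp add: mult.commute[of "sign_primitive _ _ _ _ _"] alt_sum_cmult)
    also have "\<dots> = (\<Sum>j<?r. \<Sum>k\<le>ns ! j. e j k q * sign_product kk ?r \<sigma>)"
      by (intro sum.cong refl arg_cong[of _ _ "\<lambda>z. _ * z"] alt_sum_sign_primitive[OF V(2) _ n]) (use s in \<open>auto simp: simplices_def\<close>)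
    also have "\<dots> = sign_product kk ?r \<sigma> * (\<Sum>j<?r. \<Sum>k\<le>ns ! j. e j k q)"
      by (simp add: sum_distrib_left mult.commute)
    also have "\<dots> = theta_product s kk ?r \<sigma> q"
    proof (cases "sign_product kk ?r \<sigma> = 0")
      case False
      have "P \<in> Uall" if P: "P \<in> \<Inter>(set \<sigma>)" for P
      proof -
        have "P \<in> X" using P s V(1) unfolding simplices_def cover_def by (cases \<sigma>) auto
        moreover have "P \<in> D j' k'" if jk': "j' < ?r" "k' \<le> ns ! j'" for j' k'
        proof -
          obtain u where "u \<in> set \<sigma>" "kk j' u = k'" using sign_product_support[OF False jk'] by blast
          then show ?thesis using V(2)[OF jk'(1)] s P unfolding adapted_def simplices_def by blast
        qed
        ultimately show ?thesis unfolding Uall_def by blast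
      qed
      then have "q \<in> pl Uall" using q pl_mono by blast
      then show ?thesis using eq by (simp add: theta_product_sign_product)
    qed (simp add: theta_product_sign_product)
    finally show "theta_product s kk ?r \<sigma> q = alt_sum (\<lambda>\<rho>. b \<rho> q) \<sigma>" by simp
  qed
  ultimately show ?thesis
    by (intro theta_product_descent[OF H s q0 order_refl V])
qed

end

section \<open>The Nullstellensatz\<close>

lemma poly_mapping_sum_single:
  fixes p :: "'a \<Rightarrow>\<^sub>0 'b::comm_monoid_add"
  shows "p = (\<Sum>k\<in>Poly_Mapping.keys p. Poly_Mapping.single k (Poly_Mapping.lookup p k))"
proof (rule poly_mapping_eqI)
  fix k
  have "(\<Sum>i\<in>Poly_Mapping.keys p. Poly_Mapping.lookup (Poly_Mapping.single i (Poly_Mapping.lookup p i)) k)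
      = (\<Sum>i\<in>Poly_Mapping.keys p. if i = k then Poly_Mapping.lookup p k else 0)"
    by (rule sum.cong) (auto simp: lookup_single when_def)
  then show "Poly_Mapping.lookup p k =
      Poly_Mapping.lookup (\<Sum>k\<in>Poly_Mapping.keys p. Poly_Mapping.single k (Poly_Mapping.lookup p k)) k"
    by (simp add: lookup_sum in_keys_iff)
qed

section \<open>Evaluation of polynomials\<close>

definition mono_eval :: "((nat \<times> nat) \<Rightarrow>\<^sub>0 nat) \<Rightarrow> coords \<Rightarrow> complex" where
  "mono_eval m v = (\<Prod>i\<in>Poly_Mapping.keys m. v i ^ Poly_Mapping.lookup m i)"

lemma mono_eval_superset:
  assumes "finite S" "Poly_Mapping.keys m \<subseteq> S"
  shows "mono_eval m v = (\<Prod>i\<in>S. v i ^ Poly_Mapping.lookup m i)"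
  unfolding mono_eval_def by (rule prod.mono_neutral_left) (use assms in \<open>auto simp: in_keys_iff\<close>)

lemma mono_eval_add: "mono_eval (m + n) v = mono_eval m v * mono_eval n v"
proof -
  let ?S = "Poly_Mapping.keys m \<union> Poly_Mapping.keys n"
  have S: "finite ?S" by simp
  show ?thesis
    using mono_eval_superset[OF S keys_add[of m n], of v] mono_eval_superset[OF S, of m v] mono_eval_superset[OF S, of n v]
    by (simp add: lookup_add power_add prod.distrib)
qed

lemma mono_eval_0 [simp]: "mono_eval 0 v = 1" by (simp add: mono_eval_def)

lemma mpoly_eval_alt: "mpoly_eval f v = (\<Sum>m\<in>Poly_Mapping.keys f. Poly_Mapping.lookup f m * mono_eval m v)"
  by (simp add: mpoly_eval_def mono_eval_def)

lemma mpoly_eval_superset: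
  assumes "finite S" "Poly_Mapping.keys f \<subseteq> S"
  shows "mpoly_eval f v = (\<Sum>m\<in>S. Poly_Mapping.lookup f m * mono_eval m v)"
  unfolding mpoly_eval_alt by (rule sum.mono_neutral_left) (use assms in \<open>auto simp: in_keys_iff\<close>)

lemma mpoly_eval_add: "mpoly_eval (f + g) v = mpoly_eval f v + mpoly_eval g v"
proof -
  let ?S = "Poly_Mapping.keys f \<union> Poly_Mapping.keys g"
  have S: "finite ?S" by simp
  show ?thesis
    using mpoly_eval_superset[OF S keys_add[of f g], of v] mpoly_eval_superset[OF S, of f v] mpoly_eval_superset[OF S, of g v]
    by (simp add: lookup_add sum.distrib distrib_right)
qed

lemma mpoly_eval_0 [simp]: "mpoly_eval 0 v = 0" by (simp add: mpoly_eval_def)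

lemma mpoly_eval_single [simp]: "mpoly_eval (Poly_Mapping.single m c) v = c * mono_eval m v"
  by (simp add: mpoly_eval_alt)

lemma mpoly_eval_sum: "mpoly_eval (\<Sum>i\<in>I. f i) v = (\<Sum>i\<in>I. mpoly_eval (f i) v)"
  by (induction I rule: infinite_finite_induct) (auto simp: mpoly_eval_add)

lemma mpoly_eval_mult: "mpoly_eval (f * g) v = mpoly_eval f v * mpoly_eval g v"
proof -
  have "f * g = (\<Sum>m\<in>Poly_Mapping.keys f. \<Sum>n\<in>Poly_Mapping.keys g.
      Poly_Mapping.single (m + n) (Poly_Mapping.lookup f m * Poly_Mapping.lookup g n))"
    by (subst poly_mapping_sum_single[of f], subst poly_mapping_sum_single[of g])
       (simp add: sum_product mult_single)
  then show ?thesis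
    by (simp add: mpoly_eval_sum mono_eval_add mpoly_eval_alt[of f] mpoly_eval_alt[of g] sum_product mult_ac)
qed

lemma mpoly_eval_1 [simp]: "mpoly_eval 1 v = 1"
  using mpoly_eval_single[of 0 1 v] by (simp del: mpoly_eval_single)

lemma mpoly_eval_power: "mpoly_eval (f ^ n) v = mpoly_eval f v ^ n"
  by (induction n) (auto simp: mpoly_eval_mult)

definition mconst :: "complex \<Rightarrow> mpoly" where "mconst c = Poly_Mapping.single 0 c"

definition mvar :: "nat \<times> nat \<Rightarrow> mpoly" where "mvar i = Poly_Mapping.single (Poly_Mapping.single i 1) 1"

lemma mpoly_eval_mconst [simp]: "mpoly_eval (mconst c) v = c" by (simp add: mconst_def)

lemma mpoly_eval_mvar [simp]: "mpoly_eval (mvar i) v = v i"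
  by (simp add: mvar_def mono_eval_def)

lemma mconst_simps: "mconst 0 = 0" "mconst 1 = 1" "mconst (a + b) = mconst a + mconst b" "mconst (a * b) = mconst a * mconst b" "mconst (- a) = - mconst a"
  by (simp_all add: mconst_def single_add mult_single single_uminus)

lemma mvar_power: "mvar i ^ n = Poly_Mapping.single (Poly_Mapping.single i n) 1"
  by (induction n) (simp_all add: mvar_def mult_single flip: single_add)

lemma single_sum_prod: "(\<Prod>i\<in>I. Poly_Mapping.single (f i) (1::complex)) = Poly_Mapping.single (\<Sum>i\<in>I. f i) 1"
  for f :: "'a \<Rightarrow> (nat \<times> nat) \<Rightarrow>\<^sub>0 nat"
  by (induction I rule: infinite_finite_induct) (simp_all add: mult_single)

lemma mpoly_induct:
  assumes "\<And>c. P (mconst c)" "\<And>i. P (mvar i)" "\<And>f g. P f \<Longrightarrow> P g \<Longrightarrow> P (f + g)" "\<And>f g. P f \<Longrightarrow> P g \<Longrightarrow> P (f * g)"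
  shows "P f"
proof -
  have P0: "P 0" "P 1" using assms(1)[of 0] assms(1)[of 1] by (simp_all add: mconst_simps)
  have Psum: "P (\<Sum>i\<in>I. h i)" if "\<And>i. i \<in> I \<Longrightarrow> P (h i)" for I :: "((nat \<times> nat) \<Rightarrow>\<^sub>0 nat) set" and h
    using that by (induction I rule: infinite_finite_induct) (auto simp: P0 assms(3))
  have Ppow: "P (mvar i ^ n)" for i n by (induction n) (auto simp: P0 assms)
  have Pprod: "P (\<Prod>i\<in>I. h i)" if "\<And>i. i \<in> I \<Longrightarrow> P (h i)" for I :: "(nat \<times> nat) set" and h
    using that by (induction I rule: infinite_finite_induct) (auto simp: P0 assms(4))
  have "P (Poly_Mapping.single m c)" for m c
  proof -
    have "Poly_Mapping.single m c = mconst c * (\<Prod>i\<in>Poly_Mapping.keys m. mvar i ^ Poly_Mapping.lookup m i)"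
      using poly_mapping_sum_single[of m] by (simp add: mvar_power single_sum_prod mconst_def mult_single)
    then show ?thesis using assms(1,4) Pprod Ppow by simp
  qed
  then show ?thesis by (subst poly_mapping_sum_single[of f]) (rule Psum)
qed

definition mideal :: "mpoly set \<Rightarrow> bool" where
  "mideal I \<longleftrightarrow> 0 \<in> I \<and> (\<forall>a\<in>I. \<forall>b\<in>I. a + b \<in> I) \<and> (\<forall>r. \<forall>a\<in>I. r * a \<in> I)"

lemma midealD:
  assumes "mideal I"
  shows "0 \<in> I" "a \<in> I \<Longrightarrow> b \<in> I \<Longrightarrow> a + b \<in> I" "a \<in> I \<Longrightarrow> r * a \<in> I" "a \<in> I \<Longrightarrow> a * r \<in> I"
    "a \<in> I \<Longrightarrow> - a \<in> I" "a \<in> I \<Longrightarrow> b \<in> I \<Longrightarrow> a - b \<in> I" "(\<And>i. i \<in> S \<Longrightarrow> f i \<in> I) \<Longrightarrow> (\<Sum>i\<in>S. f i) \<in> I"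
proof -
  show 0: "0 \<in> I" and add: "\<And>a b. a \<in> I \<Longrightarrow> b \<in> I \<Longrightarrow> a + b \<in> I" and mul: "\<And>r a. a \<in> I \<Longrightarrow> r * a \<in> I"
    using assms by (auto simp: mideal_def)
  show mul': "\<And>r a. a \<in> I \<Longrightarrow> a * r \<in> I" by (subst mult.commute) (rule mul)
  show neg: "\<And>a. a \<in> I \<Longrightarrow> - a \<in> I" using mul[of _ "-1"] by simp
  show "\<And>a b. a \<in> I \<Longrightarrow> b \<in> I \<Longrightarrow> a - b \<in> I" using add[of _ "- _"] neg by fastforce
  show "(\<And>i. i \<in> S \<Longrightarrow> f i \<in> I) \<Longrightarrow> (\<Sum>i\<in>S. f i) \<in> I"
    by (induction S rule: infinite_finite_induct) (auto simp: 0 add)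
qed

text \<open>More vectors than coordinates: a pivot vector \<open>b\<close> eliminates the coordinate
  k from all others, and its own coefficient is solved for at the end.\<close>

lemma linear_dependence:
  fixes u :: "'a \<Rightarrow> 'b \<Rightarrow> 'c::field"
  assumes "finite K" "finite F" "card F > card K"
  shows "\<exists>c. (\<exists>a\<in>F. c a \<noteq> 0) \<and> (\<forall>k\<in>K. (\<Sum>a\<in>F. c a * u a k) = 0)"
  using assms
proof (induction K arbitrary: F u rule: finite_induct)
  case empty
  then have "F \<noteq> {}" by auto
  then show ?case by (intro exI[of _ "\<lambda>_. 1"]) auto
next
  case (insert k K)
  show ?case
  proof (cases "\<forall>a\<in>F. u a k = 0")
    case True
    then show ?thesis using insert.IH[of F u] insert by (auto intro!: exI)
  next
    case False
    then obtain b where b: "b \<in> F" "u b k \<noteq> 0" by auto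
    define w where "w a l = u a l - u a k / u b k * u b l" for a l
    have "card K < card (F - {b})" using insert b by simp
    then obtain c where c: "\<exists>a\<in>F-{b}. c a \<noteq> 0" "\<forall>l\<in>K. (\<Sum>a\<in>F-{b}. c a * w a l) = 0"
      using insert.IH[of "F - {b}" w] insert.prems by auto
    define s where "s = (\<Sum>a\<in>F-{b}. c a * (u a k / u b k))"
    define c' where "c' = c(b := - s)"
    have sum: "(\<Sum>a\<in>F. c' a * u a l) = (\<Sum>a\<in>F-{b}. c a * w a l)" for l
    proof -
      have "(\<Sum>a\<in>F. c' a * u a l) = c' b * u b l + (\<Sum>a\<in>F-{b}. c' a * u a l)"
        by (rule sum.remove) (use b insert.prems in auto)
      also have "(\<Sum>a\<in>F-{b}. c' a * u a l) = (\<Sum>a\<in>F-{b}. c a * u a l)"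
        by (rule sum.cong) (auto simp: c'_def)
      finally show ?thesis
        by (simp add: c'_def s_def w_def sum_distrib_right sum_subtractf right_diff_distrib mult.assoc)
    qed
    have "(\<Sum>a\<in>F. c' a * u a l) = 0" if "l \<in> insert k K" for l
      using that c(2) b(2) unfolding sum by (auto simp: w_def)
    moreover have "\<exists>a\<in>F. c' a \<noteq> 0" using c(1) by (auto simp: c'_def)
    ultimately show ?thesis by blast
  qed
qed

text \<open>Substituting a variable into a univariate polynomial carries factorizations over the
  complex numbers into the multivariate ring.\<close>

definition subst_var :: "nat \<times> nat \<Rightarrow> complex poly \<Rightarrow> mpoly" where
  "subst_var i p = poly (map_poly mconst p) (mvar i)"

lemma subst_var_pCons: "subst_var i (pCons c p) = mconst c + mvar i * subst_var i p"
  by (simp add: subst_var_def map_poly_pCons mconst_simps)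

lemma subst_var_0 [simp]: "subst_var i 0 = 0" by (simp add: subst_var_def)

lemma subst_var_add: "subst_var i (p + q) = subst_var i p + subst_var i q"
  by (induction p q rule: poly_induct2) (simp_all add: subst_var_pCons mconst_simps algebra_simps)

lemma subst_var_smult: "subst_var i (Polynomial.smult c p) = mconst c * subst_var i p"
  by (induction p) (simp_all add: subst_var_pCons mconst_simps algebra_simps)

lemma subst_var_mult: "subst_var i (p * q) = subst_var i p * subst_var i q"
  by (induction p) (simp_all add: subst_var_pCons mconst_simps subst_var_add subst_var_smult algebra_simps)

lemma subst_var_sum: "subst_var i (\<Sum>a\<in>I. f a) = (\<Sum>a\<in>I. subst_var i (f a))"
  by (induction I rule: infinite_finite_induct) (simp_all add: subst_var_add)

lemma subst_var_1 [simp]: "subst_var i 1 = 1"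
  by (simp add: subst_var_pCons one_pCons mconst_simps)

lemma subst_var_prod: "subst_var i (\<Prod>a\<in>I. f a) = (\<Prod>a\<in>I. subst_var i (f a))"
  by (induction I rule: infinite_finite_induct) (simp_all add: subst_var_mult)

lemma countable_monomials: "countable (UNIV :: ((nat \<times> nat) \<Rightarrow>\<^sub>0 nat) set)"
proof -
  let ?g = "\<lambda>m :: (nat \<times> nat) \<Rightarrow>\<^sub>0 nat. (\<lambda>i. (i, Poly_Mapping.lookup m i)) ` Poly_Mapping.keys m"
  have "inj ?g"
  proof (rule injI)
    fix m n assume eq: "?g m = ?g n"
    show "m = n"
    proof (rule poly_mapping_eqI)
      fix i
      have mem: "(i, Poly_Mapping.lookup p i) \<in> ?g p \<longleftrightarrow> Poly_Mapping.lookup p i \<noteq> 0" for p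
        by (auto simp: in_keys_iff)
      have mem2: "(i, l) \<in> ?g p \<Longrightarrow> l = Poly_Mapping.lookup p i" for p l by auto
      show "Poly_Mapping.lookup m i = Poly_Mapping.lookup n i"
        using mem[of m] mem[of n] mem2[of _ n] mem2[of _ m] eq by metis
    qed
  qed
  moreover have "countable (range ?g)"
    by (rule countable_subset[OF _ countable_Collect_finite]) auto
  ultimately show ?thesis by (rule countable_image_inj_on[rotated])
qed

text \<open>There are uncountably many complex numbers but only countably many pairs of an exponent
  and a finite set of monomials. This counting replaces the usual normalization arguments for the
  Nullstellensatz.\<close>

lemma infinite_fibre:
  fixes f :: "complex \<Rightarrow> nat \<times> ((nat \<times> nat) \<Rightarrow>\<^sub>0 nat) set"
  assumes "\<And>a. finite (snd (f a))"
  shows "\<exists>y. infinite (f -` {y})"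
proof (rule ccontr)
  assume "\<not> ?thesis"
  then have fin: "finite (f -` {y})" for y by blast
  have "countable {A :: ((nat \<times> nat) \<Rightarrow>\<^sub>0 nat) set. finite A}"
    using countable_Collect_finite_subset[OF countable_monomials] by simp
  then have "countable (UNIV \<times> {A :: ((nat \<times> nat) \<Rightarrow>\<^sub>0 nat) set. finite A} :: (nat \<times> _) set)"
    by (intro countable_SIGMA) auto
  then have r: "countable (range f)"
  proof (rule countable_subset[rotated], intro subsetI)
    fix y assume "y \<in> range f"
    then show "y \<in> UNIV \<times> {A. finite A}" using assms by (auto simp: mem_Times_iff)
  qed
  have "(UNIV :: complex set) = (\<Union>y\<in>range f. f -` {y})" by auto
  then have "countable (UNIV :: complex set)"
    using countable_UN[OF r, of "\<lambda>y. f -` {y}"] fin countable_finite by metis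
  then have "countable (range complex_of_real)" by (rule countable_subset[rotated]) auto
  then have "countable (UNIV :: real set)" by (rule countable_image_inj_on) (simp add: inj_of_real)
  then show False using uncountable_UNIV_real by simp
qed

text \<open>An ideal M that is maximal among those containing H but no power of g is prime.
  Uncountability of the field shows that each variable is constant modulo M, so reduction modulo M
  is evaluation at a point where H vanishes. Then g vanishes there as well and would lie in M. The
  form with an arbitrary set H fits the applications, where H consists of all local
  denominators.\<close>

theorem nullstellensatz:
  assumes van: "\<And>v. (\<And>h. h \<in> H \<Longrightarrow> mpoly_eval h v = 0) \<Longrightarrow> mpoly_eval g v = 0"
  shows "\<exists>n F d. finite F \<and> F \<subseteq> H \<and> g ^ n = (\<Sum>h\<in>F. d h * h)"
proof (rule ccontr)
  assume no: "\<not> ?thesis"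
  define I where "I = {(\<Sum>h\<in>F. d h * h) | F d. finite F \<and> F \<subseteq> H}"
  have I: "mideal I"
    unfolding mideal_def
  proof (intro conjI ballI allI)
    show "0 \<in> I" unfolding I_def by (auto intro!: exI[of _ "{}"])
  next
    fix a b assume "a \<in> I" "b \<in> I"
    then obtain F d F' d' where F: "finite F" "F \<subseteq> H" "a = (\<Sum>h\<in>F. d h * h)" "finite F'" "F' \<subseteq> H" "b = (\<Sum>h\<in>F'. d' h * h)"
      unfolding I_def by auto
    have ext: "(\<Sum>h\<in>A. e h * h) = (\<Sum>h\<in>F \<union> F'. (if h \<in> A then e h else 0) * h)" if "A \<subseteq> F \<union> F'" for A and e :: "mpoly \<Rightarrow> mpoly"
      by (rule sum.mono_neutral_cong_left) (use that F in auto)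
    have "a + b = (\<Sum>h\<in>F \<union> F'. ((if h \<in> F then d h else 0) + (if h \<in> F' then d' h else 0)) * h)"
      unfolding F(3,6) ext[of F d, simplified] ext[of F' d', simplified] by (simp add: sum.distrib distrib_right)
    then show "a + b \<in> I" unfolding I_def using F by (auto intro!: exI[of _ "F \<union> F'"])
  next
    fix r a assume "a \<in> I"
    then obtain F d where "finite F" "F \<subseteq> H" "a = (\<Sum>h\<in>F. d h * h)" unfolding I_def by auto
    then show "r * a \<in> I"
      unfolding I_def by (auto simp: sum_distrib_left mult.assoc[symmetric] intro!: exI[of _ F])
  qed
  have HI: "H \<subseteq> I"
  proof
    fix h assume "h \<in> H"
    then show "h \<in> I" unfolding I_def by (auto intro!: exI[of _ "{h}"] exI[of _ "\<lambda>_. 1"])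
  qed
  have gI: "g ^ n \<notin> I" for n using no unfolding I_def by blast
  define \<A> where "\<A> = {J. mideal J \<and> I \<subseteq> J \<and> (\<forall>n. g ^ n \<notin> J)}"
  have "\<exists>M\<in>\<A>. \<forall>J\<in>\<A>. M \<subseteq> J \<longrightarrow> J = M"
  proof (rule subset_Zorn_nonempty)
    show "\<A> \<noteq> {}" using I gI unfolding \<A>_def by auto
    fix C assume C: "C \<noteq> {}" "subset.chain \<A> C"
    then have CA: "\<And>J. J \<in> C \<Longrightarrow> J \<in> \<A>" and tot: "\<And>J K. J \<in> C \<Longrightarrow> K \<in> C \<Longrightarrow> J \<subseteq> K \<or> K \<subseteq> J"
      unfolding subset_chain_def by blast+
    have "mideal (\<Union>C)"
      unfolding mideal_def
    proof (intro conjI ballI allI)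
      show "0 \<in> \<Union>C" using C(1) CA midealD(1) unfolding \<A>_def by blast
    next
      fix a b assume "a \<in> \<Union>C" "b \<in> \<Union>C"
      then obtain J K where JK: "J \<in> C" "a \<in> J" "K \<in> C" "b \<in> K" by blast
      then obtain L where "L \<in> C" "a \<in> L" "b \<in> L" using tot[OF JK(1,3)] by blast
      then show "a + b \<in> \<Union>C" using CA[of L] midealD(2)[of L a b] unfolding \<A>_def by blast
    next
      fix r a assume "a \<in> \<Union>C"
      then show "r * a \<in> \<Union>C" using CA midealD(3) unfolding \<A>_def by blast
    qed
    then show "\<Union>C \<in> \<A>" using C(1) CA unfolding \<A>_def by blast
  qed
  then obtain M where M: "mideal M" "I \<subseteq> M" "\<And>n. g ^ n \<notin> M" and max: "\<And>J. J \<in> \<A> \<Longrightarrow> M \<subseteq> J \<Longrightarrow> J = M"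
  proof -
    from \<open>\<exists>M\<in>\<A>. _\<close> obtain M where "M \<in> \<A>" "\<forall>J\<in>\<A>. M \<subseteq> J \<longrightarrow> J = M" by (elim bexE)
    then show ?thesis by (intro that[of M]) (simp_all add: \<A>_def)
  qed
  note ID = midealD[OF M(1)]
  \<comment> \<open>Maximality: the ideal generated by M and a is strictly larger and therefore
    contains a power of g.\<close>
  have power_in: "\<exists>n r. g ^ n - r * a \<in> M" if "a \<notin> M" for a
  proof (rule ccontr)
    assume no: "\<not> ?thesis"
    define J where "J = {m + r * a | m r. m \<in> M}"
    have "mideal J"
      unfolding mideal_def
    proof (intro conjI ballI allI)
      have "0 = 0 + 0 * a" by simp
      then show "0 \<in> J" unfolding J_def using ID(1) by blast
    next
      fix x y assume "x \<in> J" "y \<in> J"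
      then obtain m r m' r' where "m \<in> M" "m' \<in> M" "x = m + r * a" "y = m' + r' * a" unfolding J_def by blast
      then have "x + y = (m + m') + (r + r') * a" "m + m' \<in> M" using ID(2) by (simp_all add: algebra_simps)
      then show "x + y \<in> J" unfolding J_def by blast
    next
      fix s x assume "x \<in> J"
      then obtain m r where "m \<in> M" "x = m + r * a" unfolding J_def by blast
      then have "s * x = s * m + (s * r) * a" "s * m \<in> M" using ID(3) by (simp_all add: algebra_simps)
      then show "s * x \<in> J" unfolding J_def by blast
    qed
    moreover have MJ: "M \<subseteq> J"
    proof
      fix m assume "m \<in> M"
      moreover have "m = m + 0 * a" by simp
      ultimately show "m \<in> J" unfolding J_def by blast
    qed
    moreover have "g ^ n \<notin> J" for n
    proof
      assume "g ^ n \<in> J"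
      then obtain m r where "m \<in> M" "g ^ n = m + r * a" unfolding J_def by blast
      then have "g ^ n - r * a \<in> M" by simp
      then show False using no by blast
    qed
    ultimately have "J = M" using max[of J] M(2) unfolding \<A>_def by auto
    moreover have "a = 0 + 1 * a" by simp
    then have "a \<in> J" unfolding J_def using ID(1) by blast
    ultimately show False using that by simp
  qed
  have prime: "a * b \<notin> M" if ab: "a \<notin> M" "b \<notin> M" for a b
  proof
    assume "a * b \<in> M"
    obtain n r n' r' where n: "g ^ n - r * a \<in> M" "g ^ n' - r' * b \<in> M" using power_in ab by blast
    have "g ^ (n + n') = (g ^ n - r * a) * g ^ n' + r * a * (g ^ n' - r' * b) + r * r' * (a * b)"
      by (simp add: power_add algebra_simps)
    also have "\<dots> \<in> M" by (intro ID(2) ID(4)[OF n(1)] ID(3)[OF n(2)] ID(3)[OF \<open>a * b \<in> M\<close>])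
    finally show False using M(3) by blast
  qed
  have one: "1 \<notin> M" using M(3)[of 0] by simp
  have const: "mconst c \<notin> M" if "c \<noteq> 0" for c
  proof
    assume "mconst c \<in> M"
    then have "mconst (inverse c) * mconst c \<in> M" by (rule ID(3))
    then show False using one that by (simp flip: mconst_simps(4) add: mconst_simps(2))
  qed
  \<comment> \<open>Otherwise, for every a, a power of g is a multiple u_a (x_i - a) modulo M.
    Infinitely many of the u_a share the exponent and the set of monomials, so finitely many of them
    are linearly dependent.\<close>
  have root: "\<exists>a. mvar i - mconst a \<in> M" for i
  proof (rule ccontr)
    assume "\<not> ?thesis"
    then have nr: "mvar i - mconst a \<notin> M" for a by blast
    then have "\<forall>a. \<exists>n r. g ^ n - r * (mvar i - mconst a) \<in> M" using power_in by blast
    then obtain n u where nu: "\<And>a. g ^ n a - u a * (mvar i - mconst a) \<in> M" by metis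
    obtain y where y: "infinite ((\<lambda>a. (n a, Poly_Mapping.keys (u a))) -` {y})"
      using infinite_fibre[of "\<lambda>a. (n a, Poly_Mapping.keys (u a))"] by auto
    obtain n0 K where yK: "y = (n0, K)" by (cases y)
    define S where "S = {a. n a = n0 \<and> Poly_Mapping.keys (u a) = K}"
    have S: "infinite S" using y unfolding yK S_def by (simp add: vimage_def)
    then obtain a0 where "a0 \<in> S" by (metis finite.emptyI ex_in_conv)
    then have K: "finite K" unfolding S_def by auto
    obtain F where F: "F \<subseteq> S" "finite F" "card F = Suc (card K)" using infinite_arbitrarily_large[OF S] by blast
    obtain c where c: "\<exists>a\<in>F. c a \<noteq> 0" "\<forall>k\<in>K. (\<Sum>a\<in>F. c a * Poly_Mapping.lookup (u a) k) = 0"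
      using linear_dependence[OF K F(2), of "\<lambda>a. Poly_Mapping.lookup (u a)"] F(3) by auto
    have zero: "(\<Sum>a\<in>F. mconst (c a) * u a) = 0"
    proof (rule poly_mapping_eqI)
      fix k
      have l: "Poly_Mapping.lookup (mconst (c a) * u a) k = c a * Poly_Mapping.lookup (u a) k" for a
        unfolding mconst_def mult_map_scale_conv_mult[symmetric] by (simp add: Poly_Mapping.map.rep_eq when_def)
      have "(\<Sum>a\<in>F. c a * Poly_Mapping.lookup (u a) k) = 0"
      proof (cases "k \<in> K")
        case False
        then have "Poly_Mapping.lookup (u a) k = 0" if "a \<in> F" for a
          using that F(1) unfolding S_def by (auto simp: in_keys_iff)
        then show ?thesis by simp
      qed (use c in auto)
      then show "Poly_Mapping.lookup (\<Sum>a\<in>F. mconst (c a) * u a) k = Poly_Mapping.lookup 0 k"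
        by (simp add: lookup_sum l)
    qed
    \<comment> \<open>The numerator of the sum of the fractions c_a / (X - a). It does not vanish at
      any a in F with c_a nonzero.\<close>
    define q where "q = (\<Sum>a\<in>F. Polynomial.smult (c a) (\<Prod>b\<in>F-{a}. [:- b, 1:]))"
    have q0: "q \<noteq> 0"
    proof -
      obtain a where a: "a \<in> F" "c a \<noteq> 0" using c(1) by blast
      have "poly q a = (\<Sum>b\<in>F. c b * (\<Prod>b'\<in>F-{b}. a - b'))"
        by (simp add: q_def poly_sum poly_prod)
      also have "\<dots> = (\<Sum>b\<in>{a}. c b * (\<Prod>b'\<in>F-{b}. a - b'))"
        by (rule sum.mono_neutral_right) (use a F in auto)
      also have "\<dots> \<noteq> 0" using a F by simp
      finally show ?thesis by auto
    qed
    have "subst_var i p \<notin> M" if "p \<noteq> 0" for p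
      using that
    proof (induction "Polynomial.degree p" arbitrary: p)
      case 0
      then obtain c where "p = [:c:]" by (metis degree_eq_zeroE)
      then show ?case using const[of c] 0 by (simp add: subst_var_pCons)
    next
      case (Suc d)
      then have "\<not> constant (poly p)" by (simp add: constant_degree)
      then obtain z where "poly p z = 0" using fundamental_theorem_of_algebra by blast
      then obtain p' where p': "p = [:- z, 1:] * p'" by (auto simp: poly_eq_0_iff_dvd)
      then have "p' \<noteq> 0" using Suc.prems by auto
      moreover from this have "Polynomial.degree p = Suc (Polynomial.degree p')"
        unfolding p' by (subst degree_mult_eq) simp_all
      ultimately have "p' \<noteq> 0" "Polynomial.degree p' = d" using Suc.hyps by auto
      then have "subst_var i p' \<notin> M" using Suc.hyps by blast
      moreover have "subst_var i [:- z, 1:] = mvar i - mconst z" by (simp add: subst_var_pCons mconst_simps)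
      ultimately show ?case unfolding p' subst_var_mult using prime nr by simp
    qed
    then have qM: "subst_var i q \<notin> M" using q0 by blast
    have qe: "subst_var i q = (\<Sum>a\<in>F. mconst (c a) * (\<Prod>b\<in>F-{a}. mvar i - mconst b))"
      by (simp add: q_def subst_var_sum subst_var_smult subst_var_prod subst_var_pCons mconst_simps)
    \<comment> \<open>Modulo M each c_a u_a behaves like c_a g^n0 / (x_i - a). Clearing denominators
      in the relation between the u_a therefore puts g^n0 q(x_i) into M, although neither factor
      lies in this prime ideal.\<close>
    have "g ^ n0 * subst_var i q = g ^ n0 * subst_var i q - (\<Sum>a\<in>F. mconst (c a) * u a) * (\<Prod>b\<in>F. mvar i - mconst b)"
      using zero by simp
    also have "\<dots> = (\<Sum>a\<in>F. mconst (c a) * (\<Prod>b\<in>F-{a}. mvar i - mconst b) * (g ^ n0 - u a * (mvar i - mconst a)))"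
    proof -
      have "(\<Prod>b\<in>F. mvar i - mconst b) = (mvar i - mconst a) * (\<Prod>b\<in>F-{a}. mvar i - mconst b)" if "a \<in> F" for a
        using F(2) that by (rule prod.remove)
      then have e: "(\<Sum>a\<in>F. mconst (c a) * u a) * (\<Prod>b\<in>F. mvar i - mconst b)
        = (\<Sum>a\<in>F. mconst (c a) * u a * ((mvar i - mconst a) * (\<Prod>b\<in>F-{a}. mvar i - mconst b)))"
        unfolding sum_distrib_right by (intro sum.cong) auto
      show ?thesis unfolding qe e unfolding sum_distrib_left sum_subtractf[symmetric]
        by (rule sum.cong) (simp_all add: algebra_simps)
    qed
    also have "\<dots> \<in> M"
    proof (intro ID(7) ID(3))
      fix a assume "a \<in> F"
      then have "n a = n0" using F(1) S_def by auto
      then show "g ^ n0 - u a * (mvar i - mconst a) \<in> M" using nu[of a] by simp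
    qed
    finally show False using prime[OF M(3) qM] by blast
  qed
  then obtain v where v: "\<And>i. mvar i - mconst (v i) \<in> M" by metis
  have ev: "f - mconst (mpoly_eval f v) \<in> M" for f
  proof (induction f rule: mpoly_induct)
    case (1 c)
    then show ?case using ID(1) by simp
  next
    case (2 i)
    then show ?case using v by simp
  next
    case (3 f g)
    have "f + g - mconst (mpoly_eval (f + g) v) = (f - mconst (mpoly_eval f v)) + (g - mconst (mpoly_eval g v))"
      by (simp add: mpoly_eval_add mconst_simps)
    then show ?case using ID(2)[OF 3] by (simp only:)
  next
    case (4 f g)
    have "f * g - mconst (mpoly_eval (f * g) v) = (f - mconst (mpoly_eval f v)) * g + mconst (mpoly_eval f v) * (g - mconst (mpoly_eval g v))"
      by (simp add: mpoly_eval_mult mconst_simps algebra_simps)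
    then show ?case using ID(2)[OF ID(4)[OF 4(1)] ID(3)[OF 4(2)]] by (simp only:)
  qed
  have "mpoly_eval h v = 0" if "h \<in> H" for h
  proof (rule ccontr)
    assume nz: "mpoly_eval h v \<noteq> 0"
    have "h - (h - mconst (mpoly_eval h v)) \<in> M" by (rule ID(6)[OF _ ev]) (use that HI M(2) in blast)
    then show False using const[OF nz] by simp
  qed
  then have "mpoly_eval g v = 0" by (rule van)
  then have "g \<in> M" using ev[of g] by (simp add: mconst_simps)
  then show False using M(3)[of 1] by simp
qed

section \<open>Regular functions on multiprojective space\<close>

locale multiproj =
  fixes ns :: "nat list"
begin

abbreviation HC where "HC \<equiv> homog_coords ns"
abbreviation r where "r \<equiv> length ns"

lemma CI_Sigma: "coord_index ns = (SIGMA j:{..<r}. {..ns ! j})"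
  by (auto simp: coord_index_def)

lemma finite_CI: "finite (coord_index ns)"
  unfolding CI_Sigma by auto

lemma prod_CI: "(\<Prod>i\<in>coord_index ns. f i) = (\<Prod>j<r. \<Prod>k\<le>ns ! j. f (j, k))"
  unfolding CI_Sigma by (subst prod.Sigma) (auto simp: case_prod_unfold)

lemma sum_CI: "(\<Sum>i\<in>coord_index ns. f i) = (\<Sum>j<r. \<Sum>k\<le>ns ! j. f (j, k))"
  unfolding CI_Sigma by (subst sum.Sigma) (auto simp: case_prod_unfold)

definition good :: "(nat \<Rightarrow> nat) \<Rightarrow> ((nat \<times> nat) \<Rightarrow>\<^sub>0 nat) \<Rightarrow> bool" where
  "good a m \<longleftrightarrow> Poly_Mapping.keys m \<subseteq> coord_index ns \<and> (\<forall>j<r. (\<Sum>k\<le>ns ! j. Poly_Mapping.lookup m (j, k)) = a j)"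

lemma multihom_iff: "multihomogeneous ns a f \<longleftrightarrow> (\<forall>m\<in>Poly_Mapping.keys f. good a m)"
  by (simp add: multihomogeneous_def good_def)

lemma good_add: "good a m \<Longrightarrow> good b n \<Longrightarrow> good (\<lambda>j. a j + b j) (m + n)"
  unfolding good_def using keys_add[of m n] by (auto simp: lookup_add sum.distrib)

lemma multihom_add: "multihomogeneous ns a f \<Longrightarrow> multihomogeneous ns a g \<Longrightarrow> multihomogeneous ns a (f + g)"
  unfolding multihom_iff using keys_add[of f g] by auto

lemma multihom_mult: "multihomogeneous ns a f \<Longrightarrow> multihomogeneous ns b g \<Longrightarrow> multihomogeneous ns (\<lambda>j. a j + b j) (f * g)"
  unfolding multihom_iff using keys_mult[of f g] good_add by blast

lemma multihom_mconst: "multihomogeneous ns (\<lambda>_. 0) (mconst c)"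
  unfolding multihom_iff mconst_def good_def by auto

lemma multihom_mvar: "j < r \<Longrightarrow> k \<le> ns ! j \<Longrightarrow> multihomogeneous ns (\<lambda>i. if i = j then 1 else 0) (mvar (j, k))"
proof -
  assume jk: "j < r" "k \<le> ns ! j"
  have "(\<Sum>k'\<le>ns ! j'. Poly_Mapping.lookup (Poly_Mapping.single (j, k) (1::nat)) (j', k')) = (if j' = j then 1 else 0)" for j'
  proof -
    have "(\<Sum>k'\<le>ns ! j'. Poly_Mapping.lookup (Poly_Mapping.single (j, k) (1::nat)) (j', k'))
      = (\<Sum>k'\<le>ns ! j'. if k' = k then (if j' = j then 1 else 0) else 0)"
      by (rule sum.cong) (auto simp: lookup_single when_def)
    also have "\<dots> = (if j' = j then 1 else 0)" using jk by auto
    finally show ?thesis .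
  qed
  then show ?thesis unfolding multihom_iff mvar_def good_def using jk by (auto simp: coord_index_def)
qed

lemma mono_eval_scale:
  assumes "good a m" "\<And>j k. (j, k) \<in> coord_index ns \<Longrightarrow> w (j, k) = c j * v (j, k)"
  shows "mono_eval m w = (\<Prod>j<r. c j ^ a j) * mono_eval m v"
proof -
  have k: "Poly_Mapping.keys m \<subseteq> coord_index ns" using assms(1) good_def by blast
  have "mono_eval m w = (\<Prod>i\<in>coord_index ns. (c (fst i) * v i) ^ Poly_Mapping.lookup m i)"
    unfolding mono_eval_superset[OF finite_CI k] by (rule prod.cong) (use assms(2) in auto)
  also have "\<dots> = (\<Prod>i\<in>coord_index ns. c (fst i) ^ Poly_Mapping.lookup m i) * mono_eval m v"
    unfolding mono_eval_superset[OF finite_CI k] by (simp add: power_mult_distrib prod.distrib)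
  also have "(\<Prod>i\<in>coord_index ns. c (fst i) ^ Poly_Mapping.lookup m i) = (\<Prod>j<r. c j ^ a j)"
    unfolding prod_CI using assms(1) by (simp add: good_def flip: power_sum)
  finally show ?thesis .
qed

text \<open>Homogeneous polynomials are used through their values only. The degree is a parameter
  that need not be determined by the function: zero has every degree, and entries beyond the number
  of factors are ignored (\<open>hpoly_deg\<close>).\<close>

definition hpoly :: "(nat \<Rightarrow> nat) \<Rightarrow> (coords \<Rightarrow> complex) \<Rightarrow> bool" where
  "hpoly a p \<longleftrightarrow> (\<exists>f. multihomogeneous ns a f \<and> p = mpoly_eval f)"

lemma hpI: "multihomogeneous ns a f \<Longrightarrow> hpoly a (mpoly_eval f)" by (auto simp: hpoly_def)

lemma hpoly_zero: "hpoly a (\<lambda>_. 0)"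
  unfolding hpoly_def multihom_iff by (rule exI[of _ 0]) auto

lemma hpoly_const: "hpoly (\<lambda>_. 0) (\<lambda>_. c)"
  unfolding hpoly_def by (rule exI[of _ "mconst c"]) (auto simp: multihom_mconst)

lemma hpoly_X: "j < r \<Longrightarrow> k \<le> ns ! j \<Longrightarrow> hpoly (\<lambda>i. if i = j then 1 else 0) (\<lambda>v. v (j, k))"
  unfolding hpoly_def by (rule exI[of _ "mvar (j, k)"]) (auto simp: multihom_mvar[simplified])

lemma hpoly_add: "hpoly a p \<Longrightarrow> hpoly a q \<Longrightarrow> hpoly a (\<lambda>v. p v + q v)"
  unfolding hpoly_def using multihom_add mpoly_eval_add by (metis (no_types, lifting) ext)

lemma hpoly_mult: "hpoly a p \<Longrightarrow> hpoly b q \<Longrightarrow> hpoly (\<lambda>j. a j + b j) (\<lambda>v. p v * q v)"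
  unfolding hpoly_def using multihom_mult mpoly_eval_mult by (metis (no_types, lifting) ext)

lemma hpoly_deg: "hpoly a p \<Longrightarrow> (\<And>j. j < r \<Longrightarrow> a j = b j) \<Longrightarrow> hpoly b p"
  unfolding hpoly_def multihomogeneous_def by auto

lemma hpoly_cmult: "hpoly a p \<Longrightarrow> hpoly a (\<lambda>v. c * p v)"
  using hpoly_mult[OF hpoly_const[of c]] by simp

lemma hpoly_sum: "(\<And>i. i \<in> I \<Longrightarrow> hpoly a (p i)) \<Longrightarrow> hpoly a (\<lambda>v. \<Sum>i\<in>I. p i v)"
  by (induction I rule: infinite_finite_induct) (auto intro: hpoly_zero hpoly_add)

lemma hpoly_power: "hpoly a p \<Longrightarrow> hpoly (\<lambda>j. n * a j) (\<lambda>v. p v ^ n)"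
proof (induction n)
  case 0
  then show ?case using hpoly_const[of 1] by simp
next
  case (Suc n)
  then show ?case using hpoly_mult[of a p "\<lambda>j. n * a j"] by simp
qed

lemma hpoly_prod: "(\<And>i. i \<in> I \<Longrightarrow> hpoly (a i) (p i)) \<Longrightarrow> hpoly (\<lambda>j. \<Sum>i\<in>I. a i j) (\<lambda>v. \<Prod>i\<in>I. p i v)"
proof (induction I rule: infinite_finite_induct)
  case (insert i I)
  then show ?case using hpoly_mult[of "a i" "p i" "\<lambda>j. \<Sum>i\<in>I. a i j"] by simp
qed (use hpoly_const[of 1] in auto)

lemma hpoly_scale:
  assumes "hpoly a p" "\<And>j k. (j, k) \<in> coord_index ns \<Longrightarrow> w (j, k) = c j * v (j, k)"
  shows "p w = (\<Prod>j<r. c j ^ a j) * p v"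
proof -
  obtain f where f: "multihomogeneous ns a f" "p = mpoly_eval f" using assms(1) by (auto simp: hpoly_def)
  have "mono_eval m w = (\<Prod>j<r. c j ^ a j) * mono_eval m v" if "m \<in> Poly_Mapping.keys f" for m
    by (rule mono_eval_scale) (use f that assms(2) multihom_iff in auto)
  then show ?thesis by (simp add: f(2) mpoly_eval_alt sum_distrib_left mult_ac)
qed

lemma hpoly_restrict:
  assumes "hpoly a p" "\<And>i. i \<in> coord_index ns \<Longrightarrow> w i = v i"
  shows "p w = p v"
  using hpoly_scale[OF assms(1), of w "\<lambda>_. 1" v] assms(2) by simp

text \<open>For admissible \<open>K\<close> these are the generators of the irrelevant ideal of the
  multigraded coordinate ring; the locus where one of them is nonzero is a standard product
  chart.\<close>

definition chart_monom :: "(nat \<Rightarrow> nat) \<Rightarrow> coords \<Rightarrow> complex" where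
  "chart_monom K v = (\<Prod>j<r. v (j, K j))"

lemma hpoly_chart_monom:
  assumes "\<And>j. j < r \<Longrightarrow> K j \<le> ns ! j"
  shows "hpoly (\<lambda>_. 1) (chart_monom K)"
proof -
  have "hpoly (\<lambda>j. \<Sum>i<r. if j = i then 1 else 0) (chart_monom K)"
    unfolding chart_monom_def[abs_def] by (rule hpoly_prod) (use assms hpoly_X in auto)
  then show ?thesis by (rule hpoly_deg) auto
qed

section \<open>Points and the Zariski topology\<close>

definition point_of :: "coords \<Rightarrow> point" where "point_of v = proportional ns `` {v}"

lemma equiv_proportional: "equiv HC (proportional ns)"
proof (rule equivI)
  show "proportional ns \<subseteq> HC \<times> HC" by (auto simp: proportional_def)
  show "refl_on HC (proportional ns)"
    unfolding refl_on_def proportional_def by (auto intro!: exI[of _ "\<lambda>_. 1"])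
  show "sym (proportional ns)"
  proof (rule symI)
    fix v w assume "(v, w) \<in> proportional ns"
    then obtain c where c: "v \<in> HC" "w \<in> HC" "\<forall>j<r. c j \<noteq> 0" "\<forall>j k. w (j, k) = c j * v (j, k)"
      by (auto simp: proportional_def)
    have "v (j, k) = inverse (c j) * w (j, k)" for j k
    proof (cases "j < r")
      case False
      then have "v (j, k) = 0" "w (j, k) = 0" using c(1,2) by (auto simp: homog_coords_def coord_index_def)
      then show ?thesis by simp
    qed (use c in simp)
    then show "(w, v) \<in> proportional ns" using c
      by (auto simp: proportional_def intro!: exI[of _ "\<lambda>j. inverse (c j)"])
  qed
  show "Relation.trans (proportional ns)"
  proof (rule transI)
    fix u v w assume "(u, v) \<in> proportional ns" "(v, w) \<in> proportional ns"
    then obtain c c' where "u \<in> HC" "w \<in> HC" "\<forall>j<r. c j \<noteq> 0" "\<forall>j k. v (j, k) = c j * u (j, k)"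
      "\<forall>j<r. c' j \<noteq> 0" "\<forall>j k. w (j, k) = c' j * v (j, k)"
      by (auto simp: proportional_def)
    then show "(u, w) \<in> proportional ns"
      by (auto simp: proportional_def intro!: exI[of _ "\<lambda>j. c' j * c j"])
  qed
qed

lemma point_of_in: "v \<in> HC \<Longrightarrow> point_of v \<in> mproj ns"
  unfolding point_of_def mproj_def by (rule quotientI)

lemma hcoord_point_of:
  assumes "v \<in> HC"
  shows "(v, hcoord (point_of v)) \<in> proportional ns"
proof -
  have "v \<in> point_of v" unfolding point_of_def using equiv_class_self[OF equiv_proportional assms] .
  then have "hcoord (point_of v) \<in> point_of v" unfolding hcoord_def by (rule someI[where P = "\<lambda>w. w \<in> point_of v"])
  then show ?thesis by (simp add: point_of_def)
qed

lemma hcoord_point_of_HC: "v \<in> HC \<Longrightarrow> hcoord (point_of v) \<in> HC"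
  using hcoord_point_of by (auto simp: proportional_def)

lemma point_of_eqI: "(v, w) \<in> proportional ns \<Longrightarrow> point_of v = point_of w"
  unfolding point_of_def by (rule equiv_class_eq[OF equiv_proportional])

lemma hcoord_HC: "P \<in> mproj ns \<Longrightarrow> hcoord P \<in> HC"
  and point_of_hcoord: "P \<in> mproj ns \<Longrightarrow> point_of (hcoord P) = P"
proof -
  assume "P \<in> mproj ns"
  then obtain v where v: "v \<in> HC" "P = point_of v" unfolding mproj_def point_of_def by (auto elim: quotientE)
  show "hcoord P \<in> HC" using hcoord_point_of_HC v by simp
  show "point_of (hcoord P) = P" using point_of_eqI[OF hcoord_point_of[OF v(1)]] v by simp
qed

lemma proportionalD:
  assumes "(v, w) \<in> proportional ns"
  obtains c where "\<And>j. j < r \<Longrightarrow> c j \<noteq> 0" "\<And>j k. w (j, k) = c j * v (j, k)"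
  using assms by (auto simp: proportional_def)

lemma hpoly_nz: "hpoly a p \<Longrightarrow> (v, w) \<in> proportional ns \<Longrightarrow> p w = 0 \<longleftrightarrow> p v = 0"
  by (erule proportionalD) (simp add: hpoly_scale)

lemma hpoly_quot:
  assumes "hpoly a g" "hpoly a h" "(v, w) \<in> proportional ns"
  shows "g w / h w = g v / h v"
proof -
  obtain c where c: "\<And>j. j < r \<Longrightarrow> c j \<noteq> 0" "\<And>j k. w (j, k) = c j * v (j, k)"
    using assms(3) by (rule proportionalD) (rule that)
  have "(\<Prod>j<r. c j ^ a j) \<noteq> 0" using c(1) by simp
  moreover have "g w = (\<Prod>j<r. c j ^ a j) * g v" "h w = (\<Prod>j<r. c j ^ a j) * h v"
    using hpoly_scale[where w = w and c = c and v = v, OF assms(1)] hpoly_scale[where w = w and c = c and v = v, OF assms(2)] c(2) by auto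
  ultimately show ?thesis by (metis mult_divide_mult_cancel_left)
qed

lemma zariski_openin: "hpoly a h \<Longrightarrow> openin (zariski ns) {P \<in> mproj ns. h (hcoord P) \<noteq> 0}"
  unfolding zariski_def hpoly_def openin_topology_generated_by_iff
  by (auto intro!: generate_topology_on.Basis)

lemma openD:
  assumes "openin (zariski ns) U" "P \<in> U"
  shows "P \<in> mproj ns \<and> (\<exists>a h. hpoly a h \<and> h (hcoord P) \<noteq> 0 \<and> (\<forall>Q\<in>mproj ns. h (hcoord Q) \<noteq> 0 \<longrightarrow> Q \<in> U))"
proof -
  have "generate_topology_on {{P \<in> mproj ns. mpoly_eval f (hcoord P) \<noteq> 0} | f a. multihomogeneous ns a f} U"
    using assms(1) unfolding zariski_def openin_topology_generated_by_iff .
  then have "\<forall>P\<in>U. P \<in> mproj ns \<and> (\<exists>a h. hpoly a h \<and> h (hcoord P) \<noteq> 0 \<and> (\<forall>Q\<in>mproj ns. h (hcoord Q) \<noteq> 0 \<longrightarrow> Q \<in> U))"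
  proof (induction rule: generate_topology_on.induct)
    case (Int U V)
    show ?case
    proof
      fix P assume "P \<in> U \<inter> V"
      then obtain a h a' h' where *: "P \<in> mproj ns" "hpoly a h" "h (hcoord P) \<noteq> 0" "\<forall>Q\<in>mproj ns. h (hcoord Q) \<noteq> 0 \<longrightarrow> Q \<in> U"
        "hpoly a' h'" "h' (hcoord P) \<noteq> 0" "\<forall>Q\<in>mproj ns. h' (hcoord Q) \<noteq> 0 \<longrightarrow> Q \<in> V" using Int.IH by blast
      then show "P \<in> mproj ns \<and> (\<exists>a h. hpoly a h \<and> h (hcoord P) \<noteq> 0 \<and> (\<forall>Q\<in>mproj ns. h (hcoord Q) \<noteq> 0 \<longrightarrow> Q \<in> U \<inter> V))"
        using hpoly_mult[OF *(2,5)] by (intro conjI exI[of _ "\<lambda>j. a j + a' j"] exI[of _ "\<lambda>v. h v * h' v"]) auto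
    qed
  next
    case (UN K)
    show ?case
    proof
      fix P assume "P \<in> \<Union>K"
      then obtain k where "k \<in> K" "P \<in> k" by blast
      then show "P \<in> mproj ns \<and> (\<exists>a h. hpoly a h \<and> h (hcoord P) \<noteq> 0 \<and> (\<forall>Q\<in>mproj ns. h (hcoord Q) \<noteq> 0 \<longrightarrow> Q \<in> \<Union>K))"
        using UN by blast
    qed
  next
    case (Basis s)
    then obtain f a where "s = {P \<in> mproj ns. mpoly_eval f (hcoord P) \<noteq> 0}" "multihomogeneous ns a f" by blast
    then show ?case using hpI by blast
  qed simp
  then show ?thesis using assms(2) by blast
qed

lemma openin_mproj: "openin (zariski ns) (mproj ns)"
  using zariski_openin[OF hpoly_const[of 1]] by simp

section \<open>Homogeneous functions on cones\<close>

definition cone :: "point set \<Rightarrow> coords set" where "cone U = {v \<in> HC. point_of v \<in> U}"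

text \<open>N contains a principal open set around p; N itself may be any set, which keeps
  intersections and enlargements painless.\<close>

definition nbh :: "coords set \<Rightarrow> coords \<Rightarrow> bool" where
  "nbh N p \<longleftrightarrow> (\<exists>b h. hpoly b h \<and> h p \<noteq> 0 \<and> (\<forall>v\<in>HC. h v \<noteq> 0 \<longrightarrow> v \<in> N))"

lemma nbh_open:
  assumes "openin (zariski ns) U" "p \<in> HC" "point_of p \<in> U"
  shows "nbh (cone U) p"
proof -
  obtain a h where h: "hpoly a h" "h (hcoord (point_of p)) \<noteq> 0" "\<forall>Q\<in>mproj ns. h (hcoord Q) \<noteq> 0 \<longrightarrow> Q \<in> U"
    using openD[OF assms(1,3)] by blast
  have "h p \<noteq> 0" using h(2) hpoly_nz[OF h(1) hcoord_point_of[OF assms(2)]] by simp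
  moreover have "v \<in> cone U" if "v \<in> HC" "h v \<noteq> 0" for v
    using h(3) point_of_in[OF that(1)] that hpoly_nz[OF h(1) hcoord_point_of[OF that(1)]] by (simp add: cone_def)
  ultimately show ?thesis using h(1) unfolding nbh_def by blast
qed

lemma nbh_HC: "nbh HC p" unfolding nbh_def using hpoly_const[of 1] by (intro exI[of _ "\<lambda>_. 0"] exI[of _ "\<lambda>_. 1"]) auto

lemma nbh_hpoly: "hpoly a h \<Longrightarrow> h p \<noteq> 0 \<Longrightarrow> nbh {v \<in> HC. h v \<noteq> 0} p"
  unfolding nbh_def by blast

lemma nbh_Int: "nbh N p \<Longrightarrow> nbh M p \<Longrightarrow> nbh (N \<inter> M) p"
  unfolding nbh_def
proof (elim exE conjE)
  fix b h b' h' assume *: "hpoly b h" "h p \<noteq> 0" "\<forall>v\<in>HC. h v \<noteq> 0 \<longrightarrow> v \<in> N" "hpoly b' h'" "h' p \<noteq> 0" "\<forall>v\<in>HC. h' v \<noteq> 0 \<longrightarrow> v \<in> M"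
  then show "\<exists>b h. hpoly b h \<and> h p \<noteq> 0 \<and> (\<forall>v\<in>HC. h v \<noteq> 0 \<longrightarrow> v \<in> N \<inter> M)"
    by (intro exI[of _ "\<lambda>j. b j + b' j"] exI[of _ "\<lambda>v. h v * h' v"]) (auto simp: hpoly_mult)
qed

text \<open>Germs of sections of O(t), seen as functions on the cone. The degree is a difference of
  two natural degrees and may be negative. N bounds the neighbourhood where the quotient is valid
  from above, so the notion is monotone in N.\<close>

definition regular_at :: "(nat \<Rightarrow> int) \<Rightarrow> coords set \<Rightarrow> coords \<Rightarrow> (coords \<Rightarrow> complex) \<Rightarrow> bool" where
  "regular_at t N p \<rho> \<longleftrightarrow> (\<exists>a b g h. hpoly a g \<and> hpoly b h \<and> (\<forall>j<r. int (a j) - int (b j) = t j) \<and> h p \<noteq> 0 \<and>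
     (\<forall>v\<in>HC. h v \<noteq> 0 \<longrightarrow> v \<in> N \<and> \<rho> v = g v / h v))"

lemma regI:
  assumes "hpoly a g" "hpoly b h" "\<And>j. j < r \<Longrightarrow> int (a j) - int (b j) = t j" "h p \<noteq> 0"
    "\<And>v. v \<in> HC \<Longrightarrow> h v \<noteq> 0 \<Longrightarrow> v \<in> N" "\<And>v. v \<in> HC \<Longrightarrow> h v \<noteq> 0 \<Longrightarrow> \<rho> v = g v / h v"
  shows "regular_at t N p \<rho>"
  using assms unfolding regular_at_def by blast

lemma regE:
  assumes "regular_at t N p \<rho>"
  obtains a b g h where "hpoly a g" "hpoly b h" "\<And>j. j < r \<Longrightarrow> int (a j) - int (b j) = t j" "h p \<noteq> 0"
    "\<And>v. v \<in> HC \<Longrightarrow> h v \<noteq> 0 \<Longrightarrow> v \<in> N" "\<And>v. v \<in> HC \<Longrightarrow> h v \<noteq> 0 \<Longrightarrow> \<rho> v = g v / h v"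
  using assms unfolding regular_at_def by blast

lemma regular_at_deg: "regular_at t N p \<rho> \<Longrightarrow> (\<And>j. j < r \<Longrightarrow> t j = t' j) \<Longrightarrow> regular_at t' N p \<rho>"
  unfolding regular_at_def by metis

lemma regular_at_cong: "regular_at t N p \<rho> \<Longrightarrow> (\<And>v. v \<in> HC \<Longrightarrow> v \<in> N \<Longrightarrow> \<rho> v = \<rho>' v) \<Longrightarrow> regular_at t N p \<rho>'"
  by (erule regE) (rule regI, auto)

lemma regular_at_mono: "regular_at t N p \<rho> \<Longrightarrow> N \<subseteq> N' \<Longrightarrow> regular_at t N' p \<rho>"
  by (erule regE) (rule regI, auto)

lemma regular_at_mult:
  assumes "regular_at t N p \<rho>" "regular_at t' M p \<rho>'"
  shows "regular_at (\<lambda>j. t j + t' j) (N \<inter> M) p (\<lambda>v. \<rho> v * \<rho>' v)"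
proof -
  obtain a b g h where 1: "hpoly a g" "hpoly b h" "\<And>j. j < r \<Longrightarrow> int (a j) - int (b j) = t j" "h p \<noteq> 0"
    "\<And>v. v \<in> HC \<Longrightarrow> h v \<noteq> 0 \<Longrightarrow> v \<in> N" "\<And>v. v \<in> HC \<Longrightarrow> h v \<noteq> 0 \<Longrightarrow> \<rho> v = g v / h v"
    using assms(1) by (rule regE) (rule that)
  obtain a' b' g' h' where 2: "hpoly a' g'" "hpoly b' h'" "\<And>j. j < r \<Longrightarrow> int (a' j) - int (b' j) = t' j" "h' p \<noteq> 0"
    "\<And>v. v \<in> HC \<Longrightarrow> h' v \<noteq> 0 \<Longrightarrow> v \<in> M" "\<And>v. v \<in> HC \<Longrightarrow> h' v \<noteq> 0 \<Longrightarrow> \<rho>' v = g' v / h' v"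
    using assms(2) by (rule regE) (rule that)
  show ?thesis
    by (rule regI[OF hpoly_mult[OF 1(1) 2(1)] hpoly_mult[OF 1(2) 2(2)]]) (use 1(3-6) 2(3-6) in \<open>force+\<close>)
qed

lemma regular_at_add:
  assumes "regular_at t N p \<rho>" "regular_at t N p \<rho>'"
  shows "regular_at t N p (\<lambda>v. \<rho> v + \<rho>' v)"
proof -
  obtain a b g h where 1: "hpoly a g" "hpoly b h" "\<And>j. j < r \<Longrightarrow> int (a j) - int (b j) = t j" "h p \<noteq> 0"
    "\<And>v. v \<in> HC \<Longrightarrow> h v \<noteq> 0 \<Longrightarrow> v \<in> N" "\<And>v. v \<in> HC \<Longrightarrow> h v \<noteq> 0 \<Longrightarrow> \<rho> v = g v / h v"
    using assms(1) by (rule regE) (rule that)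
  obtain a' b' g' h' where 2: "hpoly a' g'" "hpoly b' h'" "\<And>j. j < r \<Longrightarrow> int (a' j) - int (b' j) = t j" "h' p \<noteq> 0"
    "\<And>v. v \<in> HC \<Longrightarrow> h' v \<noteq> 0 \<Longrightarrow> v \<in> N" "\<And>v. v \<in> HC \<Longrightarrow> h' v \<noteq> 0 \<Longrightarrow> \<rho>' v = g' v / h' v"
    using assms(2) by (rule regE) (rule that)
  have "hpoly (\<lambda>j. a j + b' j) (\<lambda>v. g' v * h v)"
    by (rule hpoly_deg[OF hpoly_mult[OF 2(1) 1(2)]]) (use 1(3) 2(3) in force)
  from hpoly_add[OF hpoly_mult[OF 1(1) 2(2)] this]
  have "hpoly (\<lambda>j. a j + b' j) (\<lambda>v. g v * h' v + g' v * h v)" .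
  then show ?thesis
  proof (rule regI[OF _ hpoly_mult[OF 1(2) 2(2)]])
    fix v assume "v \<in> HC" "h v * h' v \<noteq> 0"
    then show "\<rho> v + \<rho>' v = (g v * h' v + g' v * h v) / (h v * h' v)"
      using 1(6)[of v] 2(6)[of v] by (simp add: field_simps)
  qed (use 1(3-5) 2(3-5) in force)+
qed

lemma regular_at_hpoly: "hpoly a g \<Longrightarrow> nbh N p \<Longrightarrow> regular_at (\<lambda>j. int (a j)) N p g"
  unfolding nbh_def
proof (elim exE conjE)
  fix b h assume *: "hpoly a g" "hpoly b h" "h p \<noteq> 0" "\<forall>v\<in>HC. h v \<noteq> 0 \<longrightarrow> v \<in> N"
  show ?thesis by (rule regI[OF hpoly_mult[OF *(1,2)] *(2)]) (use * in auto)
qed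

lemma regular_at_inv:
  assumes "hpoly a g" "g p \<noteq> 0" "nbh N p"
  shows "regular_at (\<lambda>j. - int (a j)) N p (\<lambda>v. inverse (g v))"
proof -
  obtain b h where *: "hpoly b h" "h p \<noteq> 0" "\<forall>v\<in>HC. h v \<noteq> 0 \<longrightarrow> v \<in> N" using assms(3) nbh_def by blast
  show ?thesis by (rule regI[OF *(1) hpoly_mult[OF *(1) assms(1)]]) (use * assms in \<open>auto simp: field_simps\<close>)
qed

lemma regular_at_const: "nbh N p \<Longrightarrow> regular_at (\<lambda>_. 0) N p (\<lambda>_. c)"
  using regular_at_hpoly[OF hpoly_const[of c]] by simp

lemma ex_chart:
  assumes "p \<in> HC"
  obtains K where "\<And>j. j < r \<Longrightarrow> K j \<le> ns ! j" "chart_monom K p \<noteq> 0"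
proof -
  have "\<forall>j. \<exists>k. j < r \<longrightarrow> k \<le> ns ! j \<and> p (j, k) \<noteq> 0" using assms unfolding homog_coords_def by blast
  then obtain K where "\<And>j. j < r \<Longrightarrow> K j \<le> ns ! j \<and> p (j, K j) \<noteq> 0" by metis
  then show ?thesis by (intro that[of K]) (auto simp: chart_monom_def)
qed

lemma regular_at_zero:
  assumes "nbh N p" "p \<in> HC"
  shows "regular_at t N p (\<lambda>_. 0)"
proof -
  obtain b h where *: "hpoly b h" "h p \<noteq> 0" "\<forall>v\<in>HC. h v \<noteq> 0 \<longrightarrow> v \<in> N" using assms nbh_def by blast
  obtain K where K: "\<And>j. j < r \<Longrightarrow> K j \<le> ns ! j" "chart_monom K p \<noteq> 0" by (rule ex_chart[OF assms(2)]) (rule that; assumption)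
  \<comment> \<open>The numerator 0 must carry a natural degree. A power of a chart monomial in the
    denominator raises that degree until t can be added.\<close>
  define n where "n = (\<Sum>j<r. nat (- t j))"
  have n: "int n \<ge> - t j" if "j < r" for j
  proof -
    have "nat (- t j) \<le> n" unfolding n_def by (rule member_le_sum) (use that in auto)
    then show ?thesis by simp
  qed
  show ?thesis
    by (rule regI[OF hpoly_zero[of "\<lambda>j. nat (int (b j + n * 1) + t j)"] hpoly_mult[OF *(1) hpoly_power[OF hpoly_chart_monom[of K], of n]]])
       (use * K n in force)+
qed

lemma regular_at_cmult: "regular_at t N p \<rho> \<Longrightarrow> regular_at t N p (\<lambda>v. c * \<rho> v)"
  by (erule regE) (rule regI[OF hpoly_cmult[of _ _ c]], auto)

lemma regular_at_sum: "nbh N p \<Longrightarrow> p \<in> HC \<Longrightarrow> (\<And>i. i \<in> I \<Longrightarrow> regular_at t N p (\<rho> i)) \<Longrightarrow> regular_at t N p (\<lambda>v. \<Sum>i\<in>I. \<rho> i v)"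
  by (induction I rule: infinite_finite_induct) (auto intro: regular_at_add regular_at_zero)

lemma regular_at_restrict:
  assumes "regular_at t N p \<rho>" "nbh M p"
  shows "regular_at t (N \<inter> M) p \<rho>"
proof -
  have "regular_at (\<lambda>j. t j + 0) (N \<inter> M) p (\<lambda>v. \<rho> v * 1)" by (rule regular_at_mult[OF assms(1) regular_at_const[OF assms(2)]])
  then show ?thesis by simp
qed

section \<open>Clearing denominators globally\<close>

definition hpart :: "(nat \<Rightarrow> nat) \<Rightarrow> (nat \<Rightarrow> nat) \<Rightarrow> mpoly \<Rightarrow> mpoly" where
  "hpart B b d = (\<Sum>m\<in>{m \<in> Poly_Mapping.keys d. good (\<lambda>j. B j - b j) m \<and> (\<forall>j<r. b j \<le> B j)}. Poly_Mapping.single m (Poly_Mapping.lookup d m))"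

lemma lookup_hpart:
  "Poly_Mapping.lookup (hpart B b d) m = (if good (\<lambda>j. B j - b j) m \<and> (\<forall>j<r. b j \<le> B j) then Poly_Mapping.lookup d m else 0)"
proof -
  let ?S = "{m \<in> Poly_Mapping.keys d. good (\<lambda>j. B j - b j) m \<and> (\<forall>j<r. b j \<le> B j)}"
  have fin: "finite ?S" by simp
  have "Poly_Mapping.lookup (hpart B b d) m = (\<Sum>n\<in>?S. if n = m then Poly_Mapping.lookup d m else 0)"
    unfolding hpart_def lookup_sum by (rule sum.cong) (auto simp: lookup_single when_def)
  also have "\<dots> = (if m \<in> ?S then Poly_Mapping.lookup d m else 0)" using fin by simp
  finally show ?thesis by (auto simp: in_keys_iff)
qed

lemma multihom_hpart: "multihomogeneous ns (\<lambda>j. B j - b j) (hpart B b d)"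
  unfolding multihom_iff by (auto simp: in_keys_iff lookup_hpart split: if_splits)

lemma hpart_zero: "\<not> (\<forall>j<r. b j \<le> B j) \<Longrightarrow> hpart B b d = 0"
  by (rule poly_mapping_eqI) (simp add: lookup_hpart del: not_all)

lemma lookup_mult_hpart:
  assumes "multihomogeneous ns b h" "good B m"
  shows "Poly_Mapping.lookup (hpart B b d * h) m = Poly_Mapping.lookup (d * h) m"
proof -
  have "Poly_Mapping.lookup ((d - hpart B b d) * h) m = 0"
  proof (rule ccontr)
    assume "\<not> ?thesis"
    then have "m \<in> Poly_Mapping.keys ((d - hpart B b d) * h)" by (simp add: in_keys_iff)
    then obtain m' n where mn: "m = m' + n" "m' \<in> Poly_Mapping.keys (d - hpart B b d)" "n \<in> Poly_Mapping.keys h"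
      using keys_mult by blast
    have n: "good b n" using assms(1) mn(3) multihom_iff by blast
    have km: "Poly_Mapping.keys m' \<subseteq> coord_index ns"
      using assms(2) unfolding good_def mn(1) by (auto simp: in_keys_iff lookup_add)
    have sum: "(\<Sum>k\<le>ns ! j. Poly_Mapping.lookup m' (j, k)) + b j = B j" if "j < r" for j
      using assms(2) n that unfolding good_def mn(1) by (simp add: lookup_add sum.distrib)
    have "good (\<lambda>j. B j - b j) m'"
      unfolding good_def using km sum by (metis diff_add_inverse2)
    moreover have "\<forall>j<r. b j \<le> B j" using sum by (metis le_add2)
    ultimately have "Poly_Mapping.lookup (d - hpart B b d) m' = 0" by (simp add: lookup_minus lookup_hpart)
    then show False using mn(2) by (simp add: in_keys_iff)
  qed
  then show ?thesis by (simp add: left_diff_distrib lookup_minus)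
qed

text \<open>Only the components of degree B matter, so each coefficient may be replaced by its part
  of degree B - b. \<open>hpart\<close> is zero unless b \<le> B, because truncated subtraction
  would otherwise produce a wrong degree.\<close>

lemma homogeneous_combination:
  assumes "multihomogeneous ns B q" "finite F" "\<And>h. h \<in> F \<Longrightarrow> multihomogeneous ns (b h) h" "q = (\<Sum>h\<in>F. d h * h)"
  shows "q = (\<Sum>h\<in>F. hpart B (b h) (d h) * h)"
proof (rule poly_mapping_eqI)
  fix m
  show "Poly_Mapping.lookup q m = Poly_Mapping.lookup (\<Sum>h\<in>F. hpart B (b h) (d h) * h) m"
  proof (cases "good B m")
    case True
    then show ?thesis using assms(3) unfolding assms(4) lookup_sum by (intro sum.cong) (simp_all add: lookup_mult_hpart)
  next
    case False
    then have "Poly_Mapping.lookup q m = 0" using assms(1) by (auto simp: multihom_iff in_keys_iff)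
    moreover have "Poly_Mapping.lookup (hpart B (b h) (d h) * h) m = 0" if h: "h \<in> F" for h
    proof (cases "\<forall>j<r. b h j \<le> B j")
      case True
      have "multihomogeneous ns (\<lambda>j. (B j - b h j) + b h j) (hpart B (b h) (d h) * h)"
        by (rule multihom_mult[OF multihom_hpart assms(3)[OF h]])
      then have "multihomogeneous ns B (hpart B (b h) (d h) * h)"
        using True by (auto simp: multihomogeneous_def)
      then show ?thesis using False by (auto simp: multihom_iff in_keys_iff)
    qed (simp add: hpart_zero)
    ultimately show ?thesis by (simp add: lookup_sum)
  qed
qed

text \<open>The Nullstellensatz lives on the whole affine space; outside of the cone over \<open>X\<close> every
  product of one coordinate from each factor vanishes.\<close>

lemma homog_restrict:
  fixes v :: coords
  defines "v' \<equiv> (\<lambda>i. if i \<in> coord_index ns then v i else 0)"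
  shows "hpoly a p \<Longrightarrow> p v' = p v" "v' \<in> HC \<or> (\<forall>K. (\<forall>j<r. K j \<le> ns ! j) \<longrightarrow> chart_monom K v = 0)"
proof -
  show "hpoly a p \<Longrightarrow> p v' = p v" by (rule hpoly_restrict) (auto simp: v'_def)
  show "v' \<in> HC \<or> (\<forall>K. (\<forall>j<r. K j \<le> ns ! j) \<longrightarrow> chart_monom K v = 0)"
  proof (cases "v' \<in> HC")
    case False
    then obtain j where j: "j < r" "\<forall>k\<le>ns ! j. v (j, k) = 0"
      unfolding homog_coords_def v'_def by (auto simp: coord_index_def split: if_splits)
    then have "chart_monom K v = 0" if "\<forall>j<r. K j \<le> ns ! j" for K
      unfolding chart_monom_def using that by (intro prod_zero) auto
    then show ?thesis by blast
  qed blast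
qed

text \<open>The denominators that make \<rho> polynomial on the locus where G is nonzero have no
  common zero there, so a power of \<open>chart_monom K\<close> times G lies in their ideal; the
  chart monomial takes care of points outside of the cone over X. All large exponents work, so
  finitely many functions can share one exponent.\<close>

lemma regular_quotient:
  assumes G: "hpoly \<gamma> G" and K: "\<And>j. j < r \<Longrightarrow> K j \<le> ns ! j"
    and \<rho>: "\<And>p. p \<in> HC \<Longrightarrow> G p \<noteq> 0 \<Longrightarrow> regular_at t N p \<rho>"
  shows "\<exists>M0. \<forall>M\<ge>M0. \<exists>a g. hpoly a g \<and> (\<forall>j<r. int (a j) = t j + int M * (int (\<gamma> j) + 1)) \<and>
    (\<forall>v\<in>HC. G v \<noteq> 0 \<longrightarrow> (chart_monom K v * G v) ^ M * \<rho> v = g v)"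
proof -
  define H where "H = {h. \<exists>a b g. multihomogeneous ns b h \<and> hpoly a g \<and> (\<forall>j<r. int (a j) - int (b j) = t j) \<and>
    (\<forall>v\<in>HC. G v \<noteq> 0 \<longrightarrow> mpoly_eval h v * \<rho> v = g v)}"
  have xG: "hpoly (\<lambda>j. 1 + \<gamma> j) (\<lambda>v. chart_monom K v * G v)" by (rule hpoly_mult[OF hpoly_chart_monom[OF K] G])
  then obtain q where q: "multihomogeneous ns (\<lambda>j. 1 + \<gamma> j) q" "\<And>v. mpoly_eval q v = chart_monom K v * G v"
    unfolding hpoly_def by (metis (no_types))
  have Hcov: "\<exists>h\<in>H. mpoly_eval h p \<noteq> 0" if p: "p \<in> HC" "G p \<noteq> 0" for p
  proof -
    obtain a b g h where *: "hpoly a g" "hpoly b h" "\<And>j. j < r \<Longrightarrow> int (a j) - int (b j) = t j" "h p \<noteq> 0"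
      "\<And>v. v \<in> HC \<Longrightarrow> h v \<noteq> 0 \<Longrightarrow> v \<in> N" "\<And>v. v \<in> HC \<Longrightarrow> h v \<noteq> 0 \<Longrightarrow> \<rho> v = g v / h v"
      using \<rho>[OF p] by (rule regE) (rule that)
    \<comment> \<open>Squaring the denominator: the quotient formula is known only where h is
      nonzero, whereas h^2 \<rho> = g h also holds where h is zero.\<close>
    obtain f where f: "multihomogeneous ns (\<lambda>j. b j + b j) f" "mpoly_eval f = (\<lambda>v. h v * h v)"
      using hpoly_mult[OF *(2,2)] unfolding hpoly_def by metis
    have "mpoly_eval f v * \<rho> v = g v * h v" if "v \<in> HC" for v
      using *(6)[OF that] unfolding f(2) by (cases "h v = 0") auto
    then have "f \<in> H" unfolding H_def
      using f(1) hpoly_mult[OF *(1,2)] *(3) by (intro CollectI exI[of _ "\<lambda>j. a j + b j"] exI[of _ "\<lambda>j. b j + b j"] exI[of _ "\<lambda>v. g v * h v"]) auto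
    then show ?thesis using f(2) *(4) by (intro bexI[of _ f]) auto
  qed
  have "\<exists>n F d. finite F \<and> F \<subseteq> H \<and> q ^ n = (\<Sum>h\<in>F. d h * h)"
  proof (rule nullstellensatz)
    fix v assume v: "\<And>h. h \<in> H \<Longrightarrow> mpoly_eval h v = 0"
    define v' where "v' = (\<lambda>i. if i \<in> coord_index ns then v i else 0)"
    show "mpoly_eval q v = 0"
    proof (rule ccontr)
      assume nz: "mpoly_eval q v \<noteq> 0"
      then have "chart_monom K v \<noteq> 0" "G v \<noteq> 0" using q(2) by auto
      then have "v' \<in> HC" "G v' \<noteq> 0"
        using homog_restrict(2)[of v] homog_restrict(1)[OF G, of v] K unfolding v'_def by auto
      then obtain h where h: "h \<in> H" "mpoly_eval h v' \<noteq> 0" using Hcov by blast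
      then obtain b where "hpoly b (mpoly_eval h)" unfolding H_def using hpI by blast
      then have "mpoly_eval h v' = mpoly_eval h v" unfolding v'_def by (rule homog_restrict(1))
      then show False using v[OF h(1)] h(2) by simp
    qed
  qed
  then obtain n F d where F: "finite F" "F \<subseteq> H" "q ^ n = (\<Sum>h\<in>F. d h * h)" by (elim exE conjE)
  have "\<forall>h\<in>F. \<exists>a b g. multihomogeneous ns b h \<and> hpoly a g \<and> (\<forall>j<r. int (a j) - int (b j) = t j) \<and>
    (\<forall>v\<in>HC. G v \<noteq> 0 \<longrightarrow> mpoly_eval h v * \<rho> v = g v)" using F(2) unfolding H_def by blast
  then obtain a b g where abg: "\<And>h. h \<in> F \<Longrightarrow> multihomogeneous ns (b h) h" "\<And>h. h \<in> F \<Longrightarrow> hpoly (a h) (g h)"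
    "\<And>h j. h \<in> F \<Longrightarrow> j < r \<Longrightarrow> int (a h j) - int (b h j) = t j"
    "\<And>h v. h \<in> F \<Longrightarrow> v \<in> HC \<Longrightarrow> G v \<noteq> 0 \<Longrightarrow> mpoly_eval h v * \<rho> v = g h v"
    by metis
  \<comment> \<open>The second bound makes the prescribed degree of the numerator
    nonnegative.\<close>
  define M0 where "M0 = max n (\<Sum>j<r. nat (- t j))"
  show ?thesis
  proof (intro exI[of _ M0] allI impI)
    fix M assume M: "M \<ge> M0"
    define B where "B j = M * (1 + \<gamma> j)" for j
    define A where "A j = nat (t j + int (B j))" for j
    have A: "int (A j) = t j + int (B j)" if "j < r" for j
    proof -
      have "nat (- t j) \<le> (\<Sum>j<r. nat (- t j))" by (rule member_le_sum) (use that in auto)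
      then have "nat (- t j) \<le> M" using M by (simp add: M0_def)
      also have "M \<le> B j" by (simp add: B_def)
      finally show ?thesis by (simp add: A_def)
    qed
    have qM: "multihomogeneous ns B (q ^ M)"
    proof -
      have "multihomogeneous ns (\<lambda>j. m * (1 + \<gamma> j)) (q ^ m)" for m
      proof (induction m)
        case 0
        then show ?case using multihom_mconst[of 1] by (simp add: mconst_simps)
      next
        case (Suc m)
        then show ?case using multihom_mult[OF q(1) Suc] by (simp add: algebra_simps)
      qed
      then show ?thesis by (simp add: B_def[abs_def])
    qed
    have "q ^ M = q ^ (M - n) * q ^ n" using M by (simp add: M0_def flip: power_add)
    also have "\<dots> = (\<Sum>h\<in>F. (q ^ (M - n) * d h) * h)" unfolding F(3) by (simp add: sum_distrib_left mult.assoc)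
    finally have qe: "q ^ M = (\<Sum>h\<in>F. hpart B (b h) (q ^ (M - n) * d h) * h)"
      by (intro homogeneous_combination[OF qM F(1) abg(1)])
    define D where "D h = hpart B (b h) (q ^ (M - n) * d h)" for h
    define gg where "gg v = (\<Sum>h\<in>F. mpoly_eval (D h) v * g h v)" for v
    have "hpoly A (\<lambda>v. mpoly_eval (D h) v * g h v)" if h: "h \<in> F" for h
    proof (cases "\<forall>j<r. b h j \<le> B j")
      case True
      have "hpoly (\<lambda>j. B j - b h j + a h j) (\<lambda>v. mpoly_eval (D h) v * g h v)"
        unfolding D_def by (intro hpoly_mult hpI multihom_hpart abg(2)[OF h])
      then show ?thesis
      proof (rule hpoly_deg)
        fix j assume j: "j < r"
        then have "int (B j - b h j + a h j) = int (A j)" using A[OF j] abg(3)[OF h j] True by simp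
        then show "B j - b h j + a h j = A j" by linarith
      qed
    next
      case False
      then have "mpoly_eval (D h) v = 0" for v unfolding D_def using hpart_zero by simp
      then show ?thesis using hpoly_zero by simp
    qed
    then have "hpoly A gg" unfolding gg_def[abs_def] by (rule hpoly_sum)
    moreover have "(chart_monom K v * G v) ^ M * \<rho> v = gg v" if v: "v \<in> HC" "G v \<noteq> 0" for v
    proof -
      have "(chart_monom K v * G v) ^ M * \<rho> v = mpoly_eval (q ^ M) v * \<rho> v" by (simp add: mpoly_eval_power q(2))
      also have "\<dots> = (\<Sum>h\<in>F. mpoly_eval (D h) v * (mpoly_eval h v * \<rho> v))"
        unfolding qe D_def by (simp add: mpoly_eval_sum mpoly_eval_mult sum_distrib_right mult.assoc)
      also have "\<dots> = gg v" unfolding gg_def by (rule sum.cong) (use abg(4) v in auto)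
      finally show ?thesis .
    qed
    moreover have "\<forall>j<r. int (A j) = t j + int M * (int (\<gamma> j) + 1)" using A by (simp add: B_def algebra_simps)
    ultimately show "\<exists>a g. hpoly a g \<and> (\<forall>j<r. int (a j) = t j + int M * (int (\<gamma> j) + 1)) \<and>
      (\<forall>v\<in>HC. G v \<noteq> 0 \<longrightarrow> (chart_monom K v * G v) ^ M * \<rho> v = g v)" by blast
  qed
qed

text \<open>A power of each chart monomial is a combination of the functions \<open>h z\<close>, and
  such a combination involves only finitely many z. Finitely many chart monomials cover the
  cone.\<close>

lemma quasi_compact:
  assumes h: "\<And>z. z \<in> HC \<Longrightarrow> hpoly (b z) (h z)" "\<And>z. z \<in> HC \<Longrightarrow> h z z \<noteq> 0"
  obtains F where "finite F" "F \<subseteq> HC" "\<And>v. v \<in> HC \<Longrightarrow> \<exists>z\<in>F. h z v \<noteq> 0"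
proof -
  have "\<forall>z\<in>HC. \<exists>f. multihomogeneous ns (b z) f \<and> h z = mpoly_eval f" using h(1) unfolding hpoly_def by blast
  then obtain f where f: "\<And>z. z \<in> HC \<Longrightarrow> h z = mpoly_eval (f z)" by metis
  define T where "T = (PiE {..<r} (\<lambda>j. {..ns ! j}))"
  have finT: "finite T" unfolding T_def by (rule finite_PiE) auto
  have "\<exists>F. finite F \<and> F \<subseteq> HC \<and> (\<forall>v. chart_monom K v \<noteq> 0 \<longrightarrow> (\<exists>z\<in>F. h z v \<noteq> 0))" if K: "K \<in> T" for K
  proof -
    have KK: "\<forall>j<r. K j \<le> ns ! j" using K unfolding T_def by auto
    obtain q where q: "\<And>v. mpoly_eval q v = chart_monom K v" using hpoly_chart_monom[of K] KK unfolding hpoly_def by metis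
    have "\<exists>n F d. finite F \<and> F \<subseteq> f ` HC \<and> q ^ n = (\<Sum>h\<in>F. d h * h)"
    proof (rule nullstellensatz)
      fix v assume v: "\<And>g. g \<in> f ` HC \<Longrightarrow> mpoly_eval g v = 0"
      define v' where "v' = (\<lambda>i. if i \<in> coord_index ns then v i else 0)"
      show "mpoly_eval q v = 0"
      proof (rule ccontr)
        assume "mpoly_eval q v \<noteq> 0"
        then have v': "v' \<in> HC" using q homog_restrict(2)[of v] KK unfolding v'_def by auto
        have "h v' v' = h v' v" using homog_restrict(1)[OF h(1)[OF v'], of v] unfolding v'_def .
        then show False using h(2)[OF v'] v[of "f v'"] f[OF v'] v' by auto
      qed
    qed
    then obtain n F d where F: "finite F" "F \<subseteq> f ` HC" "q ^ n = (\<Sum>h\<in>F. d h * h)" by (elim exE conjE)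
    obtain F' where F': "finite F'" "F' \<subseteq> HC" "F = f ` F'" using finite_subset_image[OF F(1,2)] by blast
    have "\<exists>z\<in>F'. h z v \<noteq> 0" if "chart_monom K v \<noteq> 0" for v
    proof (rule ccontr)
      assume "\<not> ?thesis"
      then have "mpoly_eval g v = 0" if "g \<in> F" for g using F' f that by force
      then have "mpoly_eval (q ^ n) v = 0" unfolding F(3) by (simp add: mpoly_eval_sum mpoly_eval_mult)
      then show False using that by (simp add: mpoly_eval_power q)
    qed
    then show ?thesis using F' by blast
  qed
  then obtain FF where FF: "\<And>K. K \<in> T \<Longrightarrow> finite (FF K)" "\<And>K. K \<in> T \<Longrightarrow> FF K \<subseteq> HC"
    "\<And>K v. K \<in> T \<Longrightarrow> chart_monom K v \<noteq> 0 \<Longrightarrow> \<exists>z\<in>FF K. h z v \<noteq> 0" by metis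
  show ?thesis
  proof (rule that[of "\<Union>K\<in>T. FF K"])
    show "finite (\<Union>K\<in>T. FF K)" using finT FF(1) by blast
    show "(\<Union>K\<in>T. FF K) \<subseteq> HC" using FF(2) by blast
    fix v assume v: "v \<in> HC"
    obtain K where K: "\<And>j. j < r \<Longrightarrow> K j \<le> ns ! j" "chart_monom K v \<noteq> 0" by (rule ex_chart[OF v]) (rule that; assumption)
    define K' where "K' = restrict K {..<r}"
    have "K' \<in> T" unfolding K'_def T_def using K(1) by auto
    moreover have "chart_monom K' v = chart_monom K v" unfolding chart_monom_def K'_def by (rule prod.cong) auto
    ultimately show "\<exists>z\<in>(\<Union>K\<in>T. FF K). h z v \<noteq> 0" using FF(3)[of K' v] K(2) by force
  qed
qed

end

section \<open>Sections of twists as homogeneous functions\<close>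

locale vbun = multiproj ns for ns +
  fixes E :: vbundle
  assumes vb: "vector_bundle ns E"
begin

abbreviation X where "X \<equiv> mproj ns"
abbreviation rk where "rk \<equiv> rank E"

definition T :: "point \<Rightarrow> point \<Rightarrow> point \<Rightarrow> nat \<Rightarrow> nat \<Rightarrow> complex" where
  "T x y P i j = vbundle.trans E x y P $$ (i, j)"

lemma nbhd_open: "x \<in> X \<Longrightarrow> openin (zariski ns) (nbhd E x)"
  and nbhd_self: "x \<in> X \<Longrightarrow> x \<in> nbhd E x"
  using vb by (auto simp: vector_bundle_def)

lemma nbhd_X: "x \<in> X \<Longrightarrow> P \<in> nbhd E x \<Longrightarrow> P \<in> X"
  using openD[OF nbhd_open] by blast

lemma trans_carrier:
  "x \<in> X \<Longrightarrow> y \<in> X \<Longrightarrow> P \<in> nbhd E x \<Longrightarrow> P \<in> nbhd E y \<Longrightarrow> vbundle.trans E x y P \<in> carrier_mat rk rk"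
  using vb unfolding vector_bundle_def regular_mat_on_def by blast

lemma vb_cocycle:
  assumes "x \<in> X" "y \<in> X" "z \<in> X" "P \<in> nbhd E x" "P \<in> nbhd E y" "P \<in> nbhd E z"
  shows "vbundle.trans E x y P * vbundle.trans E y z P = vbundle.trans E x z P"
proof -
  have "\<forall>x\<in>X. \<forall>y\<in>X. \<forall>z\<in>X. \<forall>P\<in>nbhd E x \<inter> nbhd E y \<inter> nbhd E z.
      vbundle.trans E x y P * vbundle.trans E y z P = vbundle.trans E x z P"
    using vb unfolding vector_bundle_def by (elim conjE)
  from this[rule_format, OF assms(1-3), of P] show ?thesis using assms(4-6) by simp
qed

lemma T_refl: "x \<in> X \<Longrightarrow> P \<in> nbhd E x \<Longrightarrow> i < rk \<Longrightarrow> j < rk \<Longrightarrow> T x x P i j = (if i = j then 1 else 0)"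
  using vb unfolding vector_bundle_def T_def by simp

lemma T_trans:
  assumes "x \<in> X" "y \<in> X" "z \<in> X" "P \<in> nbhd E x" "P \<in> nbhd E y" "P \<in> nbhd E z" "i < rk" "j < rk"
  shows "(\<Sum>l<rk. T x y P i l * T y z P l j) = T x z P i j"
proof -
  have "vbundle.trans E x y P * vbundle.trans E y z P = vbundle.trans E x z P"
    by (rule vb_cocycle[OF assms(1-6)])
  then have "T x z P i j = (vbundle.trans E x y P * vbundle.trans E y z P) $$ (i, j)" by (simp only: T_def)
  also have "\<dots> = (\<Sum>l<rk. T x y P i l * T y z P l j)"
  proof -
    define A B where "A = vbundle.trans E x y P" and "B = vbundle.trans E y z P"
    have "A \<in> carrier_mat rk rk" "B \<in> carrier_mat rk rk"
      unfolding A_def B_def by (rule trans_carrier[OF assms(1,2,4,5)], rule trans_carrier[OF assms(2,3,5,6)])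
    then have "(A * B) $$ (i, j) = (\<Sum>l<rk. A $$ (i, l) * B $$ (l, j))"
      using assms(7,8) by (simp add: scalar_prod_def atLeast0LessThan)
    then show ?thesis by (simp only: T_def A_def B_def)
  qed
  finally show ?thesis by (rule sym)
qed

text \<open>Quotients of equal degree are invariant under rescaling, so the arbitrary
  representatives \<open>hcoord\<close> may be replaced by every vector of the cone.\<close>

lemma regular_on_regular_at:
  assumes "regular_on ns U \<phi>" "p \<in> HC" "point_of p \<in> U"
  shows "regular_at (\<lambda>_. 0) (cone U) p (\<lambda>v. \<phi> (point_of v))"
proof -
  from bspec[OF assms(1)[unfolded regular_on_def] assms(3)]
  obtain V a g h where V: "openin (zariski ns) V" "point_of p \<in> V" "V \<subseteq> U" "multihomogeneous ns a g" "multihomogeneous ns a h"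
    "\<forall>Q\<in>V. mpoly_eval h (hcoord Q) \<noteq> 0 \<and> \<phi> Q = mpoly_eval g (hcoord Q) / mpoly_eval h (hcoord Q)"
    by (elim exE conjE)
  obtain b f where f: "hpoly b f" "f (hcoord (point_of p)) \<noteq> 0" "\<forall>Q\<in>X. f (hcoord Q) \<noteq> 0 \<longrightarrow> Q \<in> V"
    using conjunct2[OF openD[OF V(1,2)]] by (elim exE conjE)
  have inV: "point_of v \<in> V" if "v \<in> HC" "f v \<noteq> 0" for v
    using f(3) point_of_in[OF that(1)] hpoly_nz[OF f(1) hcoord_point_of[OF that(1)]] that(2) by blast
  have fp: "f p \<noteq> 0" using f(2) hpoly_nz[OF f(1) hcoord_point_of[OF assms(2)]] by simp
  show ?thesis
  proof (rule regI[OF hpoly_mult[OF hpI[OF V(4)] f(1)] hpoly_mult[OF hpI[OF V(5)] f(1)]])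
    show "mpoly_eval h p * f p \<noteq> 0"
      using fp inV[OF assms(2) fp] V(6) hpoly_nz[OF hpI[OF V(5)] hcoord_point_of[OF assms(2)]] by auto
    fix v assume v: "v \<in> HC" "mpoly_eval h v * f v \<noteq> 0"
    then have P: "point_of v \<in> V" using inV by simp
    then show "v \<in> cone U" using V(3) v by (auto simp: cone_def)
    have "\<phi> (point_of v) = mpoly_eval g (hcoord (point_of v)) / mpoly_eval h (hcoord (point_of v))" using V(6) P by blast
    also have "\<dots> = mpoly_eval g v / mpoly_eval h v"
      by (rule hpoly_quot[OF hpI[OF V(4)] hpI[OF V(5)] hcoord_point_of[OF v(1)]])
    finally show "\<phi> (point_of v) = mpoly_eval g v * f v / (mpoly_eval h v * f v)" using v(2) by simp
  qed auto
qed

lemma regular_at_regular_on: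
  assumes "U \<subseteq> X" "\<And>p. p \<in> HC \<Longrightarrow> point_of p \<in> U \<Longrightarrow> regular_at (\<lambda>_. 0) (cone U) p \<rho>"
  shows "regular_on ns U (\<lambda>P. \<rho> (hcoord P))"
  unfolding regular_on_def
proof
  fix P assume P: "P \<in> U"
  then have PX: "P \<in> X" using assms(1) by blast
  obtain a b g h where *: "hpoly a g" "hpoly b h" "\<And>j. j < r \<Longrightarrow> int (a j) - int (b j) = 0" "h (hcoord P) \<noteq> 0"
    "\<And>v. v \<in> HC \<Longrightarrow> h v \<noteq> 0 \<Longrightarrow> v \<in> cone U" "\<And>v. v \<in> HC \<Longrightarrow> h v \<noteq> 0 \<Longrightarrow> \<rho> v = g v / h v"
    using assms(2)[OF hcoord_HC[OF PX]] point_of_hcoord[OF PX] P by (auto elim!: regE)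
  have h: "hpoly a h" using hpoly_deg[OF *(2)] *(3) by fastforce
  obtain fg fh where f: "multihomogeneous ns a fg" "g = mpoly_eval fg" "multihomogeneous ns a fh" "h = mpoly_eval fh"
    using *(1) h unfolding hpoly_def by blast
  define V where "V = {Q \<in> X. h (hcoord Q) \<noteq> 0}"
  have "openin (zariski ns) V" unfolding V_def by (rule zariski_openin[OF h])
  moreover have "P \<in> V" using PX *(4) by (simp add: V_def)
  moreover have "V \<subseteq> U"
  proof
    fix Q assume "Q \<in> V"
    then have "Q \<in> X" "hcoord Q \<in> cone U" using *(5) hcoord_HC unfolding V_def by auto
    then show "Q \<in> U" using point_of_hcoord by (simp add: cone_def)
  qed
  moreover have "\<forall>Q\<in>V. mpoly_eval fh (hcoord Q) \<noteq> 0 \<and> \<rho> (hcoord Q) = mpoly_eval fg (hcoord Q) / mpoly_eval fh (hcoord Q)"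
    using *(6) hcoord_HC unfolding V_def f(2,4) by auto
  ultimately show "\<exists>V a g h. openin (zariski ns) V \<and> P \<in> V \<and> V \<subseteq> U \<and> multihomogeneous ns a g \<and> multihomogeneous ns a h \<and>
      (\<forall>Q\<in>V. mpoly_eval h (hcoord Q) \<noteq> 0 \<and> \<rho> (hcoord Q) = mpoly_eval g (hcoord Q) / mpoly_eval h (hcoord Q))"
    using f(1,3) by (intro exI[of _ V] exI[of _ a] exI[of _ fg] exI[of _ fh]) simp
qed

lemma T_regular_at:
  assumes "x \<in> X" "y \<in> X" "p \<in> HC" "point_of p \<in> nbhd E x" "point_of p \<in> nbhd E y" "i < rk" "j < rk"
  shows "regular_at (\<lambda>_. 0) (cone (nbhd E x) \<inter> cone (nbhd E y)) p (\<lambda>v. T x y (point_of v) i j)"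
proof -
  have "regular_on ns (nbhd E x \<inter> nbhd E y) (\<lambda>P. T x y P i j)"
    using vb assms(1,2,6,7) unfolding vector_bundle_def regular_mat_on_def T_def by blast
  from regular_on_regular_at[OF this assms(3)] assms(4,5)
  have "regular_at (\<lambda>_. 0) (cone (nbhd E x \<inter> nbhd E y)) p (\<lambda>v. T x y (point_of v) i j)" by simp
  then show ?thesis by (rule regular_at_mono) (auto simp: cone_def)
qed

text \<open>A section is encoded by its components in the trivialisation at the point itself, as one
  function on the cone; \<open>component x\<close> recovers its components in the trivialisation at \<open>x\<close>.\<close>

definition component :: "point \<Rightarrow> (coords \<times> nat \<Rightarrow> complex) \<Rightarrow> nat \<Rightarrow> coords \<Rightarrow> complex" where
  "component x \<sigma> i v = (\<Sum>l<rk. T x (point_of v) (point_of v) i l * \<sigma> (v, l))"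

text \<open>The cocycle identity of the bundle, applied through the trivialisation at the point
  itself.\<close>

lemma component_change:
  assumes "x \<in> X" "y \<in> X" "v \<in> HC" "point_of v \<in> nbhd E x" "point_of v \<in> nbhd E y" "i < rk"
  shows "component y \<sigma> i v = (\<Sum>l<rk. T y x (point_of v) i l * component x \<sigma> l v)"
proof -
  have P: "point_of v \<in> X" "point_of v \<in> nbhd E (point_of v)" using assms(3) point_of_in nbhd_self by auto
  have "(\<Sum>l<rk. T y x (point_of v) i l * component x \<sigma> l v)
      = (\<Sum>l<rk. \<Sum>m<rk. T y x (point_of v) i l * T x (point_of v) (point_of v) l m * \<sigma> (v, m))"
    by (simp add: component_def sum_distrib_left mult.assoc)
  also have "\<dots> = (\<Sum>m<rk. (\<Sum>l<rk. T y x (point_of v) i l * T x (point_of v) (point_of v) l m) * \<sigma> (v, m))"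
    by (subst sum.swap) (simp add: sum_distrib_right)
  also have "\<dots> = component y \<sigma> i v"
    unfolding component_def by (rule sum.cong[OF refl]) (use T_trans assms P in simp)
  finally show ?thesis by simp
qed

lemma component_self: "v \<in> HC \<Longrightarrow> i < rk \<Longrightarrow> component (point_of v) \<sigma> i v = \<sigma> (v, i)"
  using point_of_in nbhd_self by (simp add: component_def T_refl if_distrib[of "\<lambda>c. c * _"] cong: if_cong)

lemma component_add: "component x (\<lambda>q. \<sigma> q + \<tau> q) i v = component x \<sigma> i v + component x \<tau> i v"
  by (simp add: component_def sum.distrib distrib_left)

lemma component_scale: "component x (\<lambda>q. \<rho> (fst q) * \<sigma> q) i v = \<rho> v * component x \<sigma> i v"
  by (simp add: component_def sum_distrib_left mult_ac)

lemma component_cong: "(\<And>l. l < rk \<Longrightarrow> \<sigma> (v, l) = \<tau> (v, l)) \<Longrightarrow> component x \<sigma> i v = component x \<tau> i v"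
  by (simp add: component_def)

text \<open>Regularity is tested in the trivialisation at the base point; by \<open>Reg_iff\<close>
  every other trivialisation around it gives the same notion.\<close>

definition Reg :: "(nat \<Rightarrow> int) \<Rightarrow> (coords \<times> nat \<Rightarrow> complex) \<Rightarrow> coords \<Rightarrow> bool" where
  "Reg t \<sigma> p \<longleftrightarrow> (\<forall>i<rk. regular_at t (cone (nbhd E (point_of p))) p (component (point_of p) \<sigma> i))"

lemma nbh_nbhd: "x \<in> X \<Longrightarrow> p \<in> HC \<Longrightarrow> point_of p \<in> nbhd E x \<Longrightarrow> nbh (cone (nbhd E x)) p"
  by (rule nbh_open[OF nbhd_open])

lemma regular_at_change:
  assumes "x \<in> X" "y \<in> X" "p \<in> HC" "point_of p \<in> nbhd E x" "point_of p \<in> nbhd E y"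
    and regular_at: "\<And>i. i < rk \<Longrightarrow> regular_at t (cone (nbhd E x)) p (component x \<sigma> i)" and i: "i < rk"
  shows "regular_at t (cone (nbhd E y)) p (component y \<sigma> i)"
proof -
  let ?N = "cone (nbhd E x) \<inter> cone (nbhd E y)"
  have nb: "nbh ?N p" by (intro nbh_Int nbh_nbhd assms)
  have "regular_at t ?N p (\<lambda>v. T y x (point_of v) i l * component x \<sigma> l v)" if "l < rk" for l
  proof -
    from regular_at_mult[OF T_regular_at[OF assms(2,1,3,5,4) i that] regular_at[OF that]]
    have "regular_at t (cone (nbhd E y) \<inter> cone (nbhd E x) \<inter> cone (nbhd E x)) p (\<lambda>v. T y x (point_of v) i l * component x \<sigma> l v)" by simp
    then show ?thesis by (rule regular_at_mono) auto
  qed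
  then have "regular_at t ?N p (\<lambda>v. \<Sum>l<rk. T y x (point_of v) i l * component x \<sigma> l v)"
    by (intro regular_at_sum nb assms(3)) auto
  then have "regular_at t ?N p (component y \<sigma> i)"
    by (rule regular_at_cong) (use component_change assms i in \<open>auto simp: cone_def\<close>)
  then show ?thesis by (rule regular_at_mono) auto
qed

lemma Reg_iff:
  assumes "x \<in> X" "p \<in> HC" "point_of p \<in> nbhd E x"
  shows "Reg t \<sigma> p \<longleftrightarrow> (\<forall>i<rk. regular_at t (cone (nbhd E x)) p (component x \<sigma> i))"
  unfolding Reg_def
  using regular_at_change[OF assms(1) point_of_in[OF assms(2)] assms(2,3) nbhd_self[OF point_of_in[OF assms(2)]], of t \<sigma>]
    regular_at_change[OF point_of_in[OF assms(2)] assms(1,2) nbhd_self[OF point_of_in[OF assms(2)]] assms(3), of t \<sigma>]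
  by blast

lemma RegI:
  assumes "x \<in> X" "p \<in> HC" "point_of p \<in> nbhd E x" "\<And>i. i < rk \<Longrightarrow> regular_at t N p (component x \<sigma> i)"
  shows "Reg t \<sigma> p"
  unfolding Reg_iff[OF assms(1-3)]
proof (intro allI impI)
  fix i assume "i < rk"
  from regular_at_restrict[OF assms(4)[OF this] nbh_nbhd[OF assms(1-3)]]
  show "regular_at t (cone (nbhd E x)) p (component x \<sigma> i)" by (rule regular_at_mono) simp
qed

lemma RegD: "Reg t \<sigma> p \<Longrightarrow> x \<in> X \<Longrightarrow> p \<in> HC \<Longrightarrow> point_of p \<in> nbhd E x \<Longrightarrow> i < rk \<Longrightarrow> regular_at t (cone (nbhd E x)) p (component x \<sigma> i)"
  using Reg_iff by blast

lemma Reg_cong: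
  assumes "Reg t \<sigma> p" "p \<in> HC" "nbh N p" "\<And>v l. v \<in> HC \<Longrightarrow> v \<in> N \<Longrightarrow> l < rk \<Longrightarrow> \<sigma> (v, l) = \<tau> (v, l)"
  shows "Reg t \<tau> p"
proof (rule RegI[OF point_of_in[OF assms(2)] assms(2) nbhd_self[OF point_of_in[OF assms(2)]]])
  fix i assume i: "i < rk"
  have "regular_at t (cone (nbhd E (point_of p)) \<inter> N) p (component (point_of p) \<sigma> i)"
    using assms(1,3) i unfolding Reg_def by (intro regular_at_restrict) auto
  then show "regular_at t (cone (nbhd E (point_of p)) \<inter> N) p (component (point_of p) \<tau> i)"
    by (rule regular_at_cong) (use assms(4) in \<open>auto intro: component_cong\<close>)
qed

lemma Reg_add: "Reg t \<sigma> p \<Longrightarrow> Reg t \<tau> p \<Longrightarrow> Reg t (\<lambda>q. \<sigma> q + \<tau> q) p"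
  unfolding Reg_def component_add[abs_def] by (simp add: regular_at_add)

lemma Reg_scale:
  assumes "Reg t \<sigma> p" "regular_at t' N p \<rho>"
  shows "Reg (\<lambda>j. t' j + t j) (\<lambda>q. \<rho> (fst q) * \<sigma> q) p"
  unfolding Reg_def component_scale[abs_def]
proof (intro allI impI)
  fix i assume "i < rk"
  then have "regular_at t (cone (nbhd E (point_of p))) p (component (point_of p) \<sigma> i)" using assms(1) by (simp add: Reg_def)
  from regular_at_mult[OF assms(2) this]
  show "regular_at (\<lambda>j. t' j + t j) (cone (nbhd E (point_of p))) p (\<lambda>v. \<rho> v * component (point_of p) \<sigma> i v)"
    by (rule regular_at_mono) auto
qed

lemma Reg_deg: "Reg t \<sigma> p \<Longrightarrow> (\<And>j. j < r \<Longrightarrow> t j = t' j) \<Longrightarrow> Reg t' \<sigma> p"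
  unfolding Reg_def by (meson regular_at_deg)

lemma Reg_zero: "p \<in> HC \<Longrightarrow> Reg t (\<lambda>_. 0) p"
  unfolding Reg_def component_def using point_of_in nbhd_self by (auto intro!: regular_at_zero nbh_nbhd)

definition pl :: "point set \<Rightarrow> (coords \<times> nat) set" where
  "pl U = {(v, i). v \<in> cone U \<and> i < rk}"

definition sec :: "(nat \<Rightarrow> int) \<Rightarrow> point set \<Rightarrow> (coords \<times> nat \<Rightarrow> complex) set" where
  "sec t U = {\<sigma>. \<forall>p\<in>cone U. Reg t \<sigma> p}"

definition Dc :: "nat \<Rightarrow> nat \<Rightarrow> point set" where
  "Dc j k = {P \<in> X. hcoord P (j, k) \<noteq> 0}"

lemma coneD: "p \<in> cone U \<Longrightarrow> p \<in> HC" "p \<in> cone U \<Longrightarrow> point_of p \<in> U"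
  by (auto simp: cone_def)

lemma cone_Dc: "v \<in> cone (Dc j k) \<longleftrightarrow> v \<in> HC \<and> v (j, k) \<noteq> 0"
proof -
  have "hcoord (point_of v) (j, k) \<noteq> 0 \<longleftrightarrow> v (j, k) \<noteq> 0" if v: "v \<in> HC"
  proof -
    obtain c where c: "\<And>j. j < r \<Longrightarrow> c j \<noteq> 0" "\<And>j k. hcoord (point_of v) (j, k) = c j * v (j, k)"
      using hcoord_point_of[OF v] by (rule proportionalD) (rule that)
    show ?thesis
    proof (cases "j < r")
      case False
      then have "v (j, k) = 0" using v by (auto simp: homog_coords_def coord_index_def)
      then show ?thesis using c by simp
    qed (use c in simp)
  qed
  then show ?thesis using point_of_in by (auto simp: cone_def Dc_def)
qed

sublocale GS: graded_sheaf "openin (zariski ns)" X pl sec "\<lambda>j k q. fst q (j, k)" Dc ns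
proof
  show "U \<subseteq> V \<Longrightarrow> pl U \<subseteq> pl V" for U V by (auto simp: pl_def cone_def)
  show "(\<lambda>_. 0) \<in> sec t U" for t U by (auto simp: sec_def dest: coneD intro: Reg_zero)
  show "f \<in> sec t U \<Longrightarrow> g \<in> sec t U \<Longrightarrow> (\<lambda>q. f q + g q) \<in> sec t U" for f g t U
    by (auto simp: sec_def intro: Reg_add)
  show "(\<lambda>q. a * f q) \<in> sec t U" if f: "f \<in> sec t U" for f t U a
    unfolding sec_def
  proof (intro CollectI ballI)
    fix p assume p: "p \<in> cone U"
    have "Reg (\<lambda>j. 0 + t j) (\<lambda>q. a * f q) p"
      by (rule Reg_scale[OF _ regular_at_const[OF nbh_HC]]) (use f p in \<open>auto simp: sec_def\<close>)
    then show "Reg t (\<lambda>q. a * f q) p" by simp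
  qed
  show "U \<subseteq> V \<Longrightarrow> f \<in> sec t V \<Longrightarrow> f \<in> sec t U" for U V f t by (auto simp: sec_def cone_def)
  show "(\<lambda>q. fst q (j, k) * f q) \<in> sec (t(j := s + 1)) U"
    if jk: "j < r" "k \<le> ns ! j" and f: "f \<in> sec (t(j := s)) U" for j k f t s U
    unfolding sec_def
  proof (intro CollectI ballI)
    fix p assume p: "p \<in> cone U"
    from Reg_scale[OF _ regular_at_hpoly[OF hpoly_X[OF jk] nbh_HC], of "t(j := s)" f p] f p
    show "Reg (t(j := s + 1)) (\<lambda>q. fst q (j, k) * f q) p"
      by (auto simp: sec_def elim!: Reg_deg)
  qed
  show "(\<lambda>q. inverse (fst q (j, k)) * f q) \<in> sec (t(j := s - 1)) U"
    if jk: "j < r" "k \<le> ns ! j" and U: "U \<subseteq> Dc j k" and f: "f \<in> sec (t(j := s)) U" for j k f t s U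
    unfolding sec_def
  proof (intro CollectI ballI)
    fix p assume p: "p \<in> cone U"
    then have "p \<in> cone (Dc j k)" using U by (auto simp: cone_def)
    then have nz: "p (j, k) \<noteq> 0" by (simp add: cone_Dc)
    from Reg_scale[OF _ regular_at_inv[where g = "\<lambda>v. v (j, k)" and p = p, OF hpoly_X[OF jk] _ nbh_HC, OF nz], of "t(j := s)" f] f p
    show "Reg (t(j := s - 1)) (\<lambda>q. inverse (fst q (j, k)) * f q) p"
      by (auto simp: sec_def elim!: Reg_deg)
  qed
  show "q \<in> pl (\<Union>W) \<Longrightarrow> \<exists>u\<in>W. q \<in> pl u" for q W by (auto simp: pl_def cone_def)
  show "q \<in> pl (Dc j k) \<Longrightarrow> fst q (j, k) \<noteq> 0" for q j k by (auto simp: pl_def cone_Dc)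
  show "openin (zariski ns) U \<Longrightarrow> openin (zariski ns) V \<Longrightarrow> openin (zariski ns) (U \<inter> V)" for U V by (rule openin_Int)
  show "openin (zariski ns) X" by (rule openin_mproj)
  show "openin (zariski ns) (Dc j k)" if "j < r" "k \<le> ns ! j" for j k
    unfolding Dc_def by (rule zariski_openin[OF hpoly_X[OF that]])
  show "\<exists>k\<le>ns ! j. P \<in> Dc j k" if "P \<in> X" "j < r" for P j
    using hcoord_HC[OF that(1)] that unfolding homog_coords_def Dc_def by auto
qed

end

context vbun
begin

section \<open>Comparison with sections of the twisted bundle\<close>

definition Onb :: "point \<Rightarrow> point set" where
  "Onb x = {P \<in> X. \<forall>j<r. hcoord P (j, chart x j) \<noteq> 0}"

text \<open>The local generator of O(t) in the chart at x. Dividing a homogeneous function by it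
  gives the component in that chart, and quotients of two generators are the transition functions of
  \<open>O_bundle\<close>.\<close>

definition chart_factor :: "(nat \<Rightarrow> int) \<Rightarrow> point \<Rightarrow> coords \<Rightarrow> complex" where
  "chart_factor t x v = (\<Prod>j<r. v (j, chart x j) powi t j)"

lemma chart_nz: "x \<in> X \<Longrightarrow> j < r \<Longrightarrow> chart x j \<le> ns ! j \<and> hcoord x (j, chart x j) \<noteq> 0"
proof -
  assume x: "x \<in> X" "j < r"
  obtain k where k: "k \<le> ns ! j" "hcoord x (j, k) \<noteq> 0"
    using hcoord_HC[OF x(1)] x(2) unfolding homog_coords_def by blast
  show ?thesis unfolding chart_def
    using LeastI[of "\<lambda>k. hcoord x (j, k) \<noteq> 0", OF k(2)] Least_le[of "\<lambda>k. hcoord x (j, k) \<noteq> 0", OF k(2)] k(1) by simp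
qed

lemma Onb_self: "x \<in> X \<Longrightarrow> x \<in> Onb x"
  using chart_nz by (simp add: Onb_def)

lemma Onb_nz: "v \<in> HC \<Longrightarrow> point_of v \<in> Onb x \<Longrightarrow> j < r \<Longrightarrow> v (j, chart x j) \<noteq> 0"
  using cone_Dc[of v j "chart x j"] by (auto simp: Onb_def cone_def Dc_def)

lemma chart_factor_nz: "v \<in> HC \<Longrightarrow> point_of v \<in> Onb x \<Longrightarrow> chart_factor t x v \<noteq> 0"
  using Onb_nz by (auto simp: chart_factor_def power_int_0_left_if split: if_splits)

lemma nbh_Onb: "x \<in> X \<Longrightarrow> p \<in> HC \<Longrightarrow> point_of p \<in> Onb x \<Longrightarrow> nbh (cone (Onb x)) p"
proof -
  assume a: "x \<in> X" "p \<in> HC" "point_of p \<in> Onb x"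
  have "hpoly (\<lambda>_. 1) (chart_monom (chart x))" by (rule hpoly_chart_monom) (use chart_nz a in auto)
  from nbh_hpoly[OF this] have "nbh {v \<in> HC. chart_monom (chart x) v \<noteq> 0} p"
    using Onb_nz[OF a(2,3)] by (simp add: chart_monom_def)
  moreover have "{v \<in> HC. chart_monom (chart x) v \<noteq> 0} \<subseteq> cone (Onb x)"
  proof
    fix v assume v: "v \<in> {v \<in> HC. chart_monom (chart x) v \<noteq> 0}"
    then have "\<forall>j<r. v \<in> cone (Dc j (chart x j))" unfolding cone_Dc by (auto simp: chart_monom_def)
    then show "v \<in> cone (Onb x)" using v point_of_in by (auto simp: cone_def Onb_def Dc_def)
  qed
  ultimately show ?thesis unfolding nbh_def by blast
qed

lemma regular_at_powi:
  assumes "hpoly a g" "k < 0 \<Longrightarrow> g p \<noteq> 0"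
  shows "regular_at (\<lambda>j. k * int (a j)) HC p (\<lambda>v. g v powi k)"
proof (cases "k \<ge> 0")
  case True
  then obtain n where "k = int n" by (metis nonneg_int_cases)
  then show ?thesis using regular_at_hpoly[OF hpoly_power[OF assms(1)] nbh_HC, of n p] by simp
next
  case False
  then obtain n where n: "k = - int n" by (metis int_cases2 linear neg_0_le_iff_le of_nat_0_le_iff)
  have "g p ^ n \<noteq> 0" using assms(2) False by simp
  from regular_at_inv[where g = "\<lambda>v. g v ^ n", OF hpoly_power[OF assms(1)] this nbh_HC]
  show ?thesis using n by (simp add: power_int_minus)
qed

lemma regular_at_prod:
  assumes "p \<in> HC" "\<And>i. i \<in> I \<Longrightarrow> regular_at (t i) HC p (\<rho> i)"
  shows "regular_at (\<lambda>j. \<Sum>i\<in>I. t i j) HC p (\<lambda>v. \<Prod>i\<in>I. \<rho> i v)"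
  using assms(2)
proof (induction I rule: infinite_finite_induct)
  case (insert i I)
  then show ?case using regular_at_mult[of "t i" HC p "\<rho> i" "\<lambda>j. \<Sum>i\<in>I. t i j" HC] by simp
qed (use regular_at_const[OF nbh_HC] in auto)

lemma regular_at_chart_factor:
  assumes "x \<in> X" "p \<in> HC" "point_of p \<in> Onb x"
  shows "regular_at t HC p (chart_factor t x)"
proof -
  have "regular_at (\<lambda>j. \<Sum>i<r. t i * int (if j = i then 1 else 0)) HC p (\<lambda>v. \<Prod>i<r. v (i, chart x i) powi t i)"
    by (rule regular_at_prod[OF assms(2)], rule regular_at_powi[OF hpoly_X]) (use chart_nz assms Onb_nz in auto)
  then show ?thesis unfolding chart_factor_def[abs_def]
    by (rule regular_at_deg) (simp add: if_distrib[of int] if_distrib[of "\<lambda>c. _ * c"] cong: if_cong)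
qed

lemma chart_factor_add: "v \<in> HC \<Longrightarrow> point_of v \<in> Onb x \<Longrightarrow> chart_factor t x v * chart_factor (\<lambda>j. - t j) x v = 1"
  unfolding chart_factor_def prod.distrib[symmetric] using Onb_nz by (intro prod.neutral) (auto simp: power_int_minus)

lemma regular_at_inv_chart_factor:
  assumes "x \<in> X" "p \<in> HC" "point_of p \<in> Onb x"
  shows "regular_at (\<lambda>j. - t j) (cone (Onb x)) p (\<lambda>v. inverse (chart_factor t x v))"
proof -
  have "regular_at (\<lambda>j. - t j) (HC \<inter> cone (Onb x)) p (chart_factor (\<lambda>j. - t j) x)"
    by (intro regular_at_restrict regular_at_chart_factor nbh_Onb assms)
  then have "regular_at (\<lambda>j. - t j) (HC \<inter> cone (Onb x)) p (\<lambda>v. inverse (chart_factor t x v))"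
  proof (rule regular_at_cong)
    fix v assume "v \<in> HC" "v \<in> HC \<inter> cone (Onb x)"
    then have "chart_factor t x v * chart_factor (\<lambda>j. - t j) x v = 1" by (intro chart_factor_add) (auto dest: coneD)
    then show "chart_factor (\<lambda>j. - t j) x v = inverse (chart_factor t x v)" by (rule inverse_unique[symmetric])
  qed
  then show ?thesis by (rule regular_at_mono) auto
qed

lemma chart_factor_quot:
  assumes "(v, w) \<in> proportional ns" "v \<in> HC" "point_of v \<in> Onb x" "point_of v \<in> Onb y"
  shows "(\<Prod>j<r. (w (j, chart y j) / w (j, chart x j)) powi t j) = chart_factor t y v / chart_factor t x v"
proof -
  obtain c where c: "\<And>j. j < r \<Longrightarrow> c j \<noteq> 0" "\<And>j k. w (j, k) = c j * v (j, k)"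
    using assms(1) by (rule proportionalD) (rule that)
  have "(\<Prod>j<r. (w (j, chart y j) / w (j, chart x j)) powi t j) = (\<Prod>j<r. v (j, chart y j) powi t j / v (j, chart x j) powi t j)"
    by (rule prod.cong) (use c in \<open>auto simp: power_int_divide_distrib\<close>)
  then show ?thesis by (simp add: chart_factor_def prod_dividef)
qed

lemma twist_simps:
  "rank (twist ns E t) = rk" "nbhd (twist ns E t) x = nbhd E x \<inter> Onb x"
  "vbundle.trans (twist ns E t) x y P = kronecker_mat (vbundle.trans E x y P)
     (mat 1 1 (\<lambda>_. \<Prod>j<r. (hcoord P (j, chart y j) / hcoord P (j, chart x j)) powi t j))"
  by (simp_all add: vb_tensor_def O_bundle_def Onb_def)

lemma twist_trans_mult:
  assumes "x \<in> X" "y \<in> X" "P \<in> nbhd E x" "P \<in> nbhd E y" "P \<in> Onb x" "P \<in> Onb y" "s \<in> carrier_vec rk" "i < rk"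
  shows "(vbundle.trans (twist ns E t) x y P *\<^sub>v s) $ i =
    (\<Sum>l<rk. T x y P i l * (chart_factor t y (hcoord P) / chart_factor t x (hcoord P)) * s $ l)"
proof -
  define A where "A = vbundle.trans E x y P"
  define u where "u = (\<Prod>j<r. (hcoord P (j, chart y j) / hcoord P (j, chart x j)) powi t j)"
  have A: "A \<in> carrier_mat rk rk" unfolding A_def by (rule trans_carrier[OF assms(1-4)])
  have PX: "P \<in> X" using assms(1,3) by (rule nbhd_X)
  have hh: "(hcoord P, hcoord P) \<in> proportional ns"
    using hcoord_point_of[OF hcoord_HC[OF PX]] point_of_hcoord[OF PX] by simp
  have u: "u = chart_factor t y (hcoord P) / chart_factor t x (hcoord P)"
    unfolding u_def by (rule chart_factor_quot[OF hh hcoord_HC[OF PX]]) (use point_of_hcoord[OF PX] assms in auto)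
  have k: "kronecker_mat A (mat 1 1 (\<lambda>_. u)) = mat rk rk (\<lambda>(i, j). A $$ (i, j) * u)"
    using A unfolding kronecker_mat_def by (intro eq_matI) auto
  have "vbundle.trans (twist ns E t) x y P = mat rk rk (\<lambda>(i, j). A $$ (i, j) * u)"
    unfolding k[symmetric] unfolding twist_simps A_def u_def by (rule refl)
  then have "(vbundle.trans (twist ns E t) x y P *\<^sub>v s) $ i = (mat rk rk (\<lambda>(i, j). A $$ (i, j) * u) *\<^sub>v s) $ i"
    by (rule arg_cong)
  also have "\<dots> = (\<Sum>l<rk. A $$ (i, l) * u * s $ l)"
    using assms(7,8) by (simp add: scalar_prod_def atLeast0LessThan)
  finally show ?thesis unfolding u by (simp add: A_def T_def)
qed

text \<open>\<open>Phi\<close> and \<open>Psi\<close> translate between sections of the twisted bundle and homogeneous sections of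
  degree \<open>t\<close> expressed in the trivialisation at the point itself.\<close>

definition Phi :: "(nat \<Rightarrow> int) \<Rightarrow> vb_section \<Rightarrow> coords \<times> nat \<Rightarrow> complex" where
  "Phi t s q = s (point_of (fst q)) (point_of (fst q)) $ snd q * chart_factor t (point_of (fst q)) (fst q)"

definition Psi :: "(nat \<Rightarrow> int) \<Rightarrow> (coords \<times> nat \<Rightarrow> complex) \<Rightarrow> vb_section" where
  "Psi t \<sigma> x P = vec rk (\<lambda>i. component x \<sigma> i (hcoord P) / chart_factor t x (hcoord P))"

lemma chart_factor_hcoord_quot:
  assumes "v \<in> HC" "point_of v \<in> Onb x" "point_of v \<in> Onb y"
  shows "chart_factor t y (hcoord (point_of v)) / chart_factor t x (hcoord (point_of v)) = chart_factor t y v / chart_factor t x v"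
proof -
  have h: "hcoord (point_of v) \<in> HC" "point_of (hcoord (point_of v)) = point_of v" using hcoord_HC point_of_hcoord point_of_in[OF assms(1)] by auto
  have hh: "(hcoord (point_of v), hcoord (point_of v)) \<in> proportional ns"
    using hcoord_point_of[OF h(1)] h(2) by simp
  show ?thesis
    using chart_factor_quot[OF hcoord_point_of[OF assms(1)] assms, of t] chart_factor_quot[OF hh h(1), of x y t] h(2) assms(2,3) by simp
qed

lemma vb_sectionsD:
  assumes "s \<in> vb_sections ns F U" "x \<in> X"
  shows "regular_vec_on ns (rank F) (U \<inter> nbhd F x) (s x)"
    "y \<in> X \<Longrightarrow> P \<in> U \<Longrightarrow> P \<in> nbhd F x \<Longrightarrow> P \<in> nbhd F y \<Longrightarrow> s x P = vbundle.trans F x y P *\<^sub>v s y P"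
proof -
  from assms(1)[unfolded vb_sections_def mem_Collect_eq]
  have 1: "\<forall>x\<in>X. regular_vec_on ns (rank F) (U \<inter> nbhd F x) (s x)"
    and 2: "\<forall>x\<in>X. \<forall>y\<in>X. \<forall>P\<in>U \<inter> nbhd F x \<inter> nbhd F y. s x P = vbundle.trans F x y P *\<^sub>v s y P"
    by (rule conjunct1, rule conjunct2)
  show "regular_vec_on ns (rank F) (U \<inter> nbhd F x) (s x)" using 1 assms(2) by (rule bspec)
  show "y \<in> X \<Longrightarrow> P \<in> U \<Longrightarrow> P \<in> nbhd F x \<Longrightarrow> P \<in> nbhd F y \<Longrightarrow> s x P = vbundle.trans F x y P *\<^sub>v s y P"
    using bspec[OF bspec[OF bspec[OF 2 assms(2)], of y], of P] by blast
qed

lemma component_Phi: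
  assumes s: "s \<in> vb_sections ns (twist ns E t) U" and "x \<in> X" "v \<in> HC" "point_of v \<in> U" "point_of v \<in> nbhd E x" "point_of v \<in> Onb x" "i < rk"
  shows "component x (Phi t s) i v = s x (point_of v) $ i * chart_factor t x v"
proof -
  define P where "P = point_of v"
  have P: "P \<in> X" "P \<in> nbhd E P" "P \<in> Onb P" using point_of_in[OF assms(3)] nbhd_self Onb_self unfolding P_def by auto
  have Px: "P \<in> U" "P \<in> nbhd E x" "P \<in> Onb x" using assms by (simp_all add: P_def)
  have "regular_vec_on ns rk (U \<inter> (nbhd E P \<inter> Onb P)) (s P)"
    using vb_sectionsD(1)[OF s P(1)] unfolding twist_simps .
  then have c: "s P P \<in> carrier_vec rk" using P Px unfolding regular_vec_on_def by blast
  have e: "s x P = vbundle.trans (twist ns E t) x P P *\<^sub>v s P P"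
    by (rule vb_sectionsD(2)[OF s assms(2) P(1) Px(1)]) (use Px P in \<open>simp_all add: twist_simps\<close>)
  have "s x P $ i = (\<Sum>l<rk. T x P P i l * (chart_factor t P (hcoord P) / chart_factor t x (hcoord P)) * s P P $ l)"
    unfolding e by (rule twist_trans_mult[OF assms(2) P(1) Px(2) P(2) Px(3) P(3) c assms(7)])
  also have "chart_factor t P (hcoord P) / chart_factor t x (hcoord P) = chart_factor t P v / chart_factor t x v"
    unfolding P_def by (rule chart_factor_hcoord_quot) (use assms P P_def in auto)
  finally have "s x P $ i * chart_factor t x v = (\<Sum>l<rk. T x P P i l * (s P P $ l * chart_factor t P v))"
    using chart_factor_nz[OF assms(3,6), of t] by (simp add: mult_ac flip: sum_divide_distrib)
  then show ?thesis by (simp add: component_def Phi_def P_def)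
qed

lemma Phi_sec:
  assumes s: "s \<in> vb_sections ns (twist ns E t) U"
  shows "Phi t s \<in> sec t U"
  unfolding sec_def
proof (intro CollectI ballI)
  fix p assume "p \<in> cone U"
  then have p: "p \<in> HC" "point_of p \<in> U" by (auto dest: coneD)
  define x where "x = point_of p"
  have x: "x \<in> X" "x \<in> nbhd E x" "x \<in> Onb x" using point_of_in[OF p(1)] nbhd_self Onb_self unfolding x_def by auto
  let ?U = "U \<inter> (nbhd E x \<inter> Onb x)"
  show "Reg t (Phi t s) p"
  proof (rule RegI[OF x(1) p(1)])
    show "point_of p \<in> nbhd E x" using x x_def by simp
    fix i assume i: "i < rk"
    have "regular_on ns ?U (\<lambda>P. s x P $ i)"
      using vb_sectionsD(1)[OF s x(1)] i unfolding regular_vec_on_def twist_simps by blast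
    from regular_on_regular_at[OF this p(1)] have 1: "regular_at (\<lambda>_. 0) (cone ?U) p (\<lambda>v. s x (point_of v) $ i)"
      using p x x_def by simp
    have "regular_at (\<lambda>j. 0 + t j) (cone ?U \<inter> HC) p (\<lambda>v. s x (point_of v) $ i * chart_factor t x v)"
      by (rule regular_at_mult[OF 1 regular_at_chart_factor]) (use x p x_def in auto)
    then have "regular_at t (cone ?U \<inter> HC) p (\<lambda>v. s x (point_of v) $ i * chart_factor t x v)" by simp
    then show "regular_at t (cone ?U \<inter> HC) p (component x (Phi t s) i)"
      by (rule regular_at_cong) (use component_Phi[OF s x(1)] i in \<open>auto simp: cone_def\<close>)
  qed
qed

lemma Psi_sec:
  assumes U: "openin (zariski ns) U" and \<sigma>: "\<sigma> \<in> sec t U"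
  shows "Psi t \<sigma> \<in> vb_sections ns (twist ns E t) U"
  unfolding vb_sections_def
proof (intro CollectI conjI ballI)
  fix x assume x: "x \<in> X"
  show "regular_vec_on ns (rank (twist ns E t)) (U \<inter> nbhd (twist ns E t) x) (Psi t \<sigma> x)"
    unfolding twist_simps regular_vec_on_def
  proof (intro conjI ballI allI impI)
    fix i assume i: "i < rk"
    let ?\<rho> = "\<lambda>v. component x \<sigma> i v / chart_factor t x v"
    let ?U = "U \<inter> (nbhd E x \<inter> Onb x)"
    have "regular_on ns ?U (\<lambda>P. ?\<rho> (hcoord P))"
    proof (rule regular_at_regular_on)
      show "?U \<subseteq> X" using nbhd_X[OF x] by auto
      fix p assume p: "p \<in> HC" "point_of p \<in> ?U"
      then have "Reg t \<sigma> p" using \<sigma> unfolding sec_def cone_def by auto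
      then have "regular_at t (cone (nbhd E x)) p (component x \<sigma> i)" by (rule RegD) (use x p i in auto)
      from regular_at_mult[OF this regular_at_inv_chart_factor[OF x p(1), of t]] p(2)
      have "regular_at (\<lambda>_. 0) (cone (nbhd E x) \<inter> cone (Onb x)) p ?\<rho>" by (simp add: divide_inverse)
      from regular_at_restrict[OF this nbh_open[OF U p(1)]] p(2)
      have "regular_at (\<lambda>_. 0) (cone (nbhd E x) \<inter> cone (Onb x) \<inter> cone U) p ?\<rho>" by simp
      then show "regular_at (\<lambda>_. 0) (cone ?U) p ?\<rho>" by (rule regular_at_mono) (auto simp: cone_def)
    qed
    then show "regular_on ns ?U (\<lambda>P. Psi t \<sigma> x P $ i)" using i by (simp add: Psi_def)
  qed (simp add: Psi_def)
next
  fix x y P assume x: "x \<in> X" and y: "y \<in> X" and P0: "P \<in> U \<inter> nbhd (twist ns E t) x \<inter> nbhd (twist ns E t) y"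
  then have P: "P \<in> U" "P \<in> nbhd E x" "P \<in> Onb x" "P \<in> nbhd E y" "P \<in> Onb y" by (auto simp: twist_simps)
  have PX: "P \<in> X" using nbhd_X[OF x] P by auto
  define v where "v = hcoord P"
  have v: "v \<in> HC" "point_of v = P" using hcoord_HC[OF PX] point_of_hcoord[OF PX] by (auto simp: v_def)
  have nz: "chart_factor t x v \<noteq> 0" "chart_factor t y v \<noteq> 0" using chart_factor_nz v P by auto
  have c: "Psi t \<sigma> y P \<in> carrier_vec rk" by (simp add: Psi_def)
  have dim: "dim_vec (vbundle.trans (twist ns E t) x y P *\<^sub>v Psi t \<sigma> y P) = rk"
    using trans_carrier[OF x y P(2,4)] by (simp add: twist_simps kronecker_mat_def)
  show "Psi t \<sigma> x P = vbundle.trans (twist ns E t) x y P *\<^sub>v Psi t \<sigma> y P"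
  proof (rule eq_vecI)
    fix i assume "i < dim_vec (vbundle.trans (twist ns E t) x y P *\<^sub>v Psi t \<sigma> y P)"
    then have i: "i < rk" using dim by simp
    have "(vbundle.trans (twist ns E t) x y P *\<^sub>v Psi t \<sigma> y P) $ i
        = (\<Sum>l<rk. T x y P i l * (chart_factor t y v / chart_factor t x v) * (component y \<sigma> l v / chart_factor t y v))"
      unfolding twist_trans_mult[OF x y P(2,4,3,5) c i] by (simp add: Psi_def v_def)
    also have "\<dots> = (\<Sum>l<rk. T x y P i l * component y \<sigma> l v) / chart_factor t x v"
      using nz by (simp add: sum_divide_distrib)
    also have "(\<Sum>l<rk. T x y P i l * component y \<sigma> l v) = component x \<sigma> i v"
      using component_change[OF y x v(1), of i \<sigma>] v P i by simp
    finally show "Psi t \<sigma> x P $ i = (vbundle.trans (twist ns E t) x y P *\<^sub>v Psi t \<sigma> y P) $ i"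
      using i by (simp add: Psi_def v_def)
  qed (use dim in \<open>simp add: Psi_def\<close>)
qed

text \<open>Makes the representative chosen by \<open>hcoord\<close> in \<open>Psi\<close> harmless:
  components divided by the local generator have degree 0.\<close>

lemma regular_at_scale_zero:
  assumes "regular_at (\<lambda>_. 0) N p \<rho>" "p \<in> HC" "(p, w) \<in> proportional ns"
  shows "\<rho> w = \<rho> p"
proof -
  obtain a b g h where *: "hpoly a g" "hpoly b h" "\<And>j. j < r \<Longrightarrow> int (a j) - int (b j) = 0" "h p \<noteq> 0"
    "\<And>v. v \<in> HC \<Longrightarrow> h v \<noteq> 0 \<Longrightarrow> v \<in> N" "\<And>v. v \<in> HC \<Longrightarrow> h v \<noteq> 0 \<Longrightarrow> \<rho> v = g v / h v"
    using assms(1) by (rule regE) (rule that)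
  have h: "hpoly a h" using hpoly_deg[OF *(2)] *(3) by fastforce
  have "w \<in> HC" "h w \<noteq> 0" using hpoly_nz[OF h assms(3)] *(4) assms(3) by (auto simp: proportional_def)
  then show ?thesis using *(6)[of w] *(6)[OF assms(2) *(4)] hpoly_quot[OF *(1) h assms(3)] by simp
qed

lemma Phi_Psi:
  assumes "\<sigma> \<in> sec t U" "v \<in> cone U" "l < rk"
  shows "Phi t (Psi t \<sigma>) (v, l) = \<sigma> (v, l)"
proof -
  define P where "P = point_of v"
  have v: "v \<in> HC" "point_of v \<in> U" using assms(2) by (auto dest: coneD)
  have P: "P \<in> X" "P \<in> nbhd E P" "P \<in> Onb P" using point_of_in[OF v(1)] nbhd_self Onb_self unfolding P_def by auto
  have "Reg t \<sigma> v" using assms(1,2) by (simp add: sec_def)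
  then have "regular_at t (cone (nbhd E P)) v (component P \<sigma> l)" using assms(3) by (simp add: Reg_def P_def)
  from regular_at_mult[OF this regular_at_inv_chart_factor[OF P(1) v(1), of t]] P
  have "regular_at (\<lambda>_. 0) (cone (nbhd E P) \<inter> cone (Onb P)) v (\<lambda>v. component P \<sigma> l v / chart_factor t P v)"
    by (simp add: divide_inverse P_def)
  from regular_at_scale_zero[OF this v(1) hcoord_point_of[OF v(1)]]
  have "component P \<sigma> l (hcoord P) / chart_factor t P (hcoord P) = component P \<sigma> l v / chart_factor t P v" by (simp add: P_def)
  then have "Phi t (Psi t \<sigma>) (v, l) = component P \<sigma> l v"
    using assms(3) chart_factor_nz[OF v(1), of P t] P unfolding P_def by (simp add: Phi_def Psi_def)
  then show ?thesis using component_self[OF v(1) assms(3)] by (simp add: P_def)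
qed

lemma H0_zero:
  assumes "H0_vanishes ns (twist ns E t)" "\<sigma> \<in> sec t X" "q \<in> pl X"
  shows "\<sigma> q = 0"
proof -
  obtain v l where q: "q = (v, l)" "v \<in> cone X" "l < rk" using assms(3) by (auto simp: pl_def)
  define P where "P = point_of v"
  have v: "v \<in> HC" using q by (auto dest: coneD)
  have P: "P \<in> X" "P \<in> nbhd E P" "P \<in> Onb P" using point_of_in[OF v] nbhd_self Onb_self unfolding P_def by auto
  have "section_eq ns (twist ns E t) X (Psi t \<sigma>) (zero_section (twist ns E t))"
    using assms(1) Psi_sec[OF openin_mproj assms(2)] unfolding H0_vanishes_def by blast
  then have "Psi t \<sigma> P P = 0\<^sub>v rk" using P unfolding section_eq_def zero_section_def twist_simps by blast
  then have "Phi t (Psi t \<sigma>) (v, l) = 0" using q(3) by (simp add: Phi_def P_def)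
  then show ?thesis using Phi_Psi[OF assms(2) q(2,3)] q(1) by simp
qed

section \<open>From the vanishing of cohomology to the abstract vanishing \<open>van\<close>\<close>

lemma component_alt_sum: "component x (\<lambda>q. alt_sum (\<lambda>\<rho>. c \<rho> q) \<sigma>) i v = alt_sum (\<lambda>\<rho>. component x (c \<rho>) i v) \<sigma>"
  unfolding component_def alt_sum_sum alt_sum_cmult ..

lemma cech_diff_nth:
  "l < rk \<Longrightarrow> cech_diff (twist ns E t) c \<sigma> x P $ l = alt_sum (\<lambda>\<rho>. c \<rho> x P $ l) \<sigma>"
  by (simp add: cech_diff_def twist_simps alt_sum_conv_sum)

lemma open_Inter: "set \<sigma> \<subseteq> U \<Longrightarrow> \<sigma> \<noteq> [] \<Longrightarrow> GS.cover U \<Longrightarrow> openin (zariski ns) (\<Inter>(set \<sigma>))"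
  by (rule openin_Inter) (auto simp: GS.cover_def)

text \<open>\<open>Psi\<close> carries the cocycle to the twisted bundle and \<open>Phi\<close>
  carries the primitive back. As \<open>Phi\<close> undoes \<open>Psi\<close>, the result bounds the
  original cochain. The index grows by one since lengths are counted instead of degrees.\<close>

lemma van_from_cohomology:
  assumes H: "cohomology_vanishes ns (twist ns E t) i"
  shows "GS.van t (Suc i)"
  unfolding GS.van_def
proof (intro allI impI)
  fix U c assume U: "GS.cover U" and c: "c \<in> GS.cochains U (Suc i) t" and cy: "GS.cocycle U (Suc i) c"
  let ?F = "twist ns E t"
  have oc: "open_cover ns U" using U by (simp add: open_cover_def GS.cover_def)
  define c' where "c' \<sigma> = Psi t (c \<sigma>)" for \<sigma>
  have simplices: "cech_simplices U m = GS.simplices U (Suc m)" for U m by (simp add: cech_simplices_def GS.simplices_def)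
  have csec: "c \<sigma> \<in> sec t (\<Inter>(set \<sigma>))" "openin (zariski ns) (\<Inter>(set \<sigma>))" if s: "\<sigma> \<in> GS.simplices U (Suc i)" for \<sigma>
  proof -
    have ne: "\<sigma> \<noteq> []" "set \<sigma> \<subseteq> U" using s by (auto simp: GS.simplices_def)
    show "c \<sigma> \<in> sec t (\<Inter>(set \<sigma>))" using GS.cochD[OF c s] ne by simp
    show "openin (zariski ns) (\<Inter>(set \<sigma>))" using open_Inter[OF ne(2,1) U] .
  qed
  have "c' \<in> cech_cocycles ns ?F U i"
    unfolding cech_cocycles_def cech_cochains_def cochain_eq_def section_eq_def
  proof (intro CollectI conjI ballI)
    fix \<sigma> assume "\<sigma> \<in> cech_simplices U i"
    then show "c' \<sigma> \<in> vb_sections ns ?F (\<Inter>(set \<sigma>))"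
      unfolding c'_def using csec Psi_sec simplices by auto
  next
    fix \<sigma> x P assume s: "\<sigma> \<in> cech_simplices U (Suc i)" and x: "x \<in> X" and P: "P \<in> \<Inter>(set \<sigma>) \<inter> nbhd ?F x"
    have PX: "P \<in> X" using P nbhd_X[OF x] by (auto simp: twist_simps)
    have z: "alt_sum (\<lambda>\<rho>. c \<rho> (hcoord P, l)) \<sigma> = 0" if "l < rk" for l
    proof -
      have "(hcoord P, l) \<in> pl (\<Inter>(set \<sigma>))"
        using P PX that hcoord_HC point_of_hcoord by (auto simp: pl_def cone_def)
      then show ?thesis using cy s unfolding GS.cocycle_def simplices by blast
    qed
    show "cech_diff ?F c' \<sigma> x P = zero_section ?F x P"
    proof (rule eq_vecI)
      fix l assume "l < dim_vec (zero_section ?F x P)"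
      then have l: "l < rk" by (simp add: zero_section_def twist_simps)
      have "cech_diff ?F c' \<sigma> x P $ l = alt_sum (\<lambda>\<rho>. inverse (chart_factor t x (hcoord P)) * component x (c \<rho>) l (hcoord P)) \<sigma>"
        unfolding cech_diff_nth[OF l] using l by (simp add: c'_def Psi_def field_simps)
      also have "\<dots> = inverse (chart_factor t x (hcoord P)) * component x (\<lambda>q. alt_sum (\<lambda>\<rho>. c \<rho> q) \<sigma>) l (hcoord P)"
        unfolding alt_sum_cmult component_alt_sum ..
      also have "component x (\<lambda>q. alt_sum (\<lambda>\<rho>. c \<rho> q) \<sigma>) l (hcoord P) = 0" unfolding component_def using z by simp
      finally show "cech_diff ?F c' \<sigma> x P $ l = zero_section ?F x P $ l"
        using l by (simp add: zero_section_def twist_simps)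
    qed (simp add: cech_diff_def zero_section_def)
  qed
  with H oc obtain V \<tau> where V: "open_cover ns V" "refinement_map V U \<tau>"
    and cb: "(\<lambda>\<sigma>. c' (map \<tau> \<sigma>)) \<in> cech_coboundaries ns ?F V i"
    unfolding cohomology_vanishes_def by blast
  have V': "GS.cover V" "GS.refines V U \<tau>"
    using V by (simp_all add: open_cover_def GS.cover_def refinement_map_def GS.refines_def)
  have val: "c (map \<tau> \<sigma>) (v, l) = Phi t (c' (map \<tau> \<sigma>)) (v, l)"
    if s: "\<sigma> \<in> GS.simplices V (Suc i)" "(v, l) \<in> pl (\<Inter>(set \<sigma>))" for \<sigma> v l
  proof -
    have s': "map \<tau> \<sigma> \<in> GS.simplices U (Suc i)" "(v, l) \<in> pl (\<Inter>(set (map \<tau> \<sigma>)))"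
      using GS.refines_simplices(1,3)[OF V'(2) s(1)] s(2) by auto
    show ?thesis unfolding c'_def
      by (rule Phi_Psi[OF csec(1)[OF s'(1)], symmetric]) (use s'(2) in \<open>auto simp: pl_def\<close>)
  qed
  have self: "point_of v \<in> \<Inter>(set \<sigma>) \<inter> nbhd ?F (point_of v)" "point_of v \<in> X" "l < rk" if "(v, l) \<in> pl (\<Inter>(set \<sigma>))" for v l and \<sigma> :: "point set list"
    using that point_of_in nbhd_self Onb_self by (auto simp: pl_def cone_def twist_simps)
  show "\<exists>V \<tau> b. GS.cover V \<and> GS.refines V U \<tau> \<and> b \<in> GS.cochains V (Suc i - 1) t \<and> GS.bounds V (Suc i) b (\<lambda>\<sigma>. c (map \<tau> \<sigma>))"
  proof (cases i)
    \<comment> \<open>In degree 0 a coboundary is a cochain that is zero on the refinement, which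
      matches the zero primitive on the empty simplex.\<close>
    case 0
    have "GS.bounds V (Suc i) (\<lambda>_ _. 0) (\<lambda>\<sigma>. c (map \<tau> \<sigma>))"
      unfolding GS.bounds_def
    proof (intro ballI)
      fix \<sigma> q assume s: "\<sigma> \<in> GS.simplices V (Suc i)" "q \<in> pl (\<Inter>(set \<sigma>))"
      obtain v l where q: "q = (v, l)" by (cases q)
      note sf = self[OF s(2)[unfolded q]]
      have "cochain_eq ns ?F V 0 (\<lambda>\<sigma>. c' (map \<tau> \<sigma>)) (\<lambda>_. zero_section ?F)"
        using cb unfolding cech_coboundaries_def 0 by simp
      then have "c' (map \<tau> \<sigma>) (point_of v) (point_of v) = 0\<^sub>v rk"
        using s(1) sf(1,2) unfolding cochain_eq_def section_eq_def simplices zero_section_def 0 twist_simps(1) by blast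
      then show "c (map \<tau> \<sigma>) q = alt_sum (\<lambda>\<rho>. 0) \<sigma>"
        using val[OF s[unfolded q]] sf(3) by (simp add: Phi_def q)
    qed
    from GS.vanI_witness[OF V' GS.cochains_zero this] show ?thesis .
  next
    case (Suc j)
    then obtain b where b: "b \<in> cech_cochains ns ?F V j" "cochain_eq ns ?F V i (\<lambda>\<sigma>. c' (map \<tau> \<sigma>)) (cech_diff ?F b)"
      using cb unfolding cech_coboundaries_def by auto
    define b' where "b' \<sigma> = Phi t (b \<sigma>)" for \<sigma>
    have "b' \<in> GS.cochains V (Suc i - 1) t"
    proof (rule GS.cochI)
      fix \<sigma> assume s: "\<sigma> \<in> GS.simplices V (Suc i - 1)"
      then have "\<sigma> \<noteq> []" using Suc by (auto simp: GS.simplices_def)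
      moreover have "b \<sigma> \<in> vb_sections ns ?F (\<Inter>(set \<sigma>))" using b(1) s Suc simplices unfolding cech_cochains_def by auto
      ultimately show "if \<sigma> = [] then \<forall>q. b' \<sigma> q = 0 else b' \<sigma> \<in> sec t (\<Inter>(set \<sigma>))"
        unfolding b'_def using Phi_sec by simp
    qed
    moreover have "GS.bounds V (Suc i) b' (\<lambda>\<sigma>. c (map \<tau> \<sigma>))"
      unfolding GS.bounds_def
    proof (intro ballI)
      fix \<sigma> q assume s: "\<sigma> \<in> GS.simplices V (Suc i)" "q \<in> pl (\<Inter>(set \<sigma>))"
      obtain v l where q: "q = (v, l)" by (cases q)
      note sf = self[OF s(2)[unfolded q]]
      have "c' (map \<tau> \<sigma>) (point_of v) (point_of v) = cech_diff ?F b \<sigma> (point_of v) (point_of v)"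
        using b(2) s(1) sf(1,2) unfolding cochain_eq_def section_eq_def simplices by blast
      then have "c (map \<tau> \<sigma>) q = chart_factor t (point_of v) v * alt_sum (\<lambda>\<rho>. b \<rho> (point_of v) (point_of v) $ l) \<sigma>"
        using val[OF s[unfolded q]] cech_diff_nth[OF sf(3)] by (simp add: Phi_def q)
      also have "\<dots> = alt_sum (\<lambda>\<rho>. b' \<rho> q) \<sigma>"
        unfolding alt_sum_cmult[symmetric] b'_def Phi_def q by (simp add: mult.commute)
      finally show "c (map \<tau> \<sigma>) q = alt_sum (\<lambda>\<rho>. b' \<rho> q) \<sigma>" .
    qed
    ultimately show ?thesis by (rule GS.vanI_witness[OF V'])
  qed
qed

text \<open>A cocycle of length 1 is a family of agreeing local sections. It glues to a global
  section of the twist, which is zero, so the given cover serves unrefined.\<close>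

lemma van_from_H0:
  assumes H: "H0_vanishes ns (twist ns E t)"
  shows "GS.van t 1"
  unfolding GS.van_def
proof (intro allI impI)
  fix U c assume U: "GS.cover U" and c: "c \<in> GS.cochains U 1 t" and cy: "GS.cocycle U 1 c"
  have cs: "c [u] \<in> sec t u" if "u \<in> U" for u
    using GS.cochD[OF c, of "[u]"] that by (simp add: GS.simplices_def)
  have agree: "c [u] q = c [w] q" if "u \<in> U" "w \<in> U" "q \<in> pl u" "q \<in> pl w" for u w q
  proof -
    have "q \<in> pl (\<Inter>(set [u, w]))" using that by (auto simp: pl_def cone_def)
    moreover have "[u, w] \<in> GS.simplices U (Suc 1)" using that by (simp add: GS.simplices_def)
    ultimately have "alt_sum (\<lambda>\<rho>. c \<rho> q) [u, w] = 0" using cy unfolding GS.cocycle_def by blast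
    then show ?thesis by simp
  qed
  \<comment> \<open>By \<open>agree\<close> the choice of the member of the cover does not influence
    the value.\<close>
  define \<sigma> where "\<sigma> q = c [SOME u. u \<in> U \<and> q \<in> pl u] q" for q
  have \<sigma>: "\<sigma> q = c [u] q" if "u \<in> U" "q \<in> pl u" for u q
    using someI[of "\<lambda>u. u \<in> U \<and> q \<in> pl u" u] that agree unfolding \<sigma>_def by blast
  have "\<sigma> \<in> sec t X"
    unfolding sec_def
  proof (intro CollectI ballI)
    fix p assume p: "p \<in> cone X"
    then obtain u where u: "u \<in> U" "point_of p \<in> u" using U unfolding GS.cover_def cone_def by blast
    have pH: "p \<in> HC" using p by (rule coneD)
    have "Reg t (c [u]) p" using cs[OF u(1)] u(2) pH unfolding sec_def cone_def by simp
    then show "Reg t \<sigma> p"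
    proof (rule Reg_cong[OF _ pH])
      show "nbh (cone u) p" by (rule nbh_open[OF _ pH u(2)]) (use U u in \<open>simp add: GS.cover_def\<close>)
      show "c [u] (v, l) = \<sigma> (v, l)" if "v \<in> cone u" "l < rk" for v l
        using \<sigma>[OF u(1), of "(v, l)"] that by (simp add: pl_def)
    qed
  qed
  then have z: "\<sigma> q = 0" if "q \<in> pl X" for q using H0_zero[OF H _ that] by simp
  have "GS.bounds U 1 (\<lambda>_ _. 0) (\<lambda>\<sigma>. c (map (\<lambda>u. u) \<sigma>))"
    unfolding GS.bounds_def
  proof (intro ballI)
    fix s q assume s: "s \<in> GS.simplices U 1" "q \<in> pl (\<Inter>(set s))"
    then obtain u where u: "s = [u]" "u \<in> U" by (auto simp: GS.simplices_def length_Suc_conv)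
    then have "q \<in> pl u" "q \<in> pl X" using s(2) U unfolding GS.cover_def by (auto simp: pl_def cone_def)
    then have "c [u] q = 0" using \<sigma>[OF u(2), of q] z[of q] by metis
    then show "c (map (\<lambda>u. u) s) q = alt_sum (\<lambda>\<rho>. 0) s" using u(1) by simp
  qed
  from GS.vanI_witness[OF U GS.refines_id GS.cochains_zero this]
  show "\<exists>V \<tau> b. GS.cover V \<and> GS.refines V U \<tau> \<and> b \<in> GS.cochains V (1 - 1) t \<and> GS.bounds V 1 b (\<lambda>\<sigma>. c (map \<tau> \<sigma>))" .
qed

end

section \<open>The dual functional\<close>

text \<open>A basis of \<open>W\<close> together with \<open>u\<close> is independent, and the
  linear map that is 1 at \<open>u\<close> and 0 on this basis extends to the whole space.\<close>

lemma separating_functional: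
  fixes W :: "('q \<Rightarrow> complex) set"
  assumes W: "(\<lambda>_. 0) \<in> W" "\<And>f g. f \<in> W \<Longrightarrow> g \<in> W \<Longrightarrow> (\<lambda>q. f q + g q) \<in> W" "\<And>c f. f \<in> W \<Longrightarrow> (\<lambda>q. c * f q) \<in> W"
    and u: "u \<notin> W"
  obtains \<phi> :: "('q \<Rightarrow> complex) \<Rightarrow> complex"
  where "\<And>f g. \<phi> (\<lambda>q. f q + g q) = \<phi> f + \<phi> g" "\<And>c f. \<phi> (\<lambda>q. c * f q) = c * \<phi> f"
    "\<And>f. f \<in> W \<Longrightarrow> \<phi> f = 0" "\<phi> u = 1"
proof -
  define sc where "sc c f = (\<lambda>q. c * f q)" for c :: complex and f :: "'q \<Rightarrow> complex"
  interpret V: vector_space sc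
    by unfold_locales (auto simp: sc_def fun_eq_iff algebra_simps)
  interpret C: vector_space "(*) :: complex \<Rightarrow> complex \<Rightarrow> complex"
    by unfold_locales (auto simp: algebra_simps)
  interpret P: vector_space_pair sc "(*) :: complex \<Rightarrow> complex \<Rightarrow> complex" ..
  have sub: "V.subspace W"
    unfolding V.subspace_def using W by (auto simp: sc_def zero_fun_def plus_fun_def)
  obtain B where B: "B \<subseteq> W" "V.independent B" "W \<subseteq> V.span B" by (rule V.maximal_independent_subset)
  have spanB: "V.span B = W" using B sub by (metis V.span_minimal subset_antisym)
  have "V.independent (insert u B)" using B(2) u spanB by (intro V.independent_insertI) auto
  then obtain \<phi> where \<phi>: "Vector_Spaces.linear sc (*) \<phi>" "\<forall>x\<in>insert u B. \<phi> x = (if x = u then 1 else 0)"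
    using P.linear_independent_extend[of "insert u B" "\<lambda>x. if x = u then 1 else 0"] by blast
  interpret L: Vector_Spaces.linear sc "(*)" \<phi> by (rule \<phi>(1))
  show ?thesis
  proof (rule that[of \<phi>])
    show "\<phi> (\<lambda>q. f q + g q) = \<phi> f + \<phi> g" for f g using L.add[of f g] by (simp add: plus_fun_def)
    show "\<phi> (\<lambda>q. c * f q) = c * \<phi> f" for c f using L.scale[of c f] by (simp add: sc_def)
    show "\<phi> u = 1" using \<phi>(2) by simp
    fix f assume "f \<in> W"
    then have "f \<in> V.span B" using spanB by simp
    moreover have "\<phi> b = 0" if "b \<in> B" for b using \<phi>(2) that B(1) u by auto
    ultimately show "\<phi> f = 0" by (rule L.eq_0_on_span[rotated])
  qed
qed

context multiproj
begin

section \<open>Laurent monomials\<close>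

definition laurent :: "(nat \<times> nat \<Rightarrow> int) \<Rightarrow> coords \<Rightarrow> complex" where
  "laurent n v = (\<Prod>i\<in>coord_index ns. v i powi n i)"

definition exponents :: "(nat \<Rightarrow> nat) \<Rightarrow> (nat \<times> nat \<Rightarrow> nat) set" where
  "exponents a = {m. (\<forall>i. i \<notin> coord_index ns \<longrightarrow> m i = 0) \<and> (\<forall>j<r. (\<Sum>k\<le>ns ! j. m (j, k)) = a j)}"

definition monom_val :: "(nat \<times> nat \<Rightarrow> nat) \<Rightarrow> coords \<Rightarrow> complex" where
  "monom_val m v = (\<Prod>i\<in>coord_index ns. v i ^ m i)"

lemma finite_exponents: "finite (exponents a)"
proof -
  have "exponents a \<subseteq> {m. \<forall>i. (i \<in> coord_index ns \<longrightarrow> m i \<in> {..(\<Sum>j<r. a j)}) \<and> (i \<notin> coord_index ns \<longrightarrow> m i = 0)}"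
  proof (intro subsetI CollectI allI conjI impI)
    fix m i assume m: "m \<in> exponents a"
    show "i \<notin> coord_index ns \<Longrightarrow> m i = 0" using m unfolding exponents_def by blast
    assume i: "i \<in> coord_index ns"
    obtain j k where jk: "i = (j, k)" by (cases i)
    then have j: "j < r" "k \<le> ns ! j" using i by (auto simp: coord_index_def)
    have "m (j, k) \<le> (\<Sum>k\<le>ns ! j. m (j, k))" by (rule member_le_sum) (use j in auto)
    also have "\<dots> = a j" using m j by (simp add: exponents_def)
    also have "a j \<le> (\<Sum>j<r. a j)" by (rule member_le_sum) (use j in auto)
    finally show "m i \<in> {..(\<Sum>j<r. a j)}" using jk by simp
  qed
  then show ?thesis by (rule finite_subset) (rule finite_set_of_finite_funs, use finite_CI in auto)
qed

lemma monom_val_add: "monom_val (\<lambda>i. m i + n i) v = monom_val m v * monom_val n v"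
  by (simp add: monom_val_def power_add prod.distrib)

lemma sum_CI_delta: "j < r \<Longrightarrow> (\<Sum>i\<in>coord_index ns. f i * (if j = fst i then 1 else 0)) = (\<Sum>k\<le>ns ! j. f (j, k))"
  for f :: "nat \<times> nat \<Rightarrow> 'a::semiring_1"
proof -
  assume j: "j < r"
  have "(\<Sum>i\<in>coord_index ns. f i * (if j = fst i then 1 else 0)) = (\<Sum>j'<r. if j' = j then (\<Sum>k\<le>ns ! j. f (j, k)) else 0)"
    unfolding sum_CI by (rule sum.cong) auto
  then show ?thesis using j by simp
qed

lemma hpoly_monom_val: "m \<in> exponents a \<Longrightarrow> hpoly a (monom_val m)"
proof -
  assume m: "m \<in> exponents a"
  have "hpoly (\<lambda>j. \<Sum>i\<in>coord_index ns. m i * (if j = fst i then 1 else 0)) (monom_val m)"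
    unfolding monom_val_def[abs_def]
  proof (rule hpoly_prod)
    fix i assume "i \<in> coord_index ns"
    then have "hpoly (\<lambda>j. if j = fst i then 1 else 0) (\<lambda>v. v (fst i, snd i))" by (intro hpoly_X) (auto simp: coord_index_def)
    from hpoly_power[OF this, of "m i"]
    show "hpoly (\<lambda>j. m i * (if j = fst i then 1 else 0)) (\<lambda>v. v i ^ m i)" by simp
  qed
  then show ?thesis by (rule hpoly_deg) (use m sum_CI_delta[of _ m] in \<open>auto simp: exponents_def\<close>)
qed

lemma hpoly_expand:
  assumes "hpoly b p"
  obtains K c m where "finite (K :: ((nat \<times> nat) \<Rightarrow>\<^sub>0 nat) set)" "\<And>k. k \<in> K \<Longrightarrow> m k \<in> exponents b" "\<And>v. p v = (\<Sum>k\<in>K. c k * monom_val (m k) v)"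
proof -
  obtain f where f: "multihomogeneous ns b f" "p = mpoly_eval f" using assms unfolding hpoly_def by blast
  show ?thesis
  proof (rule that[of "Poly_Mapping.keys f" Poly_Mapping.lookup "Poly_Mapping.lookup f"])
    show "finite (Poly_Mapping.keys f)" by simp
    have g: "good b k" if "k \<in> Poly_Mapping.keys f" for k using f(1) that multihom_iff by blast
    show "Poly_Mapping.lookup k \<in> exponents b" if "k \<in> Poly_Mapping.keys f" for k
      using g[OF that] unfolding good_def exponents_def by (auto simp: in_keys_iff subset_iff)
    have "mono_eval k v = monom_val (Poly_Mapping.lookup k) v" if "k \<in> Poly_Mapping.keys f" for k v
      unfolding monom_val_def by (rule mono_eval_superset[OF finite_CI]) (use g[OF that] in \<open>simp add: good_def\<close>)
    then show "p v = (\<Sum>k\<in>Poly_Mapping.keys f. Poly_Mapping.lookup f k * monom_val (Poly_Mapping.lookup k) v)" for v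
      by (simp add: f(2) mpoly_eval_alt)
  qed
qed

end

context vbun
begin

definition Uall where "Uall = GS.Uall"

lemma cone_Uall: "v \<in> cone Uall \<Longrightarrow> i \<in> coord_index ns \<Longrightarrow> v i \<noteq> 0"
proof -
  assume v: "v \<in> cone Uall" "i \<in> coord_index ns"
  then have "v \<in> cone (Dc (fst i) (snd i))" by (auto simp: cone_def Uall_def GS.Uall_def coord_index_def)
  then show "v i \<noteq> 0" by (simp add: cone_Dc)
qed

lemma laurent_add: "v \<in> cone Uall \<Longrightarrow> laurent (\<lambda>i. m i + n i) v = laurent m v * laurent n v"
  unfolding laurent_def prod.distrib[symmetric] by (rule prod.cong) (auto simp: power_int_add cone_Uall)

lemma monom_val_laurent: "monom_val m v = laurent (\<lambda>i. int (m i)) v"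
  by (simp add: monom_val_def laurent_def)

lemma sec_laurent:
  assumes e: "e \<in> sec t U" and n: "\<And>i. i \<in> coord_index ns \<Longrightarrow> n i < 0 \<Longrightarrow> U \<subseteq> Dc (fst i) (snd i)"
    and t': "\<And>j. j < r \<Longrightarrow> t' j = t j + (\<Sum>k\<le>ns ! j. n (j, k))"
  shows "(\<lambda>q. laurent n (fst q) * e q) \<in> sec t' U"
  unfolding sec_def
proof (intro CollectI ballI)
  fix p assume p: "p \<in> cone U"
  have pH: "p \<in> HC" using p by (rule coneD)
  have "regular_at (\<lambda>j. \<Sum>i\<in>coord_index ns. n i * int (if j = fst i then 1 else 0)) HC p (laurent n)"
    unfolding laurent_def[abs_def]
  proof (rule regular_at_prod[OF pH])
    fix i assume i: "i \<in> coord_index ns"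
    have "hpoly (\<lambda>j. if j = fst i then 1 else 0) (\<lambda>v. v (fst i, snd i))" by (rule hpoly_X) (use i in \<open>auto simp: coord_index_def\<close>)
    then have h: "hpoly (\<lambda>j. if j = fst i then 1 else 0) (\<lambda>v. v i)" by simp
    show "regular_at (\<lambda>j. n i * int (if j = fst i then 1 else 0)) HC p (\<lambda>v. v i powi n i)"
    proof (rule regular_at_powi[OF h])
      assume "n i < 0"
      then have "p \<in> cone (Dc (fst i) (snd i))" using n[OF i] p by (auto simp: cone_def)
      then show "p i \<noteq> 0" by (simp add: cone_Dc)
    qed
  qed
  from Reg_scale[OF _ this, of t e] e p
  have "Reg (\<lambda>j. (\<Sum>i\<in>coord_index ns. n i * int (if j = fst i then 1 else 0)) + t j) (\<lambda>q. laurent n (fst q) * e q) p"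
    by (simp add: sec_def)
  then show "Reg t' (\<lambda>q. laurent n (fst q) * e q) p"
  proof (rule Reg_deg)
    fix j assume j: "j < r"
    have "(\<Sum>i\<in>coord_index ns. n i * int (if j = fst i then 1 else 0)) = (\<Sum>i\<in>coord_index ns. n i * (if j = fst i then 1 else 0))"
      by (rule sum.cong) auto
    then show "(\<Sum>i\<in>coord_index ns. n i * int (if j = fst i then 1 else 0)) + t j = t' j"
      using t'[OF j] sum_CI_delta[OF j, of n] by simp
  qed
qed

text \<open>Functions modulo this space play the role of H^d(X, E tensor \<omega>). Membership looks
  only at places where all coordinates are nonzero, so a functional that kills this space depends on
  the values at those places alone.\<close>

definition W :: "(coords \<times> nat \<Rightarrow> complex) set" where
  "W = {f. \<exists>e. (\<forall>j<r. \<forall>k\<le>ns ! j. e j k \<in> sec (GS.canon_deg r) (GS.Uexc j k)) \<and>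
    (\<forall>q\<in>pl Uall. f q = (\<Sum>j<r. \<Sum>k\<le>ns ! j. e j k q))}"

lemma W_zero: "(\<lambda>_. 0) \<in> W"
  unfolding W_def using GS.sec_zero by (intro CollectI exI[of _ "\<lambda>_ _ _. 0"]) auto

lemma W_add: "f \<in> W \<Longrightarrow> g \<in> W \<Longrightarrow> (\<lambda>q. f q + g q) \<in> W"
  unfolding W_def
proof (elim CollectE exE conjE, intro CollectI)
  fix e e' assume "\<forall>j<r. \<forall>k\<le>ns ! j. e j k \<in> sec (GS.canon_deg r) (GS.Uexc j k)" "\<forall>q\<in>pl Uall. f q = (\<Sum>j<r. \<Sum>k\<le>ns ! j. e j k q)"
    "\<forall>j<r. \<forall>k\<le>ns ! j. e' j k \<in> sec (GS.canon_deg r) (GS.Uexc j k)" "\<forall>q\<in>pl Uall. g q = (\<Sum>j<r. \<Sum>k\<le>ns ! j. e' j k q)"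
  then show "\<exists>e. (\<forall>j<r. \<forall>k\<le>ns ! j. e j k \<in> sec (GS.canon_deg r) (GS.Uexc j k)) \<and> (\<forall>q\<in>pl Uall. f q + g q = (\<Sum>j<r. \<Sum>k\<le>ns ! j. e j k q))"
    by (intro exI[of _ "\<lambda>j k q. e j k q + e' j k q"]) (auto simp: sum.distrib intro: GS.sec_add)
qed

lemma W_cmult: "f \<in> W \<Longrightarrow> (\<lambda>q. c * f q) \<in> W"
  unfolding W_def
proof (elim CollectE exE conjE, intro CollectI)
  fix e assume "\<forall>j<r. \<forall>k\<le>ns ! j. e j k \<in> sec (GS.canon_deg r) (GS.Uexc j k)" "\<forall>q\<in>pl Uall. f q = (\<Sum>j<r. \<Sum>k\<le>ns ! j. e j k q)"
  then show "\<exists>e. (\<forall>j<r. \<forall>k\<le>ns ! j. e j k \<in> sec (GS.canon_deg r) (GS.Uexc j k)) \<and> (\<forall>q\<in>pl Uall. c * f q = (\<Sum>j<r. \<Sum>k\<le>ns ! j. e j k q))"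
    by (intro exI[of _ "\<lambda>j k q. c * e j k q"]) (auto simp: sum_distrib_left intro: GS.sec_cmult)
qed

lemma W_single:
  assumes "j < r" "k \<le> ns ! j" "e \<in> sec (GS.canon_deg r) (GS.Uexc j k)" "\<And>q. q \<in> pl Uall \<Longrightarrow> f q = e q"
  shows "f \<in> W"
proof -
  define e' where "e' j' k' = (if j' = j \<and> k' = k then e else (\<lambda>_. 0))" for j' k'
  have "(\<Sum>j<r. \<Sum>k\<le>ns ! j. e' j k q) = e q" for q
  proof -
    have "(\<Sum>j'<r. \<Sum>k'\<le>ns ! j'. e' j' k' q) = (\<Sum>j'<r. if j' = j then e q else 0)"
    proof (rule sum.cong[OF refl])
      fix j'
      have "(\<Sum>k'\<le>ns ! j'. e' j' k' q) = (\<Sum>k'\<le>ns ! j'. if k' = k then (if j' = j then e q else 0) else 0)"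
        by (rule sum.cong) (auto simp: e'_def)
      then show "(\<Sum>k'\<le>ns ! j'. e' j' k' q) = (if j' = j then e q else 0)" using assms(2) by auto
    qed
    then show ?thesis using assms(1) by simp
  qed
  moreover have "e' j' k' \<in> sec (GS.canon_deg r) (GS.Uexc j' k')" for j' k'
    using assms(3) GS.sec_zero by (simp add: e'_def)
  ultimately show ?thesis unfolding W_def using assms(4) by (intro CollectI exI[of _ e']) simp
qed

lemma W_zero_on: "(\<And>q. q \<in> pl Uall \<Longrightarrow> f q = 0) \<Longrightarrow> f \<in> W"
  unfolding W_def using GS.sec_zero by (intro CollectI exI[of _ "\<lambda>_ _ _. 0"]) auto

end

locale dual_functional = vbun +
  fixes \<phi> :: "(coords \<times> nat \<Rightarrow> complex) \<Rightarrow> complex"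
  assumes phi_add: "\<phi> (\<lambda>q. f q + g q) = \<phi> f + \<phi> g" and phi_cmult: "\<phi> (\<lambda>q. c * f q) = c * \<phi> f"
    and phi_W: "f \<in> W \<Longrightarrow> \<phi> f = 0"
begin

lemma phi_cong: "(\<And>q. q \<in> pl Uall \<Longrightarrow> f q = g q) \<Longrightarrow> \<phi> f = \<phi> g"
proof -
  assume eq: "\<And>q. q \<in> pl Uall \<Longrightarrow> f q = g q"
  have "(\<lambda>q. f q + (-1) * g q) \<in> W" by (rule W_zero_on) (use eq in simp)
  then have "\<phi> (\<lambda>q. f q + (-1) * g q) = 0" by (rule phi_W)
  then show ?thesis unfolding phi_add phi_cmult by simp
qed

text \<open>The generating function of the values of \<open>\<phi>\<close> on \<open>e\<close> times Laurent monomials. For a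
  global section, monomials with a negative exponent would not contribute, because \<open>\<phi>\<close> kills
  everything that is regular along some coordinate hyperplane; this makes the map linear over
  polynomials.\<close>

definition dual_map :: "(nat \<Rightarrow> nat) \<Rightarrow> (coords \<times> nat \<Rightarrow> complex) \<Rightarrow> coords \<Rightarrow> complex" where
  "dual_map a e v = (\<Sum>m\<in>exponents a. \<phi> (\<lambda>q. laurent (\<lambda>i. - int (m i) - 1) (fst q) * e q) * monom_val m v)"

lemma hpoly_dual_map: "hpoly a (dual_map a e)"
  unfolding dual_map_def[abs_def] by (intro hpoly_sum hpoly_cmult hpoly_monom_val)

lemma dual_map_cong: "(\<And>q. q \<in> pl Uall \<Longrightarrow> e q = e' q) \<Longrightarrow> dual_map a e v = dual_map a e' v"
  unfolding dual_map_def by (intro sum.cong refl arg_cong2[of _ _ _ _ "(*)"] phi_cong) auto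

lemma dual_map_deg: "(\<And>j. j < r \<Longrightarrow> a j = b j) \<Longrightarrow> dual_map a e v = dual_map b e v"
proof -
  assume "\<And>j. j < r \<Longrightarrow> a j = b j"
  then have "exponents a = exponents b" by (auto simp: exponents_def)
  then show ?thesis by (simp add: dual_map_def)
qed

lemma dual_map_add: "dual_map a (\<lambda>q. e q + e' q) v = dual_map a e v + dual_map a e' v"
  by (simp add: dual_map_def distrib_left phi_add distrib_right sum.distrib)

lemma dual_map_cmult: "dual_map a (\<lambda>q. c * e q) v = c * dual_map a e v"
proof -
  have "\<phi> (\<lambda>q. laurent n (fst q) * (c * e q)) = c * \<phi> (\<lambda>q. laurent n (fst q) * e q)" for n
    using phi_cmult[of c "\<lambda>q. laurent n (fst q) * e q"] by (simp add: mult_ac)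
  then show ?thesis by (simp add: dual_map_def sum_distrib_left mult.assoc)
qed

lemma dual_map_sum: "dual_map a (\<lambda>q. \<Sum>i\<in>I. e i q) v = (\<Sum>i\<in>I. dual_map a (e i) v)"
proof (induction I rule: infinite_finite_induct)
  case (insert i I)
  then show ?case using dual_map_add[of a "e i" "\<lambda>q. \<Sum>i\<in>I. e i q"] by simp
qed (use dual_map_cmult[of a 0 "\<lambda>_. 0"] in simp_all)

text \<open>If m fails to dominate m0 in some coordinate, the exponent m0 - m - 1 is nonnegative
  there, so the product extends over that hyperplane and \<phi> kills it. The remaining exponents
  are m0 plus an exponent of degree a, and reindexing extracts the monomial.\<close>

lemma dual_map_monom_val:
  assumes e: "e \<in> sec (\<lambda>j. int (a j)) X" and m0: "m0 \<in> exponents b"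
  shows "dual_map (\<lambda>j. a j + b j) (\<lambda>q. monom_val m0 (fst q) * e q) v = monom_val m0 v * dual_map a e v"
proof -
  define A where "A m = \<phi> (\<lambda>q. laurent (\<lambda>i. - int (m i) - 1) (fst q) * (monom_val m0 (fst q) * e q))" for m
  define S where "S = {m \<in> exponents (\<lambda>j. a j + b j). \<forall>i. m0 i \<le> m i}"
  have z: "A m = 0" if m: "m \<in> exponents (\<lambda>j. a j + b j) - S" for m
  proof -
    have "\<exists>i. m i < m0 i" using m by (auto simp: S_def not_le)
    then obtain i where i: "m i < m0 i" by blast
    then have iC: "i \<in> coord_index ns" using m0 unfolding exponents_def by (metis (mono_tags, lifting) mem_Collect_eq not_less_zero)
    obtain j k where jk: "i = (j, k)" by (cases i)
    have jk': "j < r" "k \<le> ns ! j" using iC jk by (auto simp: coord_index_def)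
    define n where "n i = int (m0 i) + (- int (m i) - 1)" for i
    have "(\<lambda>q. laurent n (fst q) * e q) \<in> sec (GS.canon_deg r) (GS.Uexc j k)"
    proof (rule sec_laurent[of e "\<lambda>j. int (a j)"])
      show "e \<in> sec (\<lambda>j. int (a j)) (GS.Uexc j k)"
        by (rule GS.sec_mono[OF _ e]) (auto simp: GS.Uexc_def)
      fix i' assume "i' \<in> coord_index ns" "n i' < 0"
      moreover from this have "(fst i', snd i') \<noteq> (j, k)" using i unfolding jk by (auto simp: n_def)
      ultimately show "GS.Uexc j k \<subseteq> Dc (fst i') (snd i')"
        unfolding GS.Uexc_def coord_index_def by (cases i') auto
    next
      fix j' assume j': "j' < r"
      have s: "(\<Sum>k\<le>ns ! j'. int (m0 (j', k))) = int (b j')" "(\<Sum>k\<le>ns ! j'. int (m (j', k))) = int (a j') + int (b j')"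
        using m0 m j' by (simp_all add: exponents_def flip: of_nat_sum of_nat_add)
      \<comment> \<open>The shift by -1 in each of the n_j + 1 coordinates brings the total degree
        from 0 to -n_j - 1, the degree prescribed in \<open>W\<close>.\<close>
      have "(\<Sum>k\<le>ns ! j'. n (j', k)) = int (b j') - (int (a j') + int (b j')) - int (Suc (ns ! j'))"
        unfolding n_def sum.distrib sum_subtractf sum_negf s by simp
      then show "GS.canon_deg r j' = int (a j') + (\<Sum>k\<le>ns ! j'. n (j', k))"
        using j' by (simp add: GS.canon_deg_def)
    qed
    then have "(\<lambda>q. laurent (\<lambda>i. - int (m i) - 1) (fst q) * (monom_val m0 (fst q) * e q)) \<in> W"
      by (rule W_single[OF jk']) (auto simp: pl_def n_def[abs_def] laurent_add monom_val_laurent mult_ac)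
    then show ?thesis unfolding A_def by (rule phi_W)
  qed
  have "dual_map (\<lambda>j. a j + b j) (\<lambda>q. monom_val m0 (fst q) * e q) v = (\<Sum>m\<in>S. A m * monom_val m v)"
    unfolding dual_map_def A_def[symmetric]
    by (rule sum.mono_neutral_right) (use finite_exponents z in \<open>auto simp: S_def\<close>)
  also have "\<dots> = (\<Sum>m\<in>exponents a. A (\<lambda>i. m0 i + m i) * monom_val (\<lambda>i. m0 i + m i) v)"
  proof (rule sum.reindex_bij_witness[of _ "\<lambda>m i. m0 i + m i" "\<lambda>m i. m i - m0 i"])
    fix m assume m: "m \<in> S"
    then show mi: "(\<lambda>i. m0 i + (m i - m0 i)) = m" by (auto simp: S_def)
    have "(\<Sum>k\<le>ns ! j. m (j, k) - m0 (j, k)) = a j" if "j < r" for j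
    proof -
      have "(\<Sum>k\<le>ns ! j. m0 (j, k) + (m (j, k) - m0 (j, k))) = (\<Sum>k\<le>ns ! j. m (j, k))"
        using fun_cong[OF mi] by (intro sum.cong) auto
      then show ?thesis using m m0 that by (simp add: S_def exponents_def sum.distrib)
    qed
    then show "(\<lambda>i. m i - m0 i) \<in> exponents a" using m by (auto simp: S_def exponents_def)
    show "A (\<lambda>i. m0 i + (m i - m0 i)) * monom_val (\<lambda>i. m0 i + (m i - m0 i)) v = A m * monom_val m v" unfolding mi ..
  next
    fix m assume m: "m \<in> exponents a"
    show "(\<lambda>i. m0 i + m i - m0 i) = m" by simp
    show "(\<lambda>i. m0 i + m i) \<in> S" using m m0 by (auto simp: S_def exponents_def sum.distrib)
  qed
  also have "\<dots> = (\<Sum>m\<in>exponents a. monom_val m0 v * (\<phi> (\<lambda>q. laurent (\<lambda>i. - int (m i) - 1) (fst q) * e q) * monom_val m v))"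
  proof (rule sum.cong[OF refl])
    fix m assume "m \<in> exponents a"
    have "A (\<lambda>i. m0 i + m i) = \<phi> (\<lambda>q. laurent (\<lambda>i. - int (m i) - 1) (fst q) * e q)"
      unfolding A_def
    proof (rule phi_cong)
      fix q assume "q \<in> pl Uall"
      then have q: "fst q \<in> cone Uall" by (auto simp: pl_def)
      have "laurent (\<lambda>i. (- int (m0 i + m i) - 1) + int (m0 i)) (fst q) = laurent (\<lambda>i. - int (m0 i + m i) - 1) (fst q) * monom_val m0 (fst q)"
        unfolding monom_val_laurent by (rule laurent_add[OF q])
      then show "laurent (\<lambda>i. - int (m0 i + m i) - 1) (fst q) * (monom_val m0 (fst q) * e q) = laurent (\<lambda>i. - int (m i) - 1) (fst q) * e q"
        by simp
    qed
    then show "A (\<lambda>i. m0 i + m i) * monom_val (\<lambda>i. m0 i + m i) v = monom_val m0 v * (\<phi> (\<lambda>q. laurent (\<lambda>i. - int (m i) - 1) (fst q) * e q) * monom_val m v)"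
      by (simp add: monom_val_add)
  qed
  finally show ?thesis by (simp add: dual_map_def sum_distrib_left)
qed

lemma dual_map_mult:
  assumes e: "e \<in> sec (\<lambda>j. int (a j)) X" and p: "hpoly b p" and c: "\<And>j. j < r \<Longrightarrow> c j = a j + b j"
  shows "dual_map c (\<lambda>q. p (fst q) * e q) v = p v * dual_map a e v"
proof -
  obtain K d m where K: "finite (K :: ((nat \<times> nat) \<Rightarrow>\<^sub>0 nat) set)" "\<And>k. k \<in> K \<Longrightarrow> m k \<in> exponents b" "\<And>v. p v = (\<Sum>k\<in>K. d k * monom_val (m k) v)"
    using p by (rule hpoly_expand) (rule that)
  have "dual_map c (\<lambda>q. p (fst q) * e q) v = dual_map (\<lambda>j. a j + b j) (\<lambda>q. \<Sum>k\<in>K. d k * (monom_val (m k) (fst q) * e q)) v"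
    using c by (subst dual_map_deg[of c "\<lambda>j. a j + b j"]) (simp_all add: K(3) sum_distrib_right mult.assoc)
  also have "\<dots> = (\<Sum>k\<in>K. d k * (monom_val (m k) v * dual_map a e v))"
    unfolding dual_map_sum dual_map_cmult by (intro sum.cong refl arg_cong[of _ _ "(*) _"] dual_map_monom_val e K(2))
  finally show ?thesis by (simp add: K(3) sum_distrib_right mult.assoc)
qed

text \<open>In degree 0 the generating function has a single coefficient, the value of \<phi> on the
  section divided by the product of all coordinates.\<close>

lemma dual_map_zero: "dual_map (\<lambda>_. 0) e v = \<phi> (\<lambda>q. laurent (\<lambda>_. -1) (fst q) * e q)"
proof -
  have "m = (\<lambda>_. 0)" if m: "m \<in> exponents (\<lambda>_. 0)" for m
  proof
    fix i :: "nat \<times> nat"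
    show "m i = 0" using m by (cases i) (auto simp: exponents_def coord_index_def)
  qed
  then have "exponents (\<lambda>_. 0) = {\<lambda>_. 0}" by (auto simp: exponents_def)
  then show ?thesis by (simp add: dual_map_def monom_val_def)
qed

end

section \<open>The bundle map defined by the functional\<close>

context vbun
begin

text \<open>Near every point a power of G clears the denominators of the components, and one more
  factor G makes the product vanish on the zero locus of G, so that the extension by 0 is regular.
  Quasi-compactness gives one exponent for all points.\<close>

lemma extend_by_power:
  assumes G: "hpoly \<gamma> G" and \<sigma>: "\<And>p. p \<in> HC \<Longrightarrow> G p \<noteq> 0 \<Longrightarrow> Reg t \<sigma> p"
  shows "\<exists>M. (\<lambda>q. if G (fst q) \<noteq> 0 then G (fst q) ^ M * \<sigma> q else 0) \<in> sec (\<lambda>j. t j + int M * int (\<gamma> j)) X"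
proof -
  define good_at where "good_at M p \<longleftrightarrow> Reg (\<lambda>j. t j + int M * int (\<gamma> j)) (\<lambda>q. if G (fst q) \<noteq> 0 then G (fst q) ^ M * \<sigma> q else 0) p" for M p
  have "\<exists>b h N. hpoly b h \<and> h z \<noteq> 0 \<and> (\<forall>M\<ge>N. \<forall>p\<in>HC. h p \<noteq> 0 \<longrightarrow> good_at M p)"
    if z: "z \<in> HC" for z
  proof -
    define x where "x = point_of z"
    have x: "x \<in> X" "point_of z \<in> nbhd E x" using point_of_in[OF z] nbhd_self unfolding x_def by auto
    obtain b0 h0 where h0: "hpoly b0 h0" "h0 z \<noteq> 0" "\<forall>v\<in>HC. h0 v \<noteq> 0 \<longrightarrow> v \<in> cone (nbhd E x)"
      using nbh_nbhd[OF x(1) z x(2)] unfolding nbh_def by blast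
    obtain K where K: "\<And>j. j < r \<Longrightarrow> K j \<le> ns ! j" "chart_monom K z \<noteq> 0" by (rule ex_chart[OF z]) (rule that; assumption)
    define h where "h v = chart_monom K v * h0 v" for v
    have h: "hpoly (\<lambda>j. 1 + b0 j) h" unfolding h_def[abs_def] by (rule hpoly_mult[OF hpoly_chart_monom[OF K(1)] h0(1)])
    have Gh0: "hpoly (\<lambda>j. \<gamma> j + b0 j) (\<lambda>v. G v * h0 v)" by (rule hpoly_mult[OF G h0(1)])
    define quo where "quo i M a g \<longleftrightarrow> hpoly a g \<and> (\<forall>j<r. int (a j) = t j + int M * (int (\<gamma> j + b0 j) + 1)) \<and>
      (\<forall>v\<in>HC. G v * h0 v \<noteq> 0 \<longrightarrow> (chart_monom K v * (G v * h0 v)) ^ M * component x \<sigma> i v = g v)" for i M a g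
    have "\<exists>M0. \<forall>M\<ge>M0. \<exists>a g. quo i M a g" if i: "i < rk" for i
      unfolding quo_def
    proof (rule regular_quotient[OF Gh0 K(1)])
      fix p assume p: "p \<in> HC" "G p * h0 p \<noteq> 0"
      show "regular_at t (cone (nbhd E x)) p (component x \<sigma> i)"
        by (rule RegD[OF \<sigma> x(1) p(1) _ i]) (use p h0(3) in \<open>auto simp: cone_def\<close>)
    qed auto
    then obtain M0 where M0: "\<And>i M. i < rk \<Longrightarrow> M \<ge> M0 i \<Longrightarrow> \<exists>a g. quo i M a g" by metis
    \<comment> \<open>\<open>Suc\<close> reserves the extra factor G: it remains in the numerator
      and makes the quotient zero exactly where the extension by 0 requires it.\<close>
    define N where "N = Suc (\<Sum>i<rk. M0 i)"
    have "Reg (\<lambda>j. t j + int M * int (\<gamma> j)) (\<lambda>q. if G (fst q) \<noteq> 0 then G (fst q) ^ M * \<sigma> q else 0) p"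
      if M: "M \<ge> N" and p: "p \<in> HC" "h p \<noteq> 0" for M p
    proof (rule RegI[OF x(1) p(1)])
      have in_nb: "v \<in> HC \<Longrightarrow> h v \<noteq> 0 \<Longrightarrow> v \<in> cone (nbhd E x)" for v using h0(3) by (auto simp: h_def)
      show "point_of p \<in> nbhd E x" using in_nb[OF p] by (rule coneD)
      fix i assume i: "i < rk"
      obtain M' where M': "M = Suc M'" using M by (cases M) (auto simp: N_def)
      have "M0 i \<le> (\<Sum>i<rk. M0 i)" by (rule member_le_sum) (use i in auto)
      then have "M' \<ge> M0 i" using M M' by (simp add: N_def)
      from M0[OF i this] obtain a g where g: "hpoly a g" "\<forall>j<r. int (a j) = t j + int M' * (int (\<gamma> j + b0 j) + 1)"
        "\<forall>v\<in>HC. G v * h0 v \<noteq> 0 \<longrightarrow> (chart_monom K v * (G v * h0 v)) ^ M' * component x \<sigma> i v = g v" unfolding quo_def by (elim exE conjE)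
      show "regular_at (\<lambda>j. t j + int M * int (\<gamma> j)) (cone (nbhd E x)) p (component x (\<lambda>q. if G (fst q) \<noteq> 0 then G (fst q) ^ M * \<sigma> q else 0) i)"
      proof (rule regI)
        show "hpoly (\<lambda>j. (\<gamma> j + a j) + (1 + b0 j)) (\<lambda>v. (G v * g v) * h v)" by (rule hpoly_mult[OF hpoly_mult[OF G g(1)] h])
        show "hpoly (\<lambda>j. M' * (1 + b0 j) + (1 + b0 j)) (\<lambda>v. h v ^ M' * h v)" by (rule hpoly_mult[OF hpoly_power[OF h] h])
        show "int ((\<gamma> j + a j) + (1 + b0 j)) - int (M' * (1 + b0 j) + (1 + b0 j)) = t j + int M * int (\<gamma> j)" if "j < r" for j
          using g(2) that M' by (simp add: algebra_simps)
        show "h p ^ M' * h p \<noteq> 0" using p by simp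
        fix v assume v: "v \<in> HC" "h v ^ M' * h v \<noteq> 0"
        then have hv: "h v \<noteq> 0" by auto
        show "v \<in> cone (nbhd E x)" using in_nb v(1) hv .
        have e: "component x (\<lambda>q. if G (fst q) \<noteq> 0 then G (fst q) ^ M * \<sigma> q else 0) i v = (if G v \<noteq> 0 then G v ^ M * component x \<sigma> i v else 0)"
          using component_scale[of x "\<lambda>v. G v ^ M" \<sigma> i v] by (auto simp: component_def)
        show "component x (\<lambda>q. if G (fst q) \<noteq> 0 then G (fst q) ^ M * \<sigma> q else 0) i v = G v * g v * h v / (h v ^ M' * h v)"
        proof (cases "G v = 0")
          case False
          have "h0 v \<noteq> 0" using hv by (simp add: h_def)
          then have "g v = (G v * h v) ^ M' * component x \<sigma> i v" using g(3) v(1) False by (auto simp: h_def mult_ac)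
          then show ?thesis unfolding e using False hv by (simp add: M' power_mult_distrib)
        qed (simp add: e)
      qed
    qed
    then have "\<forall>M\<ge>N. \<forall>p\<in>HC. h p \<noteq> 0 \<longrightarrow> good_at M p" unfolding good_at_def by blast
    moreover have "h z \<noteq> 0" using K(2) h0(2) by (simp add: h_def)
    ultimately show ?thesis using h by (intro exI[of _ "\<lambda>j. 1 + b0 j"] exI[of _ h] exI[of _ N] conjI)
  qed
  then obtain b h N where bh: "\<And>z. z \<in> HC \<Longrightarrow> hpoly (b z) (h z)" "\<And>z. z \<in> HC \<Longrightarrow> h z z \<noteq> 0"
    and N: "\<And>z M p. z \<in> HC \<Longrightarrow> M \<ge> N z \<Longrightarrow> p \<in> HC \<Longrightarrow> h z p \<noteq> 0 \<Longrightarrow>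
      good_at M p"
    by metis
  obtain F where F: "finite F" "F \<subseteq> HC" "\<And>v. v \<in> HC \<Longrightarrow> \<exists>z\<in>F. h z v \<noteq> 0"
  proof (rule quasi_compact[of b h])
    show "hpoly (b z) (h z)" if "z \<in> HC" for z by (rule bh(1)[OF that])
    show "h z z \<noteq> 0" if "z \<in> HC" for z by (rule bh(2)[OF that])
  qed (rule that)
  define M where "M = (\<Sum>z\<in>F. N z)"
  show ?thesis
  proof (intro exI[of _ M], unfold sec_def, intro CollectI ballI)
    fix p assume "p \<in> cone X"
    then have p: "p \<in> HC" by (rule coneD)
    obtain z where z: "z \<in> F" "h z p \<noteq> 0" using F(3)[OF p] by blast
    have "N z \<le> M" unfolding M_def by (rule member_le_sum) (use z F in auto)
    then show "Reg (\<lambda>j. t j + int M * int (\<gamma> j)) (\<lambda>q. if G (fst q) \<noteq> 0 then G (fst q) ^ M * \<sigma> q else 0) p"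
      using N[of z M p] z F(2) p unfolding good_at_def by blast
  qed
qed

lemma cone_X: "cone X = HC"
  using point_of_in by (auto simp: cone_def)

end

context dual_functional
begin

text \<open>The functional gives a bundle map to the trivial bundle: its row at a point is pinned down by
  its values on global sections of all twists.\<close>

definition is_row :: "point \<Rightarrow> coords \<Rightarrow> (nat \<Rightarrow> complex) \<Rightarrow> bool" where
  "is_row x v \<rho> \<longleftrightarrow> (\<forall>a. \<forall>\<sigma>\<in>sec (\<lambda>j. int (a j)) X. dual_map a \<sigma> v = (\<Sum>i<rk. \<rho> i * component x \<sigma> i v))"

text \<open>Powers of G times the local frame extend to global sections \<open>E' i\<close>, and the
  values of \<open>dual_map\<close> on them determine the row. Conversely, a multiple of any global
  section is a combination of the \<open>E' i\<close> with polynomial coefficients, so linearity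
  over polynomials shows that this row computes \<open>dual_map\<close> everywhere near p.\<close>

lemma local_rows:
  assumes x: "x \<in> X" and p: "p \<in> HC" "point_of p \<in> nbhd E x"
  shows "\<exists>b G \<rho>. hpoly b G \<and> G p \<noteq> 0 \<and> (\<forall>v\<in>HC. G v \<noteq> 0 \<longrightarrow> v \<in> cone (nbhd E x)) \<and>
    (\<forall>i<rk. \<forall>v\<in>HC. G v \<noteq> 0 \<longrightarrow> regular_at (\<lambda>_. 0) (cone (nbhd E x)) v (\<rho> i)) \<and>
    (\<forall>v\<in>HC. G v \<noteq> 0 \<longrightarrow> is_row x v (\<lambda>i. \<rho> i v) \<and> (\<forall>\<rho>'. is_row x v \<rho>' \<longrightarrow> (\<forall>i<rk. \<rho>' i = \<rho> i v)))"
proof -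
  obtain b0 h0 where h0: "hpoly b0 h0" "h0 p \<noteq> 0" "\<forall>v\<in>HC. h0 v \<noteq> 0 \<longrightarrow> v \<in> cone (nbhd E x)"
    using nbh_nbhd[OF x p] unfolding nbh_def by blast
  obtain K where K: "\<And>j. j < r \<Longrightarrow> K j \<le> ns ! j" "chart_monom K p \<noteq> 0" by (rule ex_chart[OF p(1)]) (rule that; assumption)
  define G where "G v = chart_monom K v * h0 v" for v
  define \<gamma> where "\<gamma> j = 1 + b0 j" for j
  have G: "hpoly \<gamma> G" unfolding G_def[abs_def] \<gamma>_def[abs_def] by (rule hpoly_mult[OF hpoly_chart_monom[OF K(1)] h0(1)])
  have Gnb: "v \<in> cone (nbhd E x)" if "v \<in> HC" "G v \<noteq> 0" for v using h0(3) that by (auto simp: G_def)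
  \<comment> \<open>The frame of the trivialisation at x, rewritten in the trivialisation at each
    point itself as the encoding of sections demands.\<close>
  define fr where "fr i q = T (point_of (fst q)) x (point_of (fst q)) (snd q) i" for i q
  have cfr: "component x (fr i) l v = (if l = i then 1 else 0)" if v: "v \<in> cone (nbhd E x)" and il: "i < rk" "l < rk" for i l v
  proof -
    have vH: "v \<in> HC" "point_of v \<in> nbhd E x" using v by (auto dest: coneD)
    have P: "point_of v \<in> X" "point_of v \<in> nbhd E (point_of v)" using point_of_in[OF vH(1)] nbhd_self by auto
    have "component x (fr i) l v = T x x (point_of v) l i"
      unfolding component_def fr_def using T_trans[OF x P(1) x vH(2) P(2) vH(2) il(2,1)] by simp
    then show ?thesis using T_refl[OF x vH(2) il(2,1)] by simp
  qed
  define ext where "ext i M \<longleftrightarrow> (\<lambda>q. if G (fst q) \<noteq> 0 then G (fst q) ^ M * fr i q else 0) \<in> sec (\<lambda>j. 0 + int M * int (\<gamma> j)) X" for i M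
  have "\<exists>M. ext i M" if i: "i < rk" for i
    unfolding ext_def
  proof (rule extend_by_power[OF G])
    fix p' assume p': "p' \<in> HC" "G p' \<noteq> 0"
    have pn: "p' \<in> cone (nbhd E x)" using Gnb p' .
    show "Reg (\<lambda>_. 0) (fr i) p'"
    proof (rule RegI[OF x p'(1)])
      show "point_of p' \<in> nbhd E x" using pn by (rule coneD)
      fix l assume l: "l < rk"
      have "regular_at (\<lambda>_. 0) (cone (nbhd E x)) p' (\<lambda>_. if l = i then 1 else 0)"
        by (rule regular_at_const[OF nbh_nbhd[OF x p'(1)]]) (use pn in \<open>auto dest: coneD\<close>)
      then show "regular_at (\<lambda>_. 0) (cone (nbhd E x)) p' (component x (fr i) l)"
        by (rule regular_at_cong) (simp add: cfr i l)
    qed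
  qed
  then obtain M where M: "\<And>i. i < rk \<Longrightarrow> ext i (M i)"
    by metis
  define E' where "E' i q = (if G (fst q) \<noteq> 0 then G (fst q) ^ M i * fr i q else 0)" for i q
  define d where "d i j = M i * \<gamma> j" for i j
  have E': "E' i \<in> sec (\<lambda>j. int (d i j)) X" if "i < rk" for i
    using M[OF that] unfolding ext_def E'_def[abs_def] d_def by simp
  have cE': "component x (E' i) l v = (if l = i then G v ^ M i else 0)" if "v \<in> HC" "G v \<noteq> 0" "i < rk" "l < rk" for i l v
  proof -
    have "component x (E' i) l v = component x (\<lambda>q. G (fst q) ^ M i * fr i q) l v"
      by (rule component_cong) (use that in \<open>simp add: E'_def\<close>)
    then show ?thesis using component_scale[of x "\<lambda>v. G v ^ M i" "fr i" l v] cfr[OF Gnb[OF that(1,2)] that(3,4)] by simp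
  qed
  define \<rho> where "\<rho> i v = dual_map (d i) (E' i) v / G v ^ M i" for i v
  have regular_at_\<rho>: "regular_at (\<lambda>_. 0) (cone (nbhd E x)) v (\<rho> i)" if v: "v \<in> HC" "G v \<noteq> 0" for v i
  proof (rule regI)
    show "hpoly (\<lambda>j. d i j + \<gamma> j) (\<lambda>v. dual_map (d i) (E' i) v * G v)" by (rule hpoly_mult[OF hpoly_dual_map G])
    show "hpoly (\<lambda>j. d i j + \<gamma> j) (\<lambda>v. G v ^ M i * G v)" unfolding d_def by (rule hpoly_mult[OF hpoly_power[OF G] G])
    show "G v ^ M i * G v \<noteq> 0" using v by simp
    fix w assume w: "w \<in> HC" "G w ^ M i * G w \<noteq> 0"
    then show "w \<in> cone (nbhd E x)" using Gnb by auto
    show "\<rho> i w = dual_map (d i) (E' i) w * G w / (G w ^ M i * G w)" using w by (simp add: \<rho>_def)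
  qed simp
  have uniq: "\<rho>' i = \<rho> i v" if v: "v \<in> HC" "G v \<noteq> 0" and row: "is_row x v \<rho>'" and i: "i < rk" for v \<rho>' i
  proof -
    have "dual_map (d i) (E' i) v = (\<Sum>l<rk. \<rho>' l * component x (E' i) l v)" using row E'[OF i] unfolding is_row_def by blast
    also have "\<dots> = (\<Sum>l<rk. if l = i then \<rho>' i * G v ^ M i else 0)"
      by (rule sum.cong) (use cE'[OF v i] in auto)
    finally show ?thesis using v(2) i by (simp add: \<rho>_def)
  qed
  have row: "is_row x v (\<lambda>i. \<rho> i v)" if v: "v \<in> HC" "G v \<noteq> 0" for v
    unfolding is_row_def
  proof (intro allI ballI)
    fix a \<sigma> assume \<sigma>: "\<sigma> \<in> sec (\<lambda>j. int (a j)) X"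
    define quo where "quo i L a' g \<longleftrightarrow> hpoly a' g \<and> (\<forall>j<r. int (a' j) = int (a j) + int L * (int (\<gamma> j) + 1)) \<and>
      (\<forall>v\<in>HC. G v \<noteq> 0 \<longrightarrow> (chart_monom K v * G v) ^ L * component x \<sigma> i v = g v)" for i L a' g
    have "\<exists>L0. \<forall>L\<ge>L0. \<exists>a' g. quo i L a' g" if i: "i < rk" for i
      unfolding quo_def
    proof (rule regular_quotient[OF G K(1)])
      fix p assume p: "p \<in> HC" "G p \<noteq> 0"
      have "Reg (\<lambda>j. int (a j)) \<sigma> p" using \<sigma> p(1) unfolding sec_def cone_X by blast
      then show "regular_at (\<lambda>j. int (a j)) (cone (nbhd E x)) p (component x \<sigma> i)"
        by (rule RegD[OF _ x p(1) _ i]) (use Gnb[OF p] in \<open>rule coneD\<close>)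
    qed auto
    then obtain L0 where L0: "\<And>i L. i < rk \<Longrightarrow> L \<ge> L0 i \<Longrightarrow> \<exists>a' g. quo i L a' g" by metis
    define L where "L = (\<Sum>i<rk. L0 i)"
    define MM where "MM = (\<Sum>i<rk. M i)"
    have L: "L \<ge> L0 i" "MM \<ge> M i" if "i < rk" for i
      unfolding L_def MM_def by (rule member_le_sum; use that in auto)+
    have "\<forall>i. \<exists>a' g. i < rk \<longrightarrow> quo i L a' g" using L0 L(1) by blast
    then obtain a' g where quo: "\<And>i. i < rk \<Longrightarrow> quo i L (a' i) (g i)" by metis
    have g: "i < rk \<Longrightarrow> hpoly (a' i) (g i)"
      "i < rk \<Longrightarrow> j < r \<Longrightarrow> int (a' i j) = int (a j) + int L * (int (\<gamma> j) + 1)"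
      "i < rk \<Longrightarrow> v \<in> HC \<Longrightarrow> G v \<noteq> 0 \<Longrightarrow> (chart_monom K v * G v) ^ L * component x \<sigma> i v = g i v" for i j v
      using quo[of i] unfolding quo_def by blast+
    define c where "c j = (L * (1 + \<gamma> j) + MM * \<gamma> j + \<gamma> j)" for j
    \<comment> \<open>The first power clears the denominators of the components of \<sigma>, the
      second accommodates the different exponents \<open>M i\<close>, and the last factor G makes
      both sides of \<open>id\<close> zero where G vanishes.\<close>
    define Q where "Q v = (chart_monom K v * G v) ^ L * G v ^ MM * G v" for v
    have Q: "hpoly c Q"
      unfolding Q_def[abs_def] c_def[abs_def]
      by (intro hpoly_mult[OF hpoly_mult[OF hpoly_power[OF hpoly_mult[OF hpoly_chart_monom[OF K(1)] G]] hpoly_power[OF G]] G])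
    define R where "R i v = G v * G v ^ (MM - M i) * g i v" for i v
    have R: "hpoly (\<lambda>j. \<gamma> j + (MM - M i) * \<gamma> j + a' i j) (R i)" if "i < rk" for i
      unfolding R_def[abs_def] by (intro hpoly_mult[OF hpoly_mult[OF G hpoly_power[OF G]] g(1)[OF that]])
    have id: "Q (fst q) * \<sigma> q = (\<Sum>i<rk. R i (fst q) * E' i q)" if q: "q \<in> pl Uall" for q
    proof -
      obtain w l where wl: "q = (w, l)" by (cases q)
      have w: "w \<in> HC" "l < rk" using q wl by (auto simp: pl_def dest: coneD)
      show ?thesis
      proof (cases "G w = 0")
        case True
        then show ?thesis by (simp add: wl Q_def R_def)
      next
        case False
        have wn: "point_of w \<in> nbhd E x" using Gnb[OF w(1) False] by (rule coneD)
        have P: "point_of w \<in> X" "point_of w \<in> nbhd E (point_of w)" using point_of_in[OF w(1)] nbhd_self by auto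
        have "\<sigma> (w, l) = (\<Sum>i<rk. T (point_of w) x (point_of w) l i * component x \<sigma> i w)"
          using component_self[OF w, of \<sigma>] component_change[OF x P(1) w(1) wn P(2) w(2), of \<sigma>] by simp
        then have "Q w * \<sigma> (w, l) = (\<Sum>i<rk. G w ^ MM * G w * (T (point_of w) x (point_of w) l i * ((chart_monom K w * G w) ^ L * component x \<sigma> i w)))"
          by (simp add: Q_def sum_distrib_left mult_ac)
        also have "\<dots> = (\<Sum>i<rk. R i w * E' i (w, l))"
        proof (rule sum.cong[OF refl])
          fix i assume "i \<in> {..<rk}"
          then have i: "i < rk" by simp
          have "G w ^ MM = G w ^ (MM - M i) * G w ^ M i" using L(2)[OF i] by (simp flip: power_add)
          then show "G w ^ MM * G w * (T (point_of w) x (point_of w) l i * ((chart_monom K w * G w) ^ L * component x \<sigma> i w)) = R i w * E' i (w, l)"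
            using False unfolding g(3)[OF i w(1) False] by (simp add: R_def E'_def fr_def mult_ac)
        qed
        finally show ?thesis by (simp add: wl)
      qed
    qed
    have "Q v * dual_map a \<sigma> v = dual_map (\<lambda>j. a j + c j) (\<lambda>q. Q (fst q) * \<sigma> q) v"
      by (rule dual_map_mult[OF \<sigma> Q, symmetric]) simp
    also have "\<dots> = dual_map (\<lambda>j. a j + c j) (\<lambda>q. \<Sum>i<rk. R i (fst q) * E' i q) v"
      by (rule dual_map_cong[OF id])
    also have "\<dots> = (\<Sum>i<rk. R i v * dual_map (d i) (E' i) v)"
      unfolding dual_map_sum
    proof (rule sum.cong[OF refl])
      fix i assume "i \<in> {..<rk}"
      then have i: "i < rk" by simp
      show "dual_map (\<lambda>j. a j + c j) (\<lambda>q. R i (fst q) * E' i q) v = R i v * dual_map (d i) (E' i) v"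
      proof (rule dual_map_mult[OF E'[OF i] R[OF i]])
        fix j assume j: "j < r"
        have "MM * \<gamma> j = (MM - M i) * \<gamma> j + M i * \<gamma> j" using L(2)[OF i] by (simp flip: distrib_right)
        then have "int (a j + c j) = int (d i j + (\<gamma> j + (MM - M i) * \<gamma> j + a' i j))"
          using g(2)[OF i j] by (simp add: c_def d_def algebra_simps del: of_nat_mult)
             (simp add: algebra_simps)
        then show "a j + c j = d i j + (\<gamma> j + (MM - M i) * \<gamma> j + a' i j)" by linarith
      qed
    qed
    also have "\<dots> = (\<Sum>i<rk. G v * G v ^ MM * ((chart_monom K v * G v) ^ L * component x \<sigma> i v) * \<rho> i v)"
    proof (rule sum.cong[OF refl])
      fix i assume "i \<in> {..<rk}"
      then have i: "i < rk" by simp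
      have "G v ^ MM = G v ^ (MM - M i) * G v ^ M i" using L(2)[OF i] by (simp flip: power_add)
      then show "R i v * dual_map (d i) (E' i) v = G v * G v ^ MM * ((chart_monom K v * G v) ^ L * component x \<sigma> i v) * \<rho> i v"
        unfolding g(3)[OF i v] using v(2) by (simp add: R_def \<rho>_def)
    qed
    also have "\<dots> = Q v * (\<Sum>i<rk. \<rho> i v * component x \<sigma> i v)"
      by (simp add: Q_def sum_distrib_left mult_ac)
    finally have "Q v * dual_map a \<sigma> v = Q v * (\<Sum>i<rk. \<rho> i v * component x \<sigma> i v)" .
    moreover have "Q v \<noteq> 0" using v(2) by (auto simp: Q_def G_def)
    ultimately show "dual_map a \<sigma> v = (\<Sum>i<rk. \<rho> i v * component x \<sigma> i v)" by simp
  qed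
  show ?thesis
    by (rule exI[of _ \<gamma>], rule exI[of _ G], rule exI[of _ \<rho>])
       (use G Gnb regular_at_\<rho> row uniq K(2) h0(2) in \<open>auto simp: G_def\<close>)
qed

definition row :: "point \<Rightarrow> coords \<Rightarrow> nat \<Rightarrow> complex" where
  "row x v = (SOME \<rho>. is_row x v \<rho>)"

text \<open>Uniqueness in \<open>local_rows\<close> forces the pointwise choice \<open>row\<close>
  to agree near every point with the regular functions found there, which makes it regular.\<close>

lemma row:
  assumes x: "x \<in> X" and p: "p \<in> HC" "point_of p \<in> nbhd E x"
  shows "is_row x p (row x p)" "\<And>\<rho> i. is_row x p \<rho> \<Longrightarrow> i < rk \<Longrightarrow> \<rho> i = row x p i"
    "\<And>i. i < rk \<Longrightarrow> regular_at (\<lambda>_. 0) (cone (nbhd E x)) p (\<lambda>v. row x v i)"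
proof -
  from local_rows[OF assms] obtain b G \<rho> where G: "hpoly b G" "G p \<noteq> 0" "\<forall>v\<in>HC. G v \<noteq> 0 \<longrightarrow> v \<in> cone (nbhd E x)"
    "\<forall>i<rk. \<forall>v\<in>HC. G v \<noteq> 0 \<longrightarrow> regular_at (\<lambda>_. 0) (cone (nbhd E x)) v (\<rho> i)"
    "\<forall>v\<in>HC. G v \<noteq> 0 \<longrightarrow> is_row x v (\<lambda>i. \<rho> i v) \<and> (\<forall>\<rho>'. is_row x v \<rho>' \<longrightarrow> (\<forall>i<rk. \<rho>' i = \<rho> i v))"
    by (elim exE conjE)
  have isr: "is_row x v (row x v)" if "v \<in> HC" "G v \<noteq> 0" for v
    unfolding row_def by (rule someI[of "is_row x v" "\<lambda>i. \<rho> i v"]) (use G(5) that in blast)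
  then have eq: "row x v i = \<rho> i v" if "v \<in> HC" "G v \<noteq> 0" "i < rk" for v i using G(5) that by blast
  show "is_row x p (row x p)" using isr p(1) G(2) .
  show "\<rho>' i = row x p i" if "is_row x p \<rho>'" "i < rk" for \<rho>' i
    using eq[OF p(1) G(2) that(2)] G(2,5) p(1) that by auto
  fix i assume i: "i < rk"
  have "regular_at (\<lambda>_. 0) (cone (nbhd E x) \<inter> {v \<in> HC. G v \<noteq> 0}) p (\<rho> i)"
    using G(4) i p(1) G(2) by (intro regular_at_restrict nbh_hpoly[OF G(1,2)]) blast
  then have "regular_at (\<lambda>_. 0) (cone (nbhd E x) \<inter> {v \<in> HC. G v \<noteq> 0}) p (\<lambda>v. row x v i)"
    by (rule regular_at_cong) (use eq i in auto)
  then show "regular_at (\<lambda>_. 0) (cone (nbhd E x)) p (\<lambda>v. row x v i)" by (rule regular_at_mono) auto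
qed

text \<open>The transported row satisfies the defining property of a row at y, so uniqueness
  applies.\<close>

lemma row_change:
  assumes "x \<in> X" "y \<in> X" "v \<in> HC" "point_of v \<in> nbhd E x" "point_of v \<in> nbhd E y" "i < rk"
  shows "row y v i = (\<Sum>l<rk. row x v l * T x y (point_of v) l i)"
proof -
  have "is_row y v (\<lambda>i. \<Sum>l<rk. row x v l * T x y (point_of v) l i)"
    unfolding is_row_def
  proof (intro allI ballI)
    fix a \<sigma> assume \<sigma>: "\<sigma> \<in> sec (\<lambda>j. int (a j)) X"
    have "dual_map a \<sigma> v = (\<Sum>l<rk. row x v l * component x \<sigma> l v)"
      using row(1)[OF assms(1,3,4)] \<sigma> unfolding is_row_def by blast
    also have "\<dots> = (\<Sum>l<rk. row x v l * (\<Sum>i<rk. T x y (point_of v) l i * component y \<sigma> i v))"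
      by (intro sum.cong refl arg_cong[of _ _ "(*) _"] component_change) (use assms in auto)
    also have "\<dots> = (\<Sum>i<rk. (\<Sum>l<rk. row x v l * T x y (point_of v) l i) * component y \<sigma> i v)"
      unfolding sum_distrib_left sum_distrib_right by (subst sum.swap) (simp add: mult_ac)
    finally show "dual_map a \<sigma> v = (\<Sum>i<rk. (\<Sum>l<rk. row x v l * T x y (point_of v) l i) * component y \<sigma> i v)" .
  qed
  from row(2)[OF assms(2,3,5) this assms(6)] show ?thesis by simp
qed

end

section \<open>Splitting\<close>

lemma mat_two_mult: "mat 2 2 f * mat 2 2 g = mat 2 2 (\<lambda>(i, j). f (i, 0) * g (0, j) + f (i, 1) * g (1, j))"
  for f g :: "nat \<times> nat \<Rightarrow> complex"
proof -
  have "{0..<2::nat} = {0, 1}" by auto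
  then show ?thesis by (intro eq_matI) (simp_all add: scalar_prod_def)
qed

lemma mat_two_eqI:
  assumes "f (0, 0) = g (0, 0)" "f (0, 1) = g (0, 1)" "f (1, 0) = g (1, 0)" "f (1, 1) = g (1, 1)"
  shows "mat 2 2 f = mat 2 2 g"
proof (rule eq_matI)
  fix i j assume "i < dim_row (mat 2 2 g)" "j < dim_col (mat 2 2 g)"
  then have "i = 0 \<or> i = 1" "j = 0 \<or> j = 1" by auto
  then show "mat 2 2 f $$ (i, j) = mat 2 2 g $$ (i, j)" using assms by auto
qed simp_all

context vbun
begin

text \<open>The analogue of \<open>Phi\<close> for E itself. It is not an instance, because the
  twist by degree 0 is presented on smaller trivialising sets, while the normalization speaks of
  sections of E.\<close>

lemma section_to_model:
  assumes s: "s \<in> vb_sections ns E X"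
  defines "\<sigma> \<equiv> (\<lambda>q. s (point_of (fst q)) (point_of (fst q)) $ snd q)"
  shows "\<sigma> \<in> sec (\<lambda>_. 0) X" "x \<in> X \<Longrightarrow> v \<in> HC \<Longrightarrow> point_of v \<in> nbhd E x \<Longrightarrow> i < rk \<Longrightarrow> component x \<sigma> i v = s x (point_of v) $ i"
proof -
  show c: "component x \<sigma> i v = s x (point_of v) $ i" if "x \<in> X" "v \<in> HC" "point_of v \<in> nbhd E x" "i < rk" for x v i
  proof -
    define P where "P = point_of v"
    have P: "P \<in> X" "P \<in> nbhd E P" "P \<in> nbhd E x" using point_of_in[OF that(2)] nbhd_self that(3) unfolding P_def by auto
    define A where "A = vbundle.trans E x P P"
    have A: "A \<in> carrier_mat rk rk" unfolding A_def by (rule trans_carrier[OF that(1) P(1,3,2)])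
    have sv: "s P P \<in> carrier_vec rk" using vb_sectionsD(1)[OF s P(1)] P unfolding regular_vec_on_def by blast
    have "s x P = A *\<^sub>v s P P" unfolding A_def by (rule vb_sectionsD(2)[OF s that(1) P(1)]) (use P in auto)
    then have "s x P $ i = (\<Sum>l<rk. A $$ (i, l) * s P P $ l)"
      using A sv that(4) by (simp add: scalar_prod_def atLeast0LessThan)
    then show ?thesis by (simp add: component_def T_def A_def \<sigma>_def P_def)
  qed
  show "\<sigma> \<in> sec (\<lambda>_. 0) X"
    unfolding sec_def
  proof (intro CollectI ballI)
    fix p assume "p \<in> cone X"
    then have p: "p \<in> HC" by (rule coneD)
    define x where "x = point_of p"
    have x: "x \<in> X" "point_of p \<in> nbhd E x" using point_of_in[OF p] nbhd_self unfolding x_def by auto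
    show "Reg (\<lambda>_. 0) \<sigma> p"
    proof (rule RegI[OF x(1) p x(2)])
      fix i assume i: "i < rk"
      have "regular_on ns (X \<inter> nbhd E x) (\<lambda>P. s x P $ i)"
        using vb_sectionsD(1)[OF s x(1)] i unfolding regular_vec_on_def by blast
      from regular_on_regular_at[OF this p] have "regular_at (\<lambda>_. 0) (cone (X \<inter> nbhd E x)) p (\<lambda>v. s x (point_of v) $ i)"
        using point_of_in[OF p] x(2) by simp
      then show "regular_at (\<lambda>_. 0) (cone (X \<inter> nbhd E x)) p (component x \<sigma> i)"
        by (rule regular_at_cong) (use c[OF x(1)] i in \<open>auto simp: cone_def\<close>)
    qed
  qed
qed

lemma nonzero_model_section:
  assumes "\<not> H0_vanishes ns E"
  obtains \<sigma> q where "\<sigma> \<in> sec (\<lambda>_. 0) X" "q \<in> pl X" "\<sigma> q \<noteq> 0"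
proof -
  obtain s x P where s: "s \<in> vb_sections ns E X" and x: "x \<in> X" "P \<in> nbhd E x" "P \<in> X" and nz: "s x P \<noteq> 0\<^sub>v rk"
    using assms unfolding H0_vanishes_def section_eq_def zero_section_def by blast
  define \<sigma> where "\<sigma> = (\<lambda>q. s (point_of (fst q)) (point_of (fst q)) $ snd q)"
  define v where "v = hcoord P"
  have v: "v \<in> HC" "point_of v = P" using hcoord_HC[OF x(3)] point_of_hcoord[OF x(3)] by (auto simp: v_def)
  have "s x P \<in> carrier_vec rk" using vb_sectionsD(1)[OF s x(1)] x unfolding regular_vec_on_def by blast
  then obtain i where i: "i < rk" "s x P $ i \<noteq> 0" using nz by (metis carrier_vecD eq_vecI index_zero_vec(1,2))
  have "component x \<sigma> i v \<noteq> 0"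
    using section_to_model(2)[OF s x(1) v(1) _ i(1)] v x(2) i(2) unfolding \<sigma>_def by simp
  then obtain l where "l < rk" "\<sigma> (v, l) \<noteq> 0" unfolding component_def by (metis (no_types, lifting) lessThan_iff mult_zero_right sum.neutral)
  moreover have "\<sigma> \<in> sec (\<lambda>_. 0) X" unfolding \<sigma>_def by (rule section_to_model(1)[OF s])
  ultimately show ?thesis using that[of \<sigma> "(v, l)"] v x(3) by (simp add: pl_def cone_def)
qed

text \<open>On a factor P^0 the only coordinate vanishes nowhere. Dividing a nonzero section by it
  would give a nonzero section of a negative twist, which the normalization excludes.\<close>

lemma positive_dims:
  assumes norm: "normalized ns E" and j: "j < r"
  shows "ns ! j \<ge> 1"
proof (rule ccontr)
  assume "\<not> ?thesis"
  then have z: "ns ! j = 0" by simp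
  define t :: "nat \<Rightarrow> int" where "t = (\<lambda>_. 0)(j := 0 - 1)"
  have "(\<forall>i<r. t i \<le> 0) \<and> (\<exists>i<r. t i \<noteq> 0)" using j by (auto simp: t_def)
  then have H: "H0_vanishes ns (twist ns E t)" using norm unfolding normalized_def by blast
  obtain \<sigma> q where \<sigma>: "\<sigma> \<in> sec (\<lambda>_. 0) X" "q \<in> pl X" "\<sigma> q \<noteq> 0"
    using nonzero_model_section norm unfolding normalized_def by blast
  have X: "X \<subseteq> Dc j 0" using GS.D_cover[OF _ j] z by auto
  have "(\<lambda>q. inverse (fst q (j, 0)) * \<sigma> q) \<in> sec t X"
    unfolding t_def by (rule GS.sec_inv[OF j _ X]) (use \<sigma>(1) in \<open>simp_all add: fun_upd_idem\<close>)
  from H0_zero[OF H this \<sigma>(2)] have "fst q (j, 0) = 0" using \<sigma>(3) by simp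
  moreover have "q \<in> pl (Dc j 0)" using \<sigma>(2) GS.pl_mono[OF X] by blast
  ultimately show False using GS.x_nz by blast
qed

text \<open>Supplies the vanishing required by \<open>section_zero\<close> with l = i + 1. For l = 1
  the degree t is nonzero and the normalization applies. For l \<ge> 2 the box bounds l by the sum
  of the dimensions, so i = l - 1 lies in the range of the cohomological hypothesis.\<close>

lemma section_not_in_W:
  assumes norm: "normalized ns E"
    and H: "\<And>i t. 1 \<le> i \<Longrightarrow> i \<le> sum_list ns - 1 \<Longrightarrow> (\<forall>j<length ns. - int (ns ! j) \<le> t j \<and> t j \<le> 0) \<Longrightarrow>
      (\<Sum>j<length ns. t j) = - int i - 1 \<Longrightarrow> cohomology_vanishes ns (twist ns E t) i"
    and \<sigma>: "\<sigma> \<in> sec (\<lambda>_. 0) X" "q0 \<in> pl X" "\<sigma> q0 \<noteq> 0"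
  shows "(\<lambda>q. laurent (\<lambda>_. -1) (fst q) * \<sigma> q) \<notin> W"
proof
  assume "(\<lambda>q. laurent (\<lambda>_. -1) (fst q) * \<sigma> q) \<in> W"
  then obtain e where e: "\<forall>j<r. \<forall>k\<le>ns ! j. e j k \<in> sec (GS.canon_deg r) (GS.Uexc j k)"
    "\<forall>q\<in>pl Uall. laurent (\<lambda>_. -1) (fst q) * \<sigma> q = (\<Sum>j<r. \<Sum>k\<le>ns ! j. e j k q)"
    unfolding W_def by (elim CollectE exE conjE)
  have "\<sigma> q0 = 0"
  proof (rule GS.section_zero[OF _ _ \<sigma>(1,2)])
    fix t l assume t: "\<forall>j<r. - int (ns ! j) \<le> t j \<and> t j \<le> 0" "(\<Sum>j<r. t j) = - int l" "l \<ge> 1"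
    show "GS.van t l"
    proof (cases "l = 1")
      case True
      have "\<exists>j<r. t j \<noteq> 0"
      proof (rule ccontr)
        assume "\<not> ?thesis"
        then have "(\<Sum>j<r. t j) = 0" by simp
        then show False using t(2) True by simp
      qed
      then have "H0_vanishes ns (twist ns E t)" using norm t(1) unfolding normalized_def by blast
      then show ?thesis using van_from_H0 True by simp
    next
      case False
      have "(\<Sum>j<r. - t j) \<le> (\<Sum>j<r. int (ns ! j))" by (rule sum_mono) (use t(1) in auto)
      then have "int l \<le> int (sum_list ns)"
        using t(2) by (simp add: sum_negf sum_list_sum_nth atLeast0LessThan)
      then have "cohomology_vanishes ns (twist ns E t) (l - 1)"
        by (intro H) (use t False in auto)
      from van_from_cohomology[OF this] show ?thesis using t(3) by simp
    qed
  next
    show "ns ! j \<ge> 1" if "j < r" for j by (rule positive_dims[OF norm that])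
    show "e j k \<in> sec (GS.canon_deg r) (GS.Uexc j k)" if "j < r" "k \<le> ns ! j" for j k using e(1) that by blast
    fix q assume q: "q \<in> pl GS.Uall"
    have "laurent (\<lambda>_. -1) (fst q) = (\<Prod>j<r. \<Prod>k\<le>ns ! j. inverse (fst q (j, k)))"
      unfolding laurent_def prod_CI by (simp add: power_int_minus)
    then show "\<sigma> q * (\<Prod>j<r. \<Prod>k\<le>ns ! j. inverse (fst q (j, k))) = (\<Sum>j<r. \<Sum>k\<le>ns ! j. e j k q)"
      using bspec[OF e(2), of q] q by (simp add: Uall_def mult.commute)
  qed
  then show False using \<sigma>(3) by simp
qed

lemma regular_onI:
  assumes "U \<subseteq> X" "\<And>p. p \<in> HC \<Longrightarrow> point_of p \<in> U \<Longrightarrow> regular_at (\<lambda>_. 0) (cone U) p \<rho>" "\<And>P. P \<in> U \<Longrightarrow> \<phi> P = \<rho> (hcoord P)"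
  shows "regular_on ns U \<phi>"
proof -
  have "regular_on ns U (\<lambda>P. \<rho> (hcoord P))" by (rule regular_at_regular_on[OF assms(1,2)])
  show ?thesis
    unfolding regular_on_def
  proof
    fix P assume "P \<in> U"
    from bspec[OF \<open>regular_on ns U (\<lambda>P. \<rho> (hcoord P))\<close>[unfolded regular_on_def] this]
    obtain V a g h where V: "openin (zariski ns) V" "P \<in> V" "V \<subseteq> U" "multihomogeneous ns a g" "multihomogeneous ns a h"
      "\<forall>Q\<in>V. mpoly_eval h (hcoord Q) \<noteq> 0 \<and> \<rho> (hcoord Q) = mpoly_eval g (hcoord Q) / mpoly_eval h (hcoord Q)"
      by (elim exE conjE)
    have "\<forall>Q\<in>V. mpoly_eval h (hcoord Q) \<noteq> 0 \<and> \<phi> Q = mpoly_eval g (hcoord Q) / mpoly_eval h (hcoord Q)"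
      using V(3,6) assms(3) by auto
    with V(1-5) show "\<exists>V a g h. openin (zariski ns) V \<and> P \<in> V \<and> V \<subseteq> U \<and> multihomogeneous ns a g \<and> multihomogeneous ns a h \<and>
      (\<forall>Q\<in>V. mpoly_eval h (hcoord Q) \<noteq> 0 \<and> \<phi> Q = mpoly_eval g (hcoord Q) / mpoly_eval h (hcoord Q))"
      by (intro exI conjI)
  qed
qed

lemma line_bundleI:
  assumes regular_at: "\<And>x y. x \<in> X \<Longrightarrow> y \<in> X \<Longrightarrow> regular_on ns (nbhd E x \<inter> nbhd E y) (f x y)"
    and refl: "\<And>x P. x \<in> X \<Longrightarrow> P \<in> nbhd E x \<Longrightarrow> f x x P = 1"
    and mult: "\<And>x y z P. x \<in> X \<Longrightarrow> y \<in> X \<Longrightarrow> z \<in> X \<Longrightarrow> P \<in> nbhd E x \<Longrightarrow> P \<in> nbhd E y \<Longrightarrow> P \<in> nbhd E z \<Longrightarrow>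
      f x y P * f y z P = f x z P"
  shows "is_line_bundle ns \<lparr>rank = 1, nbhd = nbhd E, trans = (\<lambda>x y P. mat 1 1 (\<lambda>_. f x y P))\<rparr>"
proof -
  have 1: "mat 1 1 (\<lambda>_. a) * mat 1 1 (\<lambda>_. b) = mat 1 1 (\<lambda>_. a * b)" for a b :: complex
    by (rule eq_matI) (auto simp: scalar_prod_def)
  have 2: "mat 1 1 (\<lambda>_. 1) = (1\<^sub>m 1 :: complex mat)" by (rule eq_matI) auto
  show ?thesis
    unfolding is_line_bundle_def vector_bundle_def vbundle.simps
  proof (intro conjI ballI)
    fix x y assume xy: "x \<in> X" "y \<in> X"
    show "regular_mat_on ns 1 (nbhd E x \<inter> nbhd E y) (\<lambda>P. mat 1 1 (\<lambda>_. f x y P))"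
      unfolding regular_mat_on_def using regular_at[OF xy] by simp
  next
    fix x P assume "x \<in> X" "P \<in> nbhd E x"
    then show "mat 1 1 (\<lambda>_. f x x P) = 1\<^sub>m 1" using refl 2 by simp
  next
    fix x y z P assume "x \<in> X" "y \<in> X" "z \<in> X" "P \<in> nbhd E x \<inter> nbhd E y \<inter> nbhd E z"
    then show "mat 1 1 (\<lambda>_. f x y P) * mat 1 1 (\<lambda>_. f y z P) = mat 1 1 (\<lambda>_. f x z P)"
      unfolding 1 using mult[of x y z P] by simp
  qed (use nbhd_open nbhd_self in simp_all)
qed

text \<open>The isomorphism sends a vector e to the pair of R(e) and the wedge of S and e, with
  values in the sum of the trivial bundle and det E. In local frames its matrix is \<open>A\<close>,
  of determinant R(S) = 1, and \<open>B\<close> is the adjugate of \<open>A\<close>.\<close>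

lemma split_of_retraction:
  assumes rk2: "rk = 2"
    and S: "\<And>x p i. x \<in> X \<Longrightarrow> p \<in> HC \<Longrightarrow> point_of p \<in> nbhd E x \<Longrightarrow> i < 2 \<Longrightarrow> regular_at (\<lambda>_. 0) (cone (nbhd E x)) p (\<lambda>v. S x v i)"
    and R: "\<And>x p i. x \<in> X \<Longrightarrow> p \<in> HC \<Longrightarrow> point_of p \<in> nbhd E x \<Longrightarrow> i < 2 \<Longrightarrow> regular_at (\<lambda>_. 0) (cone (nbhd E x)) p (\<lambda>v. R x v i)"
    and SC: "\<And>x y v i. x \<in> X \<Longrightarrow> y \<in> X \<Longrightarrow> v \<in> HC \<Longrightarrow> point_of v \<in> nbhd E x \<Longrightarrow> point_of v \<in> nbhd E y \<Longrightarrow> i < 2 \<Longrightarrow>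
      S x v i = (\<Sum>l<2. T x y (point_of v) i l * S y v l)"
    and RC: "\<And>x y v i. x \<in> X \<Longrightarrow> y \<in> X \<Longrightarrow> v \<in> HC \<Longrightarrow> point_of v \<in> nbhd E x \<Longrightarrow> point_of v \<in> nbhd E y \<Longrightarrow> i < 2 \<Longrightarrow>
      R y v i = (\<Sum>l<2. R x v l * T x y (point_of v) l i)"
    and RS: "\<And>x v. x \<in> X \<Longrightarrow> v \<in> HC \<Longrightarrow> point_of v \<in> nbhd E x \<Longrightarrow> (\<Sum>i<2. R x v i * S x v i) = 1"
  shows "splits_two ns E"
proof -
  have two: "{..<2::nat} = {0, 1}" by auto
  have less2: "i < (2::nat) \<longleftrightarrow> i = 0 \<or> i = 1" for i by auto
  define A where "A x P = mat 2 2 (\<lambda>(i, j). if i = 0 then R x (hcoord P) j else if j = 0 then - S x (hcoord P) 1 else S x (hcoord P) 0)" for x P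
  define B where "B x P = mat 2 2 (\<lambda>(i, j). if j = 0 then S x (hcoord P) i else if i = 0 then - R x (hcoord P) 1 else R x (hcoord P) 0)" for x P
  define dt where "dt x y P = T x y P 0 0 * T x y P 1 1 - T x y P 0 1 * T x y P 1 0" for x y P
  define L where "L = \<lparr>rank = 1, nbhd = nbhd E, trans = (\<lambda>x y P. mat 1 1 (\<lambda>_. 1))\<rparr>"
  define M where "M = \<lparr>rank = 1, nbhd = nbhd E, trans = (\<lambda>x y P. mat 1 1 (\<lambda>_. dt x y P))\<rparr>"
  have hc: "hcoord P \<in> HC" "point_of (hcoord P) = P" "hcoord P \<in> cone U \<longleftrightarrow> P \<in> U" if "P \<in> nbhd E x" "x \<in> X" for P x U
    using hcoord_HC point_of_hcoord nbhd_X[OF that(2,1)] by (auto simp: cone_def)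
  have NX: "nbhd E x \<inter> nbhd E y \<subseteq> X" if "x \<in> X" for x y using nbhd_X[OF that] by blast
  have det_regular_at: "regular_on ns (nbhd E x \<inter> nbhd E y) (dt x y)" if xy: "x \<in> X" "y \<in> X" for x y
  proof (rule regular_onI[OF NX[OF xy(1)]])
    fix p assume p: "p \<in> HC" "point_of p \<in> nbhd E x \<inter> nbhd E y"
    let ?N = "cone (nbhd E x) \<inter> cone (nbhd E y)"
    have t: "regular_at (\<lambda>_. 0) ?N p (\<lambda>v. T x y (point_of v) i j)" if "i < 2" "j < 2" for i j
      by (rule T_regular_at) (use xy p that rk2 in auto)
    have m: "regular_at (\<lambda>_. 0) ?N p (\<lambda>v. T x y (point_of v) i j * T x y (point_of v) k l)" if "i < 2" "j < 2" "k < 2" "l < 2" for i j k l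
      using regular_at_mult[OF t[OF that(1,2)] t[OF that(3,4)]] by simp
    have "regular_at (\<lambda>_. 0) ?N p (\<lambda>v. T x y (point_of v) 0 0 * T x y (point_of v) 1 1 + (-1) * (T x y (point_of v) 0 1 * T x y (point_of v) 1 0))"
      by (intro regular_at_add regular_at_cmult m) auto
    then have "regular_at (\<lambda>_. 0) ?N p (\<lambda>v. dt x y (point_of v))" by (simp add: dt_def)
    then show "regular_at (\<lambda>_. 0) (cone (nbhd E x \<inter> nbhd E y)) p (\<lambda>v. dt x y (point_of v))"
      by (rule regular_at_mono) (auto simp: cone_def)
  next
    fix P assume "P \<in> nbhd E x \<inter> nbhd E y"
    then show "dt x y P = dt x y (point_of (hcoord P))" using hc(2)[of P x] xy by simp
  qed
  have one_regular_at: "regular_on ns (nbhd E x \<inter> nbhd E y) (\<lambda>_. c)" if xy: "x \<in> X" "y \<in> X" for x y c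
    by (rule regular_onI[OF NX[OF xy(1)], where \<rho> = "\<lambda>_. c"])
       (auto intro!: regular_at_const nbh_open openin_Int nbhd_open xy)
  have det_refl: "dt x x P = 1" if "x \<in> X" "P \<in> nbhd E x" for x P
    using T_refl[OF that] rk2 by (simp add: dt_def)
  have det_trans: "dt x y P * dt y z P = dt x z P" if xyz: "x \<in> X" "y \<in> X" "z \<in> X" "P \<in> nbhd E x" "P \<in> nbhd E y" "P \<in> nbhd E z" for x y z P
  proof -
    have t: "T x z P i j = T x y P i 0 * T y z P 0 j + T x y P i 1 * T y z P 1 j" if "i < 2" "j < 2" for i j
      using T_trans[OF xyz, of i j] that rk2 by (simp add: two)
    show ?thesis unfolding dt_def by (simp add: t algebra_simps)
  qed
  have Lb: "is_line_bundle ns L"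
    unfolding L_def by (rule line_bundleI) (use one_regular_at in auto)
  have Mb: "is_line_bundle ns M"
    unfolding M_def by (rule line_bundleI[OF det_regular_at det_refl det_trans])
  have entry: "regular_on ns (nbhd E x) (\<lambda>P. S x (hcoord P) i)" "regular_on ns (nbhd E x) (\<lambda>P. R x (hcoord P) i)"
    "regular_on ns (nbhd E x) (\<lambda>P. - S x (hcoord P) i)" "regular_on ns (nbhd E x) (\<lambda>P. - R x (hcoord P) i)"
    if x: "x \<in> X" and i: "i < 2" for x i
  proof -
    have U: "nbhd E x \<subseteq> X" using nbhd_X[OF x] by blast
    show "regular_on ns (nbhd E x) (\<lambda>P. S x (hcoord P) i)" by (rule regular_at_regular_on[OF U S[OF x _ _ i]])
    show "regular_on ns (nbhd E x) (\<lambda>P. R x (hcoord P) i)" by (rule regular_at_regular_on[OF U R[OF x _ _ i]])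
    show "regular_on ns (nbhd E x) (\<lambda>P. - S x (hcoord P) i)"
      by (rule regular_at_regular_on[OF U, of "\<lambda>v. - S x v i"]) (use regular_at_cmult[OF S[OF x _ _ i], of _ "-1"] in simp)
    show "regular_on ns (nbhd E x) (\<lambda>P. - R x (hcoord P) i)"
      by (rule regular_at_regular_on[OF U, of "\<lambda>v. - R x v i"]) (use regular_at_cmult[OF R[OF x _ _ i], of _ "-1"] in simp)
  qed
  have regA: "regular_mat_on ns 2 (nbhd E x) (A x)" and regB: "regular_mat_on ns 2 (nbhd E x) (B x)" if x: "x \<in> X" for x
    unfolding regular_mat_on_def A_def B_def using entry[OF x] by (auto simp: less2)
  have RS2: "R x v 0 * S x v 0 + R x v 1 * S x v 1 = 1" if "x \<in> X" "v \<in> HC" "point_of v \<in> nbhd E x" for x v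
    using RS[OF that] by (simp add: two)
  have AB: "A x P * B x P = 1\<^sub>m 2" "B x P * A x P = 1\<^sub>m 2" if x: "x \<in> X" "P \<in> nbhd E x" for x P
  proof -
    note e = RS2[OF x(1) hc(1)[OF x(2,1)], unfolded hc(2)[OF x(2,1)], OF x(2)]
    show "A x P * B x P = 1\<^sub>m 2"
      unfolding A_def B_def mat_two_mult one_mat_def by (rule mat_two_eqI) (use e in \<open>simp_all add: algebra_simps\<close>)
    show "B x P * A x P = 1\<^sub>m 2"
      unfolding A_def B_def mat_two_mult one_mat_def by (rule mat_two_eqI) (use e in \<open>simp_all add: algebra_simps\<close>)
  qed
  \<comment> \<open>The first row is the transformation rule of R. In the second row both arguments
    of the wedge are multiplied by the transition matrix, which produces its determinant
    \<open>dt\<close>.\<close>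
  have comm: "A x P * vbundle.trans E x y P = vbundle.trans (vb_sum L M) x y P * A y P"
    if xy: "x \<in> X" "y \<in> X" "P \<in> nbhd E x" "P \<in> nbhd E y" for x y P
  proof -
    define v where "v = hcoord P"
    have v: "v \<in> HC" "point_of v = P" using hc xy v_def by auto
    have Tm: "vbundle.trans E x y P = mat 2 2 (\<lambda>(i, j). T x y P i j)"
      by (rule eq_matI) (use trans_carrier[OF xy] rk2 in \<open>auto simp: T_def\<close>)
    have Fm: "vbundle.trans (vb_sum L M) x y P = mat 2 2 (\<lambda>(i, j). if i = j then (if i = 0 then 1 else dt x y P) else 0)"
      by (rule eq_matI) (auto simp: vb_sum_def L_def M_def less2)
    have s: "S x v i = T x y P i 0 * S y v 0 + T x y P i 1 * S y v 1" if "i < 2" for i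
      using SC[OF xy(1,2) v(1) _ _ that] v(2) xy by (simp add: two)
    have rr: "R y v i = R x v 0 * T x y P 0 i + R x v 1 * T x y P 1 i" if "i < 2" for i
      using RC[OF xy(1,2) v(1) _ _ that] v(2) xy by (simp add: two)
    show ?thesis
      unfolding Tm Fm A_def v_def[symmetric] mat_two_mult
      by (rule mat_two_eqI) (simp_all add: s rr dt_def algebra_simps)
  qed
  let ?F = "vb_sum L M"
  have nb: "nbhd ?F x = nbhd E x" for x by (simp add: vb_sum_def L_def M_def)
  have rank: "rk = rank ?F" by (simp add: rk2 vb_sum_def L_def M_def)
  have mats: "\<forall>x\<in>X. regular_mat_on ns rk (nbhd E x \<inter> nbhd ?F x) (A x) \<and> regular_mat_on ns rk (nbhd E x \<inter> nbhd ?F x) (B x) \<and>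
      (\<forall>P\<in>nbhd E x \<inter> nbhd ?F x. A x P * B x P = 1\<^sub>m rk \<and> B x P * A x P = 1\<^sub>m rk)"
    using regA regB AB by (simp add: nb rk2)
  have comms: "\<forall>x\<in>X. \<forall>y\<in>X. \<forall>P\<in>nbhd E x \<inter> nbhd ?F x \<inter> (nbhd E y \<inter> nbhd ?F y).
      A x P * vbundle.trans E x y P = vbundle.trans ?F x y P * A y P"
    by (intro ballI comm) simp_all
  have "vb_iso ns E ?F"
    unfolding vb_iso_def by (rule conjI[OF rank], rule exI[of _ A], rule exI[of _ B], rule conjI[OF mats comms])
  then show ?thesis unfolding splits_two_def using Lb Mb by blast
qed

end

theorem corollary2p13:
  fixes ns :: "nat list" and E :: vbundle and d :: nat
  assumes "d = sum_list ns"
    and "vector_bundle ns E"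
    and "rank E = 2"
    and "normalized ns E"
    and "\<And>i t. 1 \<le> i \<Longrightarrow> i \<le> d - 1 \<Longrightarrow>
           (\<forall>j<length ns. - int (ns ! j) \<le> t j \<and> t j \<le> 0) \<Longrightarrow>
           (\<Sum>j<length ns. t j) = - int i - 1 \<Longrightarrow>
           cohomology_vanishes ns (twist ns E t) i"
  shows "splits_two ns E"
proof -
  interpret vbun ns E by unfold_locales (rule assms(2))
  have "\<not> H0_vanishes ns E" using assms(4) by (simp add: normalized_def)
  then obtain \<sigma> q0 where \<sigma>: "\<sigma> \<in> sec (\<lambda>_. 0) X" "q0 \<in> pl X" "\<sigma> q0 \<noteq> 0"
    by (rule nonzero_model_section)
  define u where "u = (\<lambda>q. laurent (\<lambda>_. -1) (fst q) * \<sigma> q)"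
  have u: "u \<notin> W" unfolding u_def
    by (rule section_not_in_W[OF assms(4) _ \<sigma>]) (use assms(1,5) in blast)
  obtain \<phi> :: "(coords \<times> nat \<Rightarrow> complex) \<Rightarrow> complex" where \<phi>: "\<And>f g. \<phi> (\<lambda>q. f q + g q) = \<phi> f + \<phi> g"
    "\<And>c f. \<phi> (\<lambda>q. c * f q) = c * \<phi> f" "\<And>f. f \<in> W \<Longrightarrow> \<phi> f = 0" "\<phi> u = 1"
  proof (rule separating_functional[OF W_zero _ _ u])
    show "(\<lambda>q. f q + g q) \<in> W" if "f \<in> W" "g \<in> W" for f g using that by (rule W_add)
    show "(\<lambda>q. c * f q) \<in> W" if "f \<in> W" for c f using that by (rule W_cmult)
  qed (rule that)
  interpret dual_functional ns E \<phi> by unfold_locales (use \<phi> in auto)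
  have \<sigma>0: "\<sigma> \<in> sec (\<lambda>j. int 0) X" using \<sigma>(1) by simp
  \<comment> \<open>The normalization of \<phi> at \<open>u\<close> makes the image of the section
    the constant 1; this is the identity R(S) = 1 of the retraction.\<close>
  have f1: "dual_map (\<lambda>_. 0) \<sigma> v = 1" for v unfolding dual_map_zero using \<phi>(4) by (simp add: u_def)
  show ?thesis
  proof (rule split_of_retraction[OF assms(3), where S = "\<lambda>x v i. component x \<sigma> i v" and R = row])
    fix x p i assume x: "x \<in> X" "p \<in> HC" "point_of p \<in> nbhd E x" and "i < (2::nat)"
    then have i: "i < rk" by (simp only: assms(3))
    have "Reg (\<lambda>_. 0) \<sigma> p" using \<sigma>(1) x(2) unfolding sec_def cone_X by blast
    from RegD[OF this x i] show "regular_at (\<lambda>_. 0) (cone (nbhd E x)) p (\<lambda>v. component x \<sigma> i v)" .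
    show "regular_at (\<lambda>_. 0) (cone (nbhd E x)) p (\<lambda>v. row x v i)" by (rule row(3)[OF x i])
  next
    fix x y v i assume xy: "x \<in> X" "y \<in> X" "v \<in> HC" "point_of v \<in> nbhd E x" "point_of v \<in> nbhd E y" and "i < (2::nat)"
    then have i: "i < rk" by (simp only: assms(3))
    show "component x \<sigma> i v = (\<Sum>l<2. T x y (point_of v) i l * component y \<sigma> l v)"
      using component_change[OF xy(2,1,3,5,4) i, of \<sigma>] unfolding assms(3) .
    show "row y v i = (\<Sum>l<2. row x v l * T x y (point_of v) l i)"
      using row_change[OF xy i] unfolding assms(3) .
  next
    fix x v assume x: "x \<in> X" "v \<in> HC" "point_of v \<in> nbhd E x"
    have "dual_map (\<lambda>_. 0) \<sigma> v = (\<Sum>i<rk. row x v i * component x \<sigma> i v)"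
      by (rule bspec[OF spec[OF row(1)[OF x, unfolded is_row_def], of "\<lambda>_. 0"] \<sigma>0])
    then show "(\<Sum>i<2. row x v i * component x \<sigma> i v) = 1" unfolding f1 assms(3) by simp
  qed
qed

end
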